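(* Let $(\mathfrak H_1,J_1)$ and $(\mathfrak H_2,J_2)$ be Kreĭn spaces, $\mathfrak H=\mathfrak H_1\oplus\mathfrak H_2$, $J=\begin{pmatrix} J_1 & 0 \\ 0 & J_2 \end{pmatrix}$. Let $$T_1=\begin{pmatrix} T_{11} \\ T_{21} \end{pmatrix}:(\mathfrak H_1,J_1)\to\begin{pmatrix} (\mathfrak H_1,J_1) \\ (\mathfrak H_2,J_2) \end{pmatrix}$$ be a bounded operator, symmetric in the Kreĭn space sense, i.e. $T_{11}=T_{11}^{[*]}\in[(\mathfrak H_1,J_1)]$, with $\nu_-(I-T_{11}^*T_{11})=\kappa<\infty$, and let $J_{11}=\operatorname{sign}(I-T_{11}^*T_{11})$. Consider the pair of completion problems for $$A_\pm^0=\begin{pmatrix} I\pm T_{11} & \pm T_{21}^{[*]} \\ \pm T_{21} & \ast \end{pmatrix}$$ with $A_\pm=I\pm T$, under the minimal index conditions $\nu_-(I+JT)=\nu_-(I+J_1T_{11})$ and $\nu_-(I-JT)=\nu_-(I-J_1T_{11})$, respectively. Then these completion problems have a solution $I\pm T$ for some $T=T^{[*]}$ with $\nu_-(I-T^*T)=\kappa$ if and only if $$\nu_-(I-T_{11}^*T_{11})=\nu_-(I-T_1^*T_1).$$ If this condition is satisfied, then the following facts hold: (i) The completion problems for $A_+^0$ and $A_-^0$ have $J_2$-minimal solutions $A_+$ and $A_-$, respectively. (ii) The operators $T_m:=A_+-I$ and $T_M:=I-A_-$ belong to $\operatorname{Ext}_{J_2T_1,\kappa}(-1,1)$. (iii)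 The operators $T_m$ and $T_M$ have the block form $$T_m=\begin{pmatrix} T_{11} & J_1D_{T_{11}}V^* \\ J_2VD_{T_{11}} & -J_2+J_2V(I-J_1T_{11})J_{11}V^* \end{pmatrix},$$ $$T_M=\begin{pmatrix} T_{11} & J_1D_{T_{11}}V^* \\ J_2VD_{T_{11}} & J_2-J_2V(I+J_1T_{11})J_{11}V^* \end{pmatrix},$$ where $D_{T_{11}}:=|I-T_{11}^*T_{11}|^{1/2}$ and $V:=\operatorname{clos}(J_2T_{21}D_{T_{11}}^{[-1]})$. (iv) The operators $T_m$ and $T_M$ are $J_2$-extremal extensions of $T_1$: $$T\in\operatorname{Ext}_{J_2T_1,\kappa}(-1,1)\quad\text{iff}\quad T=T^{[*]}\in[(\mathfrak H,J)],\ \ T_m\le_{J_2}T\le_{J_2}T_M.$$ (v) The operators $T_m$ and $T_M$ are connected via $$(-T)_m=-T_M,\qquad(-T)_M=-T_m,$$ where $(-T)_m$ and $(-T)_M$ denote the operators $T_m$ and $T_M$ constructed for $-T_1$ in place of $T_1$.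
   Context: A Kreĭn space $(\mathcal H,J_{\mathcal H})$ is a Hilbert space with a fundamental symmetry $J_{\mathcal H}=J_{\mathcal H}^*=J_{\mathcal H}^{-1}$ and inner product $[\varphi,\psi]=(J_{\mathcal H}\varphi,\psi)$. $[(\mathcal H,J_{\mathcal H})]$ denotes the bounded everywhere defined operators on $\mathcal H$. For bounded $X:\mathcal H\to\mathcal K$, $X^*$ is the Hilbert space adjoint and $X^{[*]}=J_{\mathcal H}X^*J_{\mathcal K}$ is the Kreĭn space adjoint. For a bounded Hilbert-space selfadjoint $H$, $\nu_-(H)$ is the dimension of the spectral subspace corresponding to $(-\infty,0)$. $|C|=(C^*C)^{1/2}$; $\operatorname{sign}(H)$ is defined by functional calculus with $\operatorname{sign}(t)=1$ for $t\ge0$ and $-1$ for $t<0$. For nonnegative bounded $D$, the Moore–Penrose inverse $D^{[-1]}$ has domain $\operatorname{ran}D\oplus\ker D$, vanishes on $\ker D$, and maps $y\in\operatorname{ran}D$ to the unique $x\in\overline{\operatorname{ran}}\,D$ with $Dx=y$. $\operatorname{clos}$ is operator closure. Completion problems: one seeks $T=T^{[*]}\in[(\mathfrak H,J)]$ extending $T_1$ (first block column $T_1$, hence upper right block $T_{21}^{[*]}$) such that $A_+=I+T$ and $A_-=I-T$ complete $A_+^0$ and $A_-^0$ with the stated minimal index conditions. $\operatorname{Ext}_{J_2T_1,\kappa}(-1,1)$ is the set of all such $T$, satisfying both conditions $\nu_-(I\pm JT)=\nu_-(I\pm J_1T_{11})$. A solution of the single problem for $A_+^0$ (resp. $A_-^0$)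 is a completion $I+T$ (resp. $I-T$), with $T=T^{[*]}$ extending $T_1$, satisfying the corresponding single index condition; "$J_2$-minimal" means smallest among these solutions for $\le_{J_2}$. Ordering: for Kreĭn-selfadjoint $X,Y$, $X\ge Y$ means $[(X-Y)f,f]\ge0$ for all $f$. It is written $\le_{J_2}$ because for completions of the same incomplete operator it amounts to the ordering of the lower right blocks in $(\mathfrak H_2,J_2)$: $J_2(X_{22}-Y_{22})\ge0$. *)

theory Defs
  imports "HOL-Analysis.Analysis" "HOL-Library.Nonpos_Ints"
begin

section \<open>Complex Hilbert spaces\<close>

text \<open>
  The library provides real inner product spaces only.  A complex Hilbert space is a real one
  whose real inner product is the real part of a sesquilinear form.  The form is linear in its
  first argument.  Separability and nontriviality are not required.
\<close>

class complex_hilbert_space = real_inner + complete_space +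
  fixes scaleC :: "complex \<Rightarrow> 'a \<Rightarrow> 'a"  (infixr \<open>*\<^sub>C\<close> 75)
    and cinner :: "'a \<Rightarrow> 'a \<Rightarrow> complex"
  assumes scaleC_add_right: "c *\<^sub>C (x + y) = c *\<^sub>C x + c *\<^sub>C y"
    and scaleC_add_left: "(c + d) *\<^sub>C x = c *\<^sub>C x + d *\<^sub>C x"
    and scaleC_scaleC: "c *\<^sub>C d *\<^sub>C x = (c * d) *\<^sub>C x"
    and scaleR_scaleC: "r *\<^sub>R x = complex_of_real r *\<^sub>C x"
    and cinner_commute: "cinner x y = cnj (cinner y x)"
    and cinner_add_left: "cinner (x + y) z = cinner x z + cinner y z"
    and cinner_scaleC_left: "cinner (c *\<^sub>C x) y = c * cinner x y"
    and inner_eq_Re_cinner: "inner x y = Re (cinner x y)"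

instantiation complex :: complex_hilbert_space
begin
definition "scaleC_complex (c :: complex) (x :: complex) = c * x"
definition "cinner_complex (x :: complex) (y :: complex) = x * cnj y"
instance
  by standard (auto simp: scaleC_complex_def cinner_complex_def inner_complex_def
      algebra_simps scaleR_conv_of_real)
end

text \<open>The product type is the orthogonal sum.\<close>

instantiation prod :: (complex_hilbert_space, complex_hilbert_space) complex_hilbert_space
begin
definition "scaleC_prod c x = (c *\<^sub>C fst x, c *\<^sub>C snd x)"
definition "cinner_prod x y = cinner (fst x) (fst y) + cinner (snd x) (snd y)"
instance
proof
  fix x y :: "'a \<times> 'b"
  show "cinner x y = cnj (cinner y x)"
    unfolding cinner_prod_def by (metis cinner_commute complex_cnj_add)
qed (auto simp: scaleC_prod_def cinner_prod_def inner_prod_def scaleC_add_right scaleC_add_left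
      scaleC_scaleC scaleR_scaleC cinner_add_left cinner_scaleC_left inner_eq_Re_cinner
      algebra_simps prod_eq_iff)
end

global_interpretation complex_vector:
  vector_space "scaleC :: complex \<Rightarrow> 'a \<Rightarrow> 'a::complex_hilbert_space"
proof
  fix x :: 'a
  show "1 *\<^sub>C x = x"
    using scaleR_scaleC[of 1 x] by simp
qed (simp_all add: scaleC_add_right scaleC_add_left scaleC_scaleC)

text \<open>
  Infinite Hilbert dimensions are not distinguished.  For finite dimension the Hilbert dimension
  and the linear dimension agree.
\<close>

definition subspace_dim :: "'a::complex_hilbert_space set \<Rightarrow> enat" where
  "subspace_dim S =
     (if \<exists>B. finite B \<and> S \<subseteq> complex_vector.span B then enat (complex_vector.dim S) else \<infinity>)"


section \<open>Bounded operators\<close>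

text \<open>
  The type of bounded linear functions contains all bounded real-linear maps; the bounded
  operators of the theory are its complex-linear members.
\<close>

definition complex_linear ::
    "('a::complex_hilbert_space \<Rightarrow>\<^sub>L 'b::complex_hilbert_space) \<Rightarrow> bool" where
  "complex_linear A \<longleftrightarrow> (\<forall>c x. A (c *\<^sub>C x) = c *\<^sub>C A x)"

definition adj :: "('a::complex_hilbert_space \<Rightarrow>\<^sub>L 'b::complex_hilbert_space) \<Rightarrow> ('b \<Rightarrow>\<^sub>L 'a)" where
  "adj A = (THE B :: 'b \<Rightarrow>\<^sub>L 'a. \<forall>x y. cinner (A x) y = cinner x (B y))"

definition nonneg_op :: "('a::complex_hilbert_space \<Rightarrow>\<^sub>L 'a) \<Rightarrow> bool" where
  "nonneg_op A \<longleftrightarrow> complex_linear A \<and> (\<forall>x. cinner (A x) x \<in> \<real>\<^sub>\<ge>\<^sub>0)"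

definition sqrt_op :: "('a::complex_hilbert_space \<Rightarrow>\<^sub>L 'a) \<Rightarrow> ('a \<Rightarrow>\<^sub>L 'a)" where
  "sqrt_op A = (THE R. nonneg_op R \<and> R o\<^sub>L R = A)"

definition abs_op ::
    "('a::complex_hilbert_space \<Rightarrow>\<^sub>L 'b::complex_hilbert_space) \<Rightarrow> ('a \<Rightarrow>\<^sub>L 'a)" where
  "abs_op C = sqrt_op (adj C o\<^sub>L C)"

definition column_op :: "('a::real_normed_vector \<Rightarrow>\<^sub>L 'b::real_normed_vector) \<Rightarrow>
    ('a \<Rightarrow>\<^sub>L 'c::real_normed_vector) \<Rightarrow> ('a \<Rightarrow>\<^sub>L ('b \<times> 'c))" where
  "column_op A B = Blinfun (\<lambda>x. (A x, B x))"

lemma column_op_apply [simp]: "column_op A B x = (A x, B x)"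
  unfolding column_op_def
  by (simp add: bounded_linear_Blinfun_apply bounded_linear_Pair blinfun.bounded_linear_right)

text \<open>\<open>block_op A B C D\<close> is the operator matrix with rows \<open>A B\<close> and \<open>C D\<close>.\<close>

definition block_op ::
    "('a::real_normed_vector \<Rightarrow>\<^sub>L 'c::real_normed_vector) \<Rightarrow>
     ('b::real_normed_vector \<Rightarrow>\<^sub>L 'c) \<Rightarrow>
     ('a \<Rightarrow>\<^sub>L 'd::real_normed_vector) \<Rightarrow> ('b \<Rightarrow>\<^sub>L 'd) \<Rightarrow> (('a \<times> 'b) \<Rightarrow>\<^sub>L ('c \<times> 'd))" where
  "block_op A B C D =
     column_op ((A o\<^sub>L fst_blinfun) + (B o\<^sub>L snd_blinfun)) ((C o\<^sub>L fst_blinfun) + (D o\<^sub>L snd_blinfun))"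

lemma block_op_apply [simp]: "block_op A B C D (x, y) = (A x + B y, C x + D y)"
  by (simp add: block_op_def blinfun.add_left)


section \<open>Spectral measures and functional calculus\<close>

definition orth_projection :: "('a::complex_hilbert_space \<Rightarrow>\<^sub>L 'a) \<Rightarrow> bool" where
  "orth_projection P \<longleftrightarrow> complex_linear P \<and> P o\<^sub>L P = P \<and> adj P = P"

definition projection_valued_measure ::
    "(real set \<Rightarrow> ('a::complex_hilbert_space \<Rightarrow>\<^sub>L 'a)) \<Rightarrow> bool" where
  "projection_valued_measure E \<longleftrightarrow>
     (\<forall>B \<in> sets borel. orth_projection (E B)) \<and>
     E UNIV = id_blinfun \<and>
     (\<forall>B \<in> sets borel. \<forall>C \<in> sets borel. E (B \<inter> C) = E B o\<^sub>L E C) \<and>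
     (\<forall>B :: nat \<Rightarrow> real set. range B \<subseteq> sets borel \<longrightarrow> disjoint_family B \<longrightarrow>
        (\<forall>x. (\<lambda>n. E (B n) x) sums E (\<Union>n. B n) x))"

definition scalar_measure ::
    "(real set \<Rightarrow> ('a::complex_hilbert_space \<Rightarrow>\<^sub>L 'a)) \<Rightarrow> 'a \<Rightarrow> real measure" where
  "scalar_measure E x = measure_of UNIV (sets borel) (\<lambda>B. ennreal (Re (cinner (E B x) x)))"

text \<open>
  \<open>H\<close> is the integral of \<open>t\<close> with respect to \<open>E\<close>; by polarization the quadratic form
  suffices.
\<close>

definition is_spectral_measure ::
    "(real set \<Rightarrow> ('a::complex_hilbert_space \<Rightarrow>\<^sub>L 'a)) \<Rightarrow> ('a \<Rightarrow>\<^sub>L 'a) \<Rightarrow> bool" where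
  "is_spectral_measure E H \<longleftrightarrow> projection_valued_measure E \<and>
     (\<forall>x. integrable (scalar_measure E x) (\<lambda>t. t) \<and>
          cinner (H x) x = complex_of_real (\<integral>t. t \<partial>scalar_measure E x))"

text \<open>
  The spectral theorem makes the spectral measure of a bounded selfadjoint operator unique on
  Borel sets.  Its values on other sets are irrelevant, so the choice below does not matter.
\<close>

definition spectral_measure ::
    "('a::complex_hilbert_space \<Rightarrow>\<^sub>L 'a) \<Rightarrow> real set \<Rightarrow> ('a \<Rightarrow>\<^sub>L 'a)" where
  "spectral_measure H = (SOME E. is_spectral_measure E H)"

text \<open>For selfadjoint \<open>H\<close> and bounded Borel \<open>f\<close>.\<close>

definition functional_calculus ::
    "(real \<Rightarrow> real) \<Rightarrow> ('a::complex_hilbert_space \<Rightarrow>\<^sub>L 'a) \<Rightarrow> ('a \<Rightarrow>\<^sub>L 'a)" where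
  "functional_calculus f H = (THE A. complex_linear A \<and>
     (\<forall>x. cinner (A x) x = complex_of_real (\<integral>t. f t \<partial>scalar_measure (spectral_measure H) x)))"

text \<open>Unlike the library function \<open>sgn\<close>, the sign of zero is one.\<close>

definition sign_op :: "('a::complex_hilbert_space \<Rightarrow>\<^sub>L 'a) \<Rightarrow> ('a \<Rightarrow>\<^sub>L 'a)" where
  "sign_op = functional_calculus (\<lambda>t. if t \<ge> 0 then 1 else - 1)"

definition nu_minus :: "('a::complex_hilbert_space \<Rightarrow>\<^sub>L 'a) \<Rightarrow> enat" where
  "nu_minus H = subspace_dim (range (spectral_measure H {..<0}))"


section \<open>Unbounded operators as graphs\<close>

definition graph_op :: "('a::real_normed_vector \<Rightarrow>\<^sub>L 'b::real_normed_vector) \<Rightarrow> ('a \<times> 'b) set" where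
  "graph_op A = {(x, A x) | x. True}"

text \<open>
  The Moore-Penrose inverse of a nonnegative operator \<open>D\<close>, with domain \<open>ran D + ker D\<close>.  The
  vector \<open>x\<close> is the unique preimage of \<open>D x\<close> in the closure of \<open>ran D\<close>.
\<close>

definition moore_penrose :: "('a::complex_hilbert_space \<Rightarrow>\<^sub>L 'a) \<Rightarrow> ('a \<times> 'a) set" where
  "moore_penrose D = {(D x + z, x) | x z. x \<in> closure (range D) \<and> D z = 0}"

text \<open>
  Composition of graphs is the relational \<open>O\<close> (the first factor is applied first), and operator
  closure is topological closure of the graph.  Hence this is the graph of
  \<open>clos (J2 T21 D^[-1])\<close>.
\<close>

definition V_graph :: "('b::complex_hilbert_space \<Rightarrow>\<^sub>L 'b) \<Rightarrow>
    ('a::complex_hilbert_space \<Rightarrow>\<^sub>L 'b) \<Rightarrow> ('a \<Rightarrow>\<^sub>L 'a) \<Rightarrow> ('a \<times> 'b) set" where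
  "V_graph J2 T21 D = closure (moore_penrose D O graph_op (J2 o\<^sub>L T21))"


section \<open>Krein spaces\<close>

text \<open>A Krein space is a Hilbert space type together with a fundamental symmetry \<open>J\<close>.\<close>

definition fundamental_symmetry :: "('a::complex_hilbert_space \<Rightarrow>\<^sub>L 'a) \<Rightarrow> bool" where
  "fundamental_symmetry J \<longleftrightarrow> complex_linear J \<and> adj J = J \<and> J o\<^sub>L J = id_blinfun"

definition krein_inner ::
    "('a::complex_hilbert_space \<Rightarrow>\<^sub>L 'a) \<Rightarrow> 'a \<Rightarrow> 'a \<Rightarrow> complex" where
  "krein_inner J x y = cinner (J x) y"

definition krein_adj ::
    "('a::complex_hilbert_space \<Rightarrow>\<^sub>L 'a) \<Rightarrow> ('b::complex_hilbert_space \<Rightarrow>\<^sub>L 'b) \<Rightarrow>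
     ('a \<Rightarrow>\<^sub>L 'b) \<Rightarrow> ('b \<Rightarrow>\<^sub>L 'a)" where
  "krein_adj JH JK X = JH o\<^sub>L adj X o\<^sub>L JK"

definition krein_selfadjoint ::
    "('a::complex_hilbert_space \<Rightarrow>\<^sub>L 'a) \<Rightarrow> ('a \<Rightarrow>\<^sub>L 'a) \<Rightarrow> bool" where
  "krein_selfadjoint J T \<longleftrightarrow> complex_linear T \<and> T = krein_adj J J T"

definition krein_le ::
    "('a::complex_hilbert_space \<Rightarrow>\<^sub>L 'a) \<Rightarrow> ('a \<Rightarrow>\<^sub>L 'a) \<Rightarrow> ('a \<Rightarrow>\<^sub>L 'a) \<Rightarrow> bool" where
  "krein_le J X Y \<longleftrightarrow> (\<forall>f. krein_inner J ((Y - X) f) f \<in> \<real>\<^sub>\<ge>\<^sub>0)"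

definition sum_symmetry ::
    "('a::complex_hilbert_space \<Rightarrow>\<^sub>L 'a) \<Rightarrow> ('b::complex_hilbert_space \<Rightarrow>\<^sub>L 'b) \<Rightarrow>
     (('a \<times> 'b) \<Rightarrow>\<^sub>L ('a \<times> 'b))" where
  "sum_symmetry J1 J2 = block_op J1 0 0 J2"


section \<open>Completion problems\<close>

definition completes ::
    "(('a::complex_hilbert_space \<times> 'b::complex_hilbert_space) \<Rightarrow>\<^sub>L ('a \<times> 'b)) \<Rightarrow>
     ('a \<Rightarrow>\<^sub>L 'a) \<Rightarrow> ('b \<Rightarrow>\<^sub>L 'a) \<Rightarrow> ('a \<Rightarrow>\<^sub>L 'b) \<Rightarrow> bool" where
  "completes A A11 A12 A21 \<longleftrightarrow> (\<exists>A22. complex_linear A22 \<and> A = block_op A11 A12 A21 A22)"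

definition selfadjoint_extension ::
    "('a::complex_hilbert_space \<Rightarrow>\<^sub>L 'a) \<Rightarrow> ('b::complex_hilbert_space \<Rightarrow>\<^sub>L 'b) \<Rightarrow>
     ('a \<Rightarrow>\<^sub>L 'a) \<Rightarrow> ('a \<Rightarrow>\<^sub>L 'b) \<Rightarrow> (('a \<times> 'b) \<Rightarrow>\<^sub>L ('a \<times> 'b)) \<Rightarrow> bool" where
  "selfadjoint_extension J1 J2 T11 T21 T \<longleftrightarrow>
     krein_selfadjoint (sum_symmetry J1 J2) T \<and> (\<forall>x. T (x, 0) = column_op T11 T21 x)"

text \<open>
  \<open>completion_via s\<close> for \<open>s = 1\<close> and \<open>s = -1\<close>: the extension \<open>T\<close> of the column \<open>T11, T21\<close> yields a
  solution \<open>I + s T\<close> of the single completion problem for \<open>A_+^0\<close> and \<open>A_-^0\<close>, respectively,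
  under its minimal index condition.
\<close>

definition completion_via :: "real \<Rightarrow>
     ('a::complex_hilbert_space \<Rightarrow>\<^sub>L 'a) \<Rightarrow> ('b::complex_hilbert_space \<Rightarrow>\<^sub>L 'b) \<Rightarrow>
     ('a \<Rightarrow>\<^sub>L 'a) \<Rightarrow> ('a \<Rightarrow>\<^sub>L 'b) \<Rightarrow> (('a \<times> 'b) \<Rightarrow>\<^sub>L ('a \<times> 'b)) \<Rightarrow> bool" where
  "completion_via s J1 J2 T11 T21 T \<longleftrightarrow>
     selfadjoint_extension J1 J2 T11 T21 T \<and>
     completes (id_blinfun + s *\<^sub>R T)
       (id_blinfun + s *\<^sub>R T11) (s *\<^sub>R krein_adj J1 J2 T21) (s *\<^sub>R T21) \<and>
     nu_minus (id_blinfun + s *\<^sub>R (sum_symmetry J1 J2 o\<^sub>L T))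
       = nu_minus (id_blinfun + s *\<^sub>R (J1 o\<^sub>L T11))"

definition completion_solutions :: "real \<Rightarrow>
     ('a::complex_hilbert_space \<Rightarrow>\<^sub>L 'a) \<Rightarrow> ('b::complex_hilbert_space \<Rightarrow>\<^sub>L 'b) \<Rightarrow>
     ('a \<Rightarrow>\<^sub>L 'a) \<Rightarrow> ('a \<Rightarrow>\<^sub>L 'b) \<Rightarrow> (('a \<times> 'b) \<Rightarrow>\<^sub>L ('a \<times> 'b)) set" where
  "completion_solutions s J1 J2 T11 T21 =
     {id_blinfun + s *\<^sub>R T | T. completion_via s J1 J2 T11 T21 T}"

text \<open>The set \<open>Ext_{J2 T1, kappa}(-1, 1)\<close>.\<close>

definition Ext_set ::
    "('a::complex_hilbert_space \<Rightarrow>\<^sub>L 'a) \<Rightarrow> ('b::complex_hilbert_space \<Rightarrow>\<^sub>L 'b) \<Rightarrow>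
     ('a \<Rightarrow>\<^sub>L 'a) \<Rightarrow> ('a \<Rightarrow>\<^sub>L 'b) \<Rightarrow> (('a \<times> 'b) \<Rightarrow>\<^sub>L ('a \<times> 'b)) set" where
  "Ext_set J1 J2 T11 T21 =
     {T. completion_via 1 J1 J2 T11 T21 T \<and> completion_via (- 1) J1 J2 T11 T21 T}"

text \<open>
  \<open>J2\<close>-minimal means smallest.  Solutions of one problem differ only in the lower right block, so
  the ordering on the whole space is the ordering of these blocks with respect to \<open>J2\<close>.
\<close>

definition J2_minimal_solution :: "real \<Rightarrow>
     ('a::complex_hilbert_space \<Rightarrow>\<^sub>L 'a) \<Rightarrow> ('b::complex_hilbert_space \<Rightarrow>\<^sub>L 'b) \<Rightarrow>
     ('a \<Rightarrow>\<^sub>L 'a) \<Rightarrow> ('a \<Rightarrow>\<^sub>L 'b) \<Rightarrow> (('a \<times> 'b) \<Rightarrow>\<^sub>L ('a \<times> 'b)) \<Rightarrow> bool" where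
  "J2_minimal_solution s J1 J2 T11 T21 A \<longleftrightarrow>
     A \<in> completion_solutions s J1 J2 T11 T21 \<and>
     (\<forall>B \<in> completion_solutions s J1 J2 T11 T21. krein_le (sum_symmetry J1 J2) A B)"

definition minimal_completion :: "real \<Rightarrow>
     ('a::complex_hilbert_space \<Rightarrow>\<^sub>L 'a) \<Rightarrow> ('b::complex_hilbert_space \<Rightarrow>\<^sub>L 'b) \<Rightarrow>
     ('a \<Rightarrow>\<^sub>L 'a) \<Rightarrow> ('a \<Rightarrow>\<^sub>L 'b) \<Rightarrow> (('a \<times> 'b) \<Rightarrow>\<^sub>L ('a \<times> 'b))" where
  "minimal_completion s J1 J2 T11 T21 = (THE A. J2_minimal_solution s J1 J2 T11 T21 A)"

definition T_min ::
    "('a::complex_hilbert_space \<Rightarrow>\<^sub>L 'a) \<Rightarrow> ('b::complex_hilbert_space \<Rightarrow>\<^sub>L 'b) \<Rightarrow>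
     ('a \<Rightarrow>\<^sub>L 'a) \<Rightarrow> ('a \<Rightarrow>\<^sub>L 'b) \<Rightarrow> (('a \<times> 'b) \<Rightarrow>\<^sub>L ('a \<times> 'b))" where
  "T_min J1 J2 T11 T21 = minimal_completion 1 J1 J2 T11 T21 - id_blinfun"

definition T_max ::
    "('a::complex_hilbert_space \<Rightarrow>\<^sub>L 'a) \<Rightarrow> ('b::complex_hilbert_space \<Rightarrow>\<^sub>L 'b) \<Rightarrow>
     ('a \<Rightarrow>\<^sub>L 'a) \<Rightarrow> ('a \<Rightarrow>\<^sub>L 'b) \<Rightarrow> (('a \<times> 'b) \<Rightarrow>\<^sub>L ('a \<times> 'b))" where
  "T_max J1 J2 T11 T21 = id_blinfun - minimal_completion (- 1) J1 J2 T11 T21"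

end

theory Submission
  imports Defs
begin

text \<open>
  Multiplication by the fundamental symmetries turns the problem into one about Hilbert space
  selfadjoint operator matrices \<open>[[H, B*], [B, X]]\<close> with \<open>H = J1 T11\<close> and \<open>B = J2 T21\<close>.  A minimal
  index condition says that a maximal negative subspace of the corner stays maximal in the matrix.
  Testing maximality on vectors outside the subspace bounds the lower right block from one side by a
  generalized Schur complement; completing the square gives the converse.  For the matrix
  \<open>[[I - H H, B*], [B, I]]\<close>, whose index is at most that of \<open>I - T1* T1\<close>, the same test shows that \<open>B\<close>
  is dominated by \<open>D\<close>, hence \<open>B = V D\<close>, and that \<open>V J11 V* \<le> I\<close>.  This inequality says exactly that
  the lower bound for \<open>X\<close> from \<open>I + H\<close> does not exceed the upper bound from \<open>I - H\<close>.

  Negative indices are counted through the spectral measure, so the spectral theorem is needed: its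
  spectral family consists of the projections onto the kernels of the positive parts of \<open>H - l I\<close>,
  where the positive part comes from the square root of \<open>(H - l I)^2\<close>.
\<close>

text \<open>The corner \<open>I + s H\<close>, with \<open>s = 1\<close> or \<open>s = -1\<close>,
  need not be invertible, so its Schur complement is formed with the factors
  \<open>|I + s H|^(1/2)\<close> and \<open>sign (I + s H)\<close>. The commuting factorization
  \<open>I - H H = (I + s H) (I - s H)\<close> gives
  \<open>D = |I + s H|^(1/2) |I - s H|^(1/2)\<close>. Hence \<open>B = V D\<close> lets
  \<open>s B\<close> factor through \<open>|I + s H|^(1/2)\<close>, and on the closed range of
  \<open>D\<close> the two signs multiply to \<open>J11\<close>. This turns the Schur complement
  into \<open>V (I - s H) J11 V*\<close>, the origin of the stated block form. The two complements
  add up to \<open>2 V J11 V*\<close>, which is why \<open>V J11 V* \<le> I\<close> decides the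
  comparison of the bounds. Finiteness of \<open>\<kappa>\<close> enters twice: in the dimension
  count behind maximality, and in bounding vectors of the negative subspace of
  \<open>I - H H\<close> by \<open>D\<close>. For the index of \<open>I - T* T\<close> both
  conditions are combined: its negative vectors are mapped to the sum of the negative spectral
  subspaces of \<open>I + H\<close> and \<open>I - H\<close>, which are orthogonal and on which
  \<open>I - H H\<close> is negative.\<close>

instance complex_hilbert_space \<subseteq> banach ..

section \<open>Inner products and bounded operators\<close>

lemmas blinfun_simps = blinfun.bilinear_simps

section \<open>The complex form, complex-linear maps and adjoints\<close>

lemma cinner_add_right: "cinner x (y + z) = cinner x y + cinner x z"
  by (metis cinner_add_left cinner_commute complex_cnj_add)

lemma cinner_scaleC_right: "cinner x (c *\<^sub>C y) = cnj c * cinner x y"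
  by (metis cinner_scaleC_left cinner_commute complex_cnj_mult)

lemma Im_cinner: "Im (cinner x y) = inner x (\<i> *\<^sub>C y)"
  by (simp add: inner_eq_Re_cinner cinner_scaleC_right)

lemma inner_ext: "(\<And>x. inner x y = inner x z) \<Longrightarrow> y = (z :: 'a::real_inner)"
  using vector_eq_ldot[of y z] by simp

lemma cinner_eqI:
  fixes x y :: "'a::complex_hilbert_space" and x' y' :: "'b::complex_hilbert_space"
  assumes "inner x y = inner x' y'" "inner x (\<i> *\<^sub>C y) = inner x' (\<i> *\<^sub>C y')"
  shows "cinner x y = cinner x' y'"
  using assms by (simp add: complex_eq_iff Im_cinner flip: inner_eq_Re_cinner)

lemma cinner_self: "cinner x x = complex_of_real ((norm x)\<^sup>2)"
proof -
  have "Im (cinner x x) = 0"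
    by (metis add_cancel_left_left cinner_commute complex_cnj_add complex_add_cnj cnj.sel(2)
        equal_neg_zero)
  moreover have "Re (cinner x x) = (norm x)\<^sup>2"
    by (simp add: power2_norm_eq_inner inner_eq_Re_cinner)
  ultimately show ?thesis by (simp add: complex_eq_iff)
qed

lemma norm_scaleC: "norm (c *\<^sub>C x) = cmod c * norm (x::'a::complex_hilbert_space)"
proof -
  have "cinner (c *\<^sub>C x) (c *\<^sub>C x) = complex_of_real ((cmod c * norm x)\<^sup>2)"
  proof -
    have "cinner (c *\<^sub>C x) (c *\<^sub>C x) = (c * cnj c) * cinner x x"
      by (simp add: cinner_scaleC_left cinner_scaleC_right)
    then show ?thesis by (simp add: cinner_self power_mult_distrib flip: complex_norm_square)
  qed
  then have "(norm (c *\<^sub>C x))\<^sup>2 = (cmod c * norm x)\<^sup>2"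
    unfolding cinner_self using of_real_eq_iff by blast
  then show ?thesis by simp
qed

lemma scaleC_scaleR: "c *\<^sub>C (r *\<^sub>R x) = r *\<^sub>R (c *\<^sub>C (x::'a::complex_hilbert_space))"
  by (simp add: scaleR_scaleC scaleC_scaleC mult.commute)

lemma bounded_linear_scaleC: "bounded_linear ((*\<^sub>C) c :: 'a::complex_hilbert_space \<Rightarrow> 'a)"
  by (rule bounded_linear_intro[where K = "cmod c"])
    (auto simp: scaleC_add_right scaleC_scaleR norm_scaleC mult.commute)

lemmas scaleC_diff_right = complex_vector.scale_right_diff_distrib

lemma complex_linear_apply: "complex_linear A \<Longrightarrow> A (c *\<^sub>C x) = c *\<^sub>C A x"
  by (simp add: complex_linear_def)

lemma complex_linear_add: "complex_linear A \<Longrightarrow> complex_linear B \<Longrightarrow> complex_linear (A + B)"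
  by (simp add: complex_linear_def blinfun_simps scaleC_add_right)

lemma complex_linear_diff: "complex_linear A \<Longrightarrow> complex_linear B \<Longrightarrow> complex_linear (A - B)"
  by (simp add: complex_linear_def blinfun_simps scaleC_diff_right)

lemma complex_linear_minus: "complex_linear A \<Longrightarrow> complex_linear (- A)"
  by (simp add: complex_linear_def blinfun_simps)

lemma complex_linear_scaleR: "complex_linear A \<Longrightarrow> complex_linear (r *\<^sub>R A)"
  by (simp add: complex_linear_def blinfun_simps scaleC_scaleR)

lemma complex_linear_compose: "complex_linear A \<Longrightarrow> complex_linear B \<Longrightarrow> complex_linear (A o\<^sub>L B)"
  by (simp add: complex_linear_def)

lemma complex_linear_id: "complex_linear id_blinfun"
  by (simp add: complex_linear_def)

lemma complex_linear_zero: "complex_linear 0"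
  by (simp add: complex_linear_def)

lemmas complex_linear_intros = complex_linear_add complex_linear_diff complex_linear_minus
  complex_linear_scaleR complex_linear_compose complex_linear_id complex_linear_zero

text \<open>The representing vector minimizes \<open>norm x ^ 2 - 2 * f x\<close> over
  \<open>K\<close>. The case \<open>K = UNIV\<close> yields adjoints, and the functional
  \<open>inner _ x\<close> yields the projection of \<open>x\<close> onto \<open>K\<close>.\<close>

lemma riesz_on_closed_subspace:
  fixes K :: "'a::{real_inner,complete_space} set"
  assumes K: "subspace K" "closed K" and f: "bounded_linear f"
  obtains y where "y \<in> K" "\<And>x. x \<in> K \<Longrightarrow> f x = inner x y"
proof -
  interpret bounded_linear f by fact
  define \<phi> where "\<phi> x = (norm x)\<^sup>2 - 2 * f x" for x
  obtain b where b: "\<And>x. \<bar>f x\<bar> \<le> norm x * b"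
    using bounded by auto
  have low: "- b\<^sup>2 \<le> \<phi> x" for x
  proof -
    have "0 \<le> (norm x - b)\<^sup>2" by simp
    with b[of x] show ?thesis unfolding \<phi>_def power2_diff by (simp add: algebra_simps)
  qed
  define m where "m = Inf (\<phi> ` K)"
  have bdd: "bdd_below (\<phi> ` K)" using low by (auto simp: bdd_below_def)
  have ne: "\<phi> ` K \<noteq> {}" using subspace_0[OF K(1)] by auto
  have m: "m \<le> \<phi> x" if "x \<in> K" for x
    unfolding m_def using bdd that by (auto intro: cInf_lower)
  have "\<exists>y\<in>K. \<phi> y < m + inverse (real (Suc n))" for n
  proof -
    have "m < m + inverse (real (Suc n))" by simp
    then show ?thesis
      unfolding cInf_less_iff[OF ne bdd, folded m_def] by blast
  qed
  then obtain y where yK: "\<And>n. y n \<in> K" and y: "\<And>n. \<phi> (y n) < m + inverse (real (Suc n))"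
    by metis
  \<comment> \<open>Parallelogram law at the midpoint \<open>w\<close>, where \<open>\<phi>\<close>
    is at least \<open>m\<close>; it makes the minimizing sequence Cauchy.\<close>
  have mid: "(norm (u - v))\<^sup>2 \<le> 2 * (\<phi> u - m) + 2 * (\<phi> v - m)" if "u \<in> K" "v \<in> K" for u v
  proof -
    define w where "w = (1/2) *\<^sub>R (u + v)"
    have "w \<in> K"
      unfolding w_def using that K(1) by (intro subspace_scale subspace_add) auto
    then have "m \<le> \<phi> w" by (rule m)
    moreover have "f w = (f u + f v) / 2"
      unfolding w_def by (simp add: scaleR add)
    moreover have "(norm w)\<^sup>2 = (norm (u + v))\<^sup>2 / 4"
      unfolding w_def by (simp add: power_mult_distrib power2_eq_square)
    moreover have "(norm (u - v))\<^sup>2 + (norm (u + v))\<^sup>2 = 2 * (norm u)\<^sup>2 + 2 * (norm v)\<^sup>2"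
      by (simp add: power2_norm_eq_inner inner_diff inner_add algebra_simps inner_commute)
    moreover have "D \<le> 2 * (U - 2 * p - m) + 2 * (Q - 2 * q - m)"
      if "m \<le> W - 2 * F" "F = (p + q) / 2" "W = S / 4" "D + S = 2 * U + 2 * Q"
      for D F p q S U Q W :: real
      using that by (simp add: field_simps)
    ultimately show ?thesis unfolding \<phi>_def by blast
  qed
  have "Cauchy y"
  proof (rule metric_CauchyI)
    fix e :: real assume "e > 0"
    obtain N where N: "inverse (real (Suc N)) < e\<^sup>2 / 4"
      using reals_Archimedean[of "e\<^sup>2 / 4"] \<open>e > 0\<close> by auto
    have "dist (y i) (y j) < e" if "i \<ge> N" "j \<ge> N" for i j
    proof -
      have le: "inverse (real (Suc k)) \<le> inverse (real (Suc N))" if "k \<ge> N" for k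
        using that by (simp add: le_imp_inverse_le)
      have "(dist (y i) (y j))\<^sup>2 < e\<^sup>2"
        using mid[OF yK yK, of i j] y[of i] y[of j] le[OF that(1)] le[OF that(2)] N
        unfolding dist_norm power2_eq_square by argo
      then show ?thesis using \<open>e > 0\<close> by (simp add: power_less_imp_less_base)
    qed
    then show "\<exists>M. \<forall>i\<ge>M. \<forall>j\<ge>M. dist (y i) (y j) < e" by blast
  qed
  then obtain z where z: "y \<longlonglongrightarrow> z" using Cauchy_convergent convergent_def by blast
  have zK: "z \<in> K" using closed_sequentially[OF K(2) yK z] .
  have "(\<lambda>n. \<phi> (y n)) \<longlonglongrightarrow> \<phi> z"
    unfolding \<phi>_def by (intro tendsto_intros z tendsto)
  moreover have "(\<lambda>n. m + inverse (real (Suc n))) \<longlonglongrightarrow> m + 0"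
    by (intro tendsto_add tendsto_const LIMSEQ_inverse_real_of_nat)
  ultimately have "\<phi> z \<le> m + 0"
    by (rule LIMSEQ_le) (use y less_imp_le in blast)
  then have min: "\<phi> z \<le> \<phi> x" if "x \<in> K" for x using m[OF that] by simp
  have "f x = inner x z" if x: "x \<in> K" for x
  proof (rule ccontr)
    define d where "d = inner x z - f x"
    assume "f x \<noteq> inner x z"
    then have d: "d \<noteq> 0" by (simp add: d_def)
    have q: "0 \<le> 2 * t * d + t\<^sup>2 * (norm x)\<^sup>2" for t
    proof -
      have "z + t *\<^sub>R x \<in> K" using zK x K(1) by (intro subspace_scale subspace_add) auto
      from min[OF this] have "(norm z)\<^sup>2 - 2 * f z \<le> (norm (z + t *\<^sub>R x))\<^sup>2 - 2 * (f z + t * f x)"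
        unfolding \<phi>_def by (simp add: add scaleR)
      also have "(norm (z + t *\<^sub>R x))\<^sup>2 = (norm z)\<^sup>2 + 2 * (t * inner x z) + t\<^sup>2 * (norm x)\<^sup>2"
        unfolding power2_norm_eq_inner
        by (simp add: inner_add inner_commute power2_eq_square)
      finally show ?thesis unfolding d_def by (simp add: algebra_simps)
    qed
    \<comment> \<open>The summand one keeps \<open>p\<close> positive when \<open>x = 0\<close>; the
      quadratic is still at most \<open>- d^2 / p < 0\<close> at the chosen
      \<open>t\<close>.\<close>
    define p where "p = 1 + (norm x)\<^sup>2"
    define t where "t = - d / p"
    have p: "p > 0" by (simp add: p_def add_pos_nonneg)
    have "2 * t * d + t\<^sup>2 * (norm x)\<^sup>2 \<le> 2 * t * d + t\<^sup>2 * p"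
      by (simp add: p_def distrib_left)
    also have "\<dots> = - d\<^sup>2 / p"
      using p unfolding t_def by (simp add: field_simps power2_eq_square)
    also have "\<dots> < 0" using p d by (simp add: divide_neg_pos)
    finally show False using q[of t] by simp
  qed
  then show ?thesis using that zK by blast
qed

text \<open>Riesz representation is applied to the real inner product only. Complex linearity of
  \<open>A\<close> moves \<open>\<i>\<close> across the product, which supplies the imaginary
  part.\<close>

lemma adjoint_exists:
  fixes A :: "'a::complex_hilbert_space \<Rightarrow>\<^sub>L 'b::complex_hilbert_space"
  assumes A: "complex_linear A"
  shows "\<exists>B. \<forall>x y. cinner (A x) y = cinner x (blinfun_apply B y)"
proof -
  have "\<exists>z. \<forall>x. inner (A x) y = inner x z" for y
  proof -
    have "bounded_linear (\<lambda>x. inner (A x) y)"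
      by (intro bounded_linear_inner_left_comp blinfun.bounded_linear_right)
    then show ?thesis
      by (rule riesz_on_closed_subspace[OF subspace_UNIV closed_UNIV]) auto
  qed
  then obtain g where g: "\<And>x y. inner (A x) y = inner x (g y)" by metis
  have "bounded_linear g"
  proof (rule bounded_linear_intro[where K = "norm A"])
    show "g (x + y) = g x + g y" for x y
      by (rule inner_ext) (simp add: inner_add_right flip: g)
    show "g (r *\<^sub>R x) = r *\<^sub>R g x" for r x
      by (rule inner_ext) (simp flip: g)
    show "norm (g y) \<le> norm y * norm A" for y
    proof (cases "g y = 0")
      case False
      have "norm (g y) * norm (g y) = inner (A (g y)) y"
        by (simp add: g flip: power2_norm_eq_inner power2_eq_square)
      also have "\<dots> \<le> norm (A (g y)) * norm y" by (rule norm_cauchy_schwarz)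
      also have "\<dots> \<le> norm A * norm (g y) * norm y"
        by (intro mult_right_mono norm_blinfun) auto
      finally show ?thesis using False by (simp add: mult_ac)
    qed simp
  qed
  then obtain B where B: "\<And>y. blinfun_apply B y = g y"
    using bounded_linear_Blinfun_apply by metis
  have i: "inner (A x) (\<i> *\<^sub>C y) = inner x (\<i> *\<^sub>C g y)" for x y
  proof -
    have "inner (A x) (\<i> *\<^sub>C y) = - inner (A (\<i> *\<^sub>C x)) y"
      using A by (simp add: inner_eq_Re_cinner complex_linear_apply cinner_scaleC_left cinner_scaleC_right)
    also have "\<dots> = inner x (\<i> *\<^sub>C g y)"
      unfolding g by (simp add: inner_eq_Re_cinner cinner_scaleC_left cinner_scaleC_right)
    finally show ?thesis .
  qed
  have "cinner (A x) y = cinner x (blinfun_apply B y)" for x y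
    unfolding B by (rule cinner_eqI) (rule g i)+
  then show ?thesis by blast
qed

lemma cinner_adj:
  fixes A :: "'a::complex_hilbert_space \<Rightarrow>\<^sub>L 'b::complex_hilbert_space"
  assumes "complex_linear A"
  shows "cinner (A x) y = cinner x (adj A y)"
proof -
  obtain B where B: "\<forall>x y. cinner (A x) y = cinner x (blinfun_apply B y)"
    using adjoint_exists[OF assms] by blast
  have "adj A = B"
    unfolding adj_def
  proof (rule the_equality)
    fix B' assume B': "\<forall>x y. cinner (A x) y = cinner x (blinfun_apply B' y)"
    have "inner x (blinfun_apply B' y) = inner x (blinfun_apply B y)" for x y
      using B B' by (simp add: inner_eq_Re_cinner)
    then show "B' = B" by (auto intro: blinfun_eqI inner_ext)
  qed (rule B)
  with B show ?thesis by simp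
qed

lemma inner_adj: "complex_linear A \<Longrightarrow> inner (A x) y = inner x (adj A y)"
  by (simp add: inner_eq_Re_cinner cinner_adj)

lemma inner_adj': "complex_linear A \<Longrightarrow> inner y (A x) = inner (adj A y) x"
  by (metis inner_adj inner_commute)

lemma complex_linear_adj:
  assumes "complex_linear A" shows "complex_linear (adj A)"
  unfolding complex_linear_def
proof (intro allI)
  fix c y
  have "cinner x (adj A (c *\<^sub>C y)) = cinner x (c *\<^sub>C adj A y)" for x
    using cinner_adj[OF assms, of x y] cinner_adj[OF assms, of x "c *\<^sub>C y"]
    by (simp add: cinner_scaleC_right)
  then have "inner x (adj A (c *\<^sub>C y)) = inner x (c *\<^sub>C adj A y)" for x
    by (simp add: inner_eq_Re_cinner)
  then show "adj A (c *\<^sub>C y) = c *\<^sub>C adj A y" by (rule inner_ext)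
qed

lemma adj_eqI:
  assumes "complex_linear A" "\<And>x y. inner (A x) y = inner x (blinfun_apply B y)" shows "adj A = B"
proof (rule blinfun_eqI)
  fix y
  have "inner x (adj A y) = inner x (blinfun_apply B y)" for x
    by (metis assms inner_adj)
  then show "adj A y = blinfun_apply B y" by (rule inner_ext)
qed

lemma adj_compose:
  "complex_linear A \<Longrightarrow> complex_linear B \<Longrightarrow> adj (A o\<^sub>L B) = adj B o\<^sub>L adj A"
  by (rule adj_eqI) (auto simp: complex_linear_intros inner_adj)

section \<open>Selfadjoint and nonnegative operators\<close>

text \<open>For complex-linear operators the condition on the real inner product suffices.\<close>

definition selfadj :: "('a::complex_hilbert_space \<Rightarrow>\<^sub>L 'a) \<Rightarrow> bool" where
  "selfadj A \<longleftrightarrow> complex_linear A \<and> (\<forall>x y. inner (A x) y = inner x (A y))"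

lemma selfadj_linear: "selfadj A \<Longrightarrow> complex_linear A"
  by (simp add: selfadj_def)

lemma selfadj_inner: "selfadj A \<Longrightarrow> inner (A x) y = inner x (A y)"
  by (simp add: selfadj_def)

lemma selfadj_iff_adj: "selfadj A \<longleftrightarrow> complex_linear A \<and> adj A = A"
  unfolding selfadj_def using adj_eqI inner_adj by metis

lemma cinner_selfadj: "selfadj A \<Longrightarrow> cinner (A x) y = cinner x (A y)"
  by (metis selfadj_iff_adj cinner_adj)

lemma cinner_quadratic: "selfadj A \<Longrightarrow> cinner (A x) x = complex_of_real (inner (A x) x)"
  using cinner_selfadj[of A x x] cinner_commute[of "A x" x]
  by (auto simp: complex_eq_iff inner_eq_Re_cinner)

lemma selfadj_add: "selfadj A \<Longrightarrow> selfadj B \<Longrightarrow> selfadj (A + B)"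
  by (simp add: selfadj_def complex_linear_intros blinfun_simps inner_add)

lemma selfadj_diff: "selfadj A \<Longrightarrow> selfadj B \<Longrightarrow> selfadj (A - B)"
  by (simp add: selfadj_def complex_linear_intros blinfun_simps inner_diff)

lemma selfadj_minus: "selfadj A \<Longrightarrow> selfadj (- A)"
  by (simp add: selfadj_def complex_linear_intros blinfun_simps)

lemma selfadj_scaleR: "selfadj A \<Longrightarrow> selfadj (r *\<^sub>R A)"
  by (simp add: selfadj_def complex_linear_intros blinfun_simps)

lemma selfadj_id: "selfadj id_blinfun"
  by (simp add: selfadj_def complex_linear_intros)

lemma selfadj_zero: "selfadj 0"
  by (simp add: selfadj_def complex_linear_intros)

lemma selfadj_compose:
  "selfadj A \<Longrightarrow> selfadj B \<Longrightarrow> A o\<^sub>L B = B o\<^sub>L A \<Longrightarrow> selfadj (A o\<^sub>L B)"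
  unfolding selfadj_def
  by (auto simp: complex_linear_intros) (metis blinfun_apply_blinfun_compose)

lemmas selfadj_intros = selfadj_add selfadj_diff selfadj_minus selfadj_scaleR selfadj_id selfadj_zero

lemma selfadj_square: "selfadj A \<Longrightarrow> selfadj (A o\<^sub>L A)"
  by (rule selfadj_compose) auto

lemma selfadj_square_inner: "selfadj A \<Longrightarrow> inner (A (A x)) x = (norm (A x))\<^sup>2"
  by (simp add: selfadj_inner power2_norm_eq_inner)

lemma selfadj_adj_compose: "complex_linear B \<Longrightarrow> selfadj (adj B o\<^sub>L B)"
  by (auto simp: selfadj_def complex_linear_intros complex_linear_adj inner_adj inner_adj')

lemma selfadj_congruence: "selfadj K \<Longrightarrow> complex_linear B \<Longrightarrow> selfadj (B o\<^sub>L K o\<^sub>L adj B)"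
  by (auto simp: selfadj_def complex_linear_intros complex_linear_adj inner_adj inner_adj')

text \<open>Polarization: the imaginary part of the form at \<open>x + \<i> *\<^sub>C y\<close> is
  the difference of the real parts of the two cross terms.\<close>

lemma selfadj_of_real_form:
  fixes A :: "'a::complex_hilbert_space \<Rightarrow>\<^sub>L 'a"
  assumes A: "complex_linear A" and im: "\<And>x. Im (cinner (A x) x) = 0"
  shows "selfadj A"
  unfolding selfadj_def
proof (intro conjI allI A)
  fix x y
  have "Im (cinner (A (x + \<i> *\<^sub>C y)) (x + \<i> *\<^sub>C y)) = 0" by (rule im)
  then have "Re (cinner (A y) x) = Re (cinner (A x) y)"
    using im[of x] im[of y] A
    by (simp add: blinfun.add_right complex_linear_apply cinner_add_left cinner_add_right
        cinner_scaleC_left cinner_scaleC_right)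
  then show "inner (A x) y = inner x (A y)"
    by (metis inner_commute inner_eq_Re_cinner)
qed

text \<open>The form of the difference \<open>C\<close> at \<open>x + C x\<close> reduces to twice
  the square of the norm of \<open>C x\<close>.\<close>

lemma selfadj_eqI:
  assumes A: "selfadj A" and B: "selfadj B" and eq: "\<And>x. inner (A x) x = inner (B x) x"
  shows "A = B"
proof (rule blinfun_eqI)
  fix x
  define C where "C = A - B"
  have C: "selfadj C" "\<And>x. inner (C x) x = 0"
    using assms by (auto simp: C_def selfadj_intros blinfun_simps inner_diff)
  have "inner (C (x + C x)) (x + C x) = 0" by (rule C)
  then have "inner (C x) (C x) = 0"
    using C(2)[of x] C(2)[of "C x"] C(1)
    by (simp add: blinfun_simps inner_add selfadj_inner)
  then show "A x = B x" by (simp add: C_def blinfun_simps)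
qed

lemma nonneg_op_iff: "nonneg_op A \<longleftrightarrow> selfadj A \<and> (\<forall>x. inner (A x) x \<ge> 0)"
proof
  assume A: "nonneg_op A"
  then have "Im (cinner (A x) x) = 0" "Re (cinner (A x) x) \<ge> 0" for x
    by (auto simp: nonneg_op_def complex_nonneg_Reals_iff)
  with A show "selfadj A \<and> (\<forall>x. inner (A x) x \<ge> 0)"
    by (auto simp: nonneg_op_def inner_eq_Re_cinner intro!: selfadj_of_real_form)
next
  assume "selfadj A \<and> (\<forall>x. inner (A x) x \<ge> 0)"
  then show "nonneg_op A"
    by (simp add: nonneg_op_def selfadj_linear cinner_quadratic)
qed

lemma nonneg_op_selfadj: "nonneg_op A \<Longrightarrow> selfadj A"
  and nonneg_op_inner: "nonneg_op A \<Longrightarrow> inner (A x) x \<ge> 0"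
  by (auto simp: nonneg_op_iff)

lemma nonneg_op_cauchy_schwarz:
  assumes "nonneg_op A"
  shows "(inner (A x) y)\<^sup>2 \<le> inner (A x) x * inner (A y) y"
proof -
  have sa: "selfadj A" and nn: "\<And>x. inner (A x) x \<ge> 0" using assms by (auto simp: nonneg_op_iff)
  define a b c where "a = inner (A x) x" and "b = inner (A x) y" and "c = inner (A y) y"
  have q: "0 \<le> s\<^sup>2 * a + 2 * s * t * b + t\<^sup>2 * c" for s t
  proof -
    have "inner (A y) x = b" using sa unfolding b_def by (metis selfadj_inner inner_commute)
    then show ?thesis
      using nn[of "s *\<^sub>R x + t *\<^sub>R y"] unfolding a_def b_def c_def
      by (simp add: blinfun_simps inner_add power2_eq_square algebra_simps)
  qed
  have ac: "a \<ge> 0" "c \<ge> 0" using nn by (auto simp: a_def c_def)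
  have "b\<^sup>2 \<le> a * c"
  proof (cases "a = 0")
    case True
    show ?thesis
    proof (cases "b = 0")
      case False
      \<comment> \<open>With \<open>a = 0\<close> the form is affine in \<open>s\<close>; this
        \<open>s\<close> makes its value \<open>- c - 2\<close>.\<close>
      have "0 \<le> 2 * (- (c + 1) / b) * b + c"
        using q[of "- (c + 1) / b" 1] True by simp
      then show ?thesis using ac False by simp
    qed (use ac in simp)
  next
    case False
    then have "a > 0" using ac by simp
    have "0 \<le> a * (a * c - b\<^sup>2)"
      using q[of "- b" a] by (simp add: power2_eq_square algebra_simps)
    then show ?thesis using \<open>a > 0\<close> by (simp add: zero_le_mult_iff)
  qed
  then show ?thesis by (simp add: a_def b_def c_def)
qed

lemma nonneg_op_kernel:
  assumes "nonneg_op A" "inner (A x) x = 0" shows "A x = 0"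
  using nonneg_op_cauchy_schwarz[OF assms(1), of x "A x"] assms(2) by simp

text \<open>Cauchy-Schwarz for the form of \<open>A\<close>, taken at \<open>x\<close> and
  \<open>A x\<close>, converts a bound on the form into a bound on the norm.\<close>

lemma nonneg_op_norm_le:
  assumes A: "nonneg_op A" and le: "\<And>x. inner (A x) x \<le> c * (norm x)\<^sup>2" and "c \<ge> 0"
  shows "norm A \<le> c"
proof (rule norm_blinfun_bound[OF \<open>c \<ge> 0\<close>])
  fix x
  show "norm (A x) \<le> c * norm x"
  proof (cases "A x = 0")
    case False
    have "(norm (A x))\<^sup>2 * (norm (A x))\<^sup>2 = (inner (A x) (A x))\<^sup>2"
      by (simp only: power2_norm_eq_inner power2_eq_square[of "inner _ _"])
    also have "\<dots> \<le> inner (A x) x * inner (A (A x)) (A x)"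
      by (rule nonneg_op_cauchy_schwarz[OF A])
    also have "\<dots> \<le> (c * (norm x)\<^sup>2) * (c * (norm (A x))\<^sup>2)"
      using A \<open>c \<ge> 0\<close> by (intro mult_mono le) (auto intro: nonneg_op_inner)
    finally have "(norm (A x))\<^sup>2 \<le> (c * norm x)\<^sup>2"
      using False by (simp add: power2_eq_square mult_ac)
    then show ?thesis
      by (rule power2_le_imp_le) (simp add: \<open>c \<ge> 0\<close>)
  qed (use \<open>c \<ge> 0\<close> in simp)
qed

section \<open>Square roots and absolute values\<close>

lemma blinfun_eq_iff: "A = B \<longleftrightarrow> (\<forall>x. blinfun_apply A x = blinfun_apply B x)"
  by (metis blinfun_eqI)

lemma blinfun_compose_assoc: "(A o\<^sub>L B) o\<^sub>L C = A o\<^sub>L (B o\<^sub>L C)"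
  by (rule blinfun_eqI) simp

text \<open>A bounded increasing scalar sequence controls the increments. The case
  \<open>p = 0\<close> serves the square root iteration, and \<open>p = 1\<close> the increasing
  projections, where squared distances are differences of squared norms.\<close>

lemma Cauchy_if_dist_bounded:
  fixes X :: "nat \<Rightarrow> 'a::metric_space" and f :: "nat \<Rightarrow> real" and p :: nat
  assumes f: "incseq f" "\<And>n. f n \<le> c"
    and le: "\<And>m n. m \<le> n \<Longrightarrow> (dist (X n) (X m)) ^ Suc p \<le> f n - f m"
  shows "Cauchy X"
proof (rule metric_CauchyI)
  fix e :: real assume e: "e > 0"
  obtain l where "f \<longlonglongrightarrow> l" using incseq_convergent[OF f(1), of c] f(2) by blast
  then have "Cauchy f" by (rule LIMSEQ_imp_Cauchy)
  then obtain N where N: "\<And>m n. m \<ge> N \<Longrightarrow> n \<ge> N \<Longrightarrow> dist (f m) (f n) < e ^ Suc p"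
    unfolding Cauchy_def using e by (meson zero_less_power)
  have *: "dist (X n) (X m) < e" if "m \<le> n" "m \<ge> N" for m n
  proof (rule power_less_imp_less_base)
    show "(dist (X n) (X m)) ^ Suc p < e ^ Suc p"
      using le[OF that(1)] N[of n m] that by (simp add: dist_real_def)
  qed (use e in simp)
  have "dist (X m) (X n) < e" if "m \<ge> N" "n \<ge> N" for m n
    using *[of n m] *[of m n] that by (cases "n \<le> m") (auto simp: dist_commute)
  then show "\<exists>M. \<forall>m\<ge>M. \<forall>n\<ge>M. dist (X m) (X n) < e" by blast
qed

lemma commute_apply: "A o\<^sub>L B = B o\<^sub>L A \<Longrightarrow> A (B x) = B (A x)"
  by (metis blinfun_apply_blinfun_compose)

lemma selfadj_limit:
  assumes "\<And>n. selfadj (Y n)" "\<And>x. (\<lambda>n. Y n x) \<longlonglongrightarrow> blinfun_apply Z x"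
  shows "selfadj Z"
  unfolding selfadj_def complex_linear_def
proof (intro conjI allI)
  fix c x
  have "(\<lambda>n. c *\<^sub>C Y n x) \<longlonglongrightarrow> c *\<^sub>C Z x"
    by (rule bounded_linear.tendsto[OF bounded_linear_scaleC assms(2)])
  moreover have "(\<lambda>n. c *\<^sub>C Y n x) \<longlonglongrightarrow> Z (c *\<^sub>C x)"
    using assms(2)[of "c *\<^sub>C x"] assms(1) by (simp add: selfadj_linear complex_linear_apply)
  ultimately show "Z (c *\<^sub>C x) = c *\<^sub>C Z x" using LIMSEQ_unique by blast
next
  fix x y
  have "(\<lambda>n. inner (Y n x) y) \<longlonglongrightarrow> inner (Z x) y" "(\<lambda>n. inner x (Y n y)) \<longlonglongrightarrow> inner x (Z y)"
    by (intro tendsto_intros assms)+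
  then show "inner (Z x) y = inner x (Z y)"
    using assms(1) LIMSEQ_unique by (simp add: selfadj_inner)
qed

text \<open>
  With \<open>A = I - X\<close> and \<open>R = I - Y\<close> the equation \<open>R R = A\<close> is the fixed point equation
  \<open>Y = (X + Y Y) / 2\<close>.  The increments of its iteration in norm are bounded by those of the scalar
  iteration for \<open>X = 1\<close>, which increases to \<open>1\<close>.
\<close>

lemma contraction_sqrt_exists:
  fixes A :: "'a::complex_hilbert_space \<Rightarrow>\<^sub>L 'a"
  assumes A: "nonneg_op A" and le: "\<And>x. inner (A x) x \<le> (norm x)\<^sup>2"
  shows "\<exists>R. nonneg_op R \<and> R o\<^sub>L R = A \<and> (\<forall>T. T o\<^sub>L A = A o\<^sub>L T \<longrightarrow> T o\<^sub>L R = R o\<^sub>L T)"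
proof -
  define X where "X = id_blinfun - A"
  have saX: "selfadj X" using A unfolding X_def by (intro selfadj_intros nonneg_op_selfadj)
  have "nonneg_op X"
    using le saX by (auto simp: nonneg_op_iff X_def blinfun_simps inner_diff power2_norm_eq_inner)
  then have nX: "norm X \<le> 1"
    by (rule nonneg_op_norm_le)
      (use A in \<open>auto simp: X_def blinfun_simps inner_diff power2_norm_eq_inner nonneg_op_inner\<close>)
  define Y where "Y n = ((\<lambda>Z. (1/2) *\<^sub>R (X + (Z o\<^sub>L Z))) ^^ n) 0" for n
  define y where "y n = ((\<lambda>t::real. (1 + t * t) / 2) ^^ n) 0" for n
  have Y0: "Y 0 = 0" and Y_Suc: "Y (Suc n) = (1/2) *\<^sub>R (X + (Y n o\<^sub>L Y n))" for n
    by (simp_all add: Y_def)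
  have y0: "y 0 = 0" and y_Suc: "y (Suc n) = (1 + y n * y n) / 2" for n
    by (simp_all add: y_def)
  have y01: "0 \<le> y n \<and> y n \<le> 1" for n
    by (induction n) (auto simp: y0 y_Suc mult_le_one)
  have y_incr: "y n \<le> y (Suc n)" for n
    using sum_squares_ge_zero[of "1 - y n" 0] unfolding y_Suc by (simp add: algebra_simps)
  then have "incseq y" by (rule incseq_SucI)
  have saY: "selfadj (Y n)" for n
    by (induction n) (auto simp: Y0 Y_Suc saX intro!: selfadj_intros selfadj_square)
  have Y_comm: "T o\<^sub>L Y n = Y n o\<^sub>L T" if "T o\<^sub>L A = A o\<^sub>L T" for T n
  proof (induction n)
    case (Suc n)
    show ?case
      by (rule blinfun_eqI)
        (simp add: Y_Suc X_def blinfun_simps commute_apply[OF Suc] commute_apply[OF that])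
  qed (simp add: Y0 blinfun_eq_iff blinfun_simps)
  have nY: "norm (Y n) \<le> y n" for n
  proof (induction n)
    case (Suc n)
    have "norm (X + (Y n o\<^sub>L Y n)) \<le> norm X + norm (Y n) * norm (Y n)"
      by (intro norm_triangle_mono norm_blinfun_compose order_refl)
    also have "\<dots> \<le> 1 + y n * y n"
      using nX Suc y01[of n] by (intro add_mono mult_mono) auto
    finally show ?case by (simp add: Y_Suc y_Suc)
  qed (simp add: Y0 y0)
  have step: "norm (Y (Suc n) - Y n) \<le> y (Suc n) - y n" for n
  proof (induction n)
    case 0
    show ?case using nX by (simp add: Y_Suc Y0 y0 y_Suc)
  next
    case (Suc n)
    let ?d = "Y (Suc n) - Y n"
    \<comment> \<open>Difference of two squares, arranged so that no factors have to be
      interchanged.\<close>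
    have "Y (Suc (Suc n)) - Y (Suc n) = (1/2) *\<^sub>R ((Y (Suc n) o\<^sub>L ?d) + (?d o\<^sub>L Y n))"
      unfolding Y_Suc[of "Suc n"] Y_Suc[of n]
      by (rule blinfun_eqI) (simp add: blinfun_simps algebra_simps flip: Y_Suc)
    then have "norm (Y (Suc (Suc n)) - Y (Suc n)) = norm ((Y (Suc n) o\<^sub>L ?d) + (?d o\<^sub>L Y n)) / 2"
      by simp
    also have "\<dots> \<le> (norm (Y (Suc n)) * norm ?d + norm ?d * norm (Y n)) / 2"
      by (intro divide_right_mono norm_triangle_mono norm_blinfun_compose) auto
    also have "\<dots> \<le> (y (Suc n) * (y (Suc n) - y n) + (y (Suc n) - y n) * y n) / 2"
      using nY[of n] nY[of "Suc n"] Suc y01 y_incr[of n]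
      by (intro divide_right_mono add_mono mult_mono) auto
    also have "\<dots> = y (Suc (Suc n)) - y (Suc n)"
      by (simp add: y_Suc[of "Suc n"] y_Suc[of n] field_simps)
    finally show ?case .
  qed
  have diff: "norm (Y (n + k) - Y n) \<le> y (n + k) - y n" for n k
  proof (induction k)
    case (Suc k)
    have "norm (Y (n + Suc k) - Y n) \<le> norm (Y (Suc (n + k)) - Y (n + k)) + norm (Y (n + k) - Y n)"
      using norm_triangle_ineq[of "Y (Suc (n + k)) - Y (n + k)" "Y (n + k) - Y n"] by simp
    with Suc step[of "n + k"] show ?case by simp
  qed simp
  have "Cauchy Y"
  proof (rule Cauchy_if_dist_bounded[where p = 0, OF \<open>incseq y\<close>])
    show "y n \<le> 1" for n using y01 by blast
    show "(dist (Y n) (Y m)) ^ Suc 0 \<le> y n - y m" if "m \<le> n" for m n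
      using diff[of m "n - m"] that by (simp add: dist_norm)
  qed
  then obtain Z where Z: "Y \<longlonglongrightarrow> Z" using Cauchy_convergent convergent_def by blast
  have Zx: "(\<lambda>n. Y n x) \<longlonglongrightarrow> Z x" for x by (intro blinfun.tendsto Z tendsto_const)
  have saZ: "selfadj Z" using saY Zx by (rule selfadj_limit)
  have "norm Z \<le> 1"
  proof (rule LIMSEQ_le_const2)
    show "(\<lambda>n. norm (Y n)) \<longlonglongrightarrow> norm Z" by (intro tendsto_intros Z)
    show "\<exists>N. \<forall>n\<ge>N. norm (Y n) \<le> 1" using nY y01 order_trans by blast
  qed
  have fixp: "Z = (1/2) *\<^sub>R (X + (Z o\<^sub>L Z))"
  proof (rule LIMSEQ_unique)
    show "(\<lambda>n. Y (Suc n)) \<longlonglongrightarrow> Z" using Z by (rule LIMSEQ_Suc)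
    show "(\<lambda>n. Y (Suc n)) \<longlonglongrightarrow> (1/2) *\<^sub>R (X + (Z o\<^sub>L Z))"
      unfolding Y_Suc
      by (intro tendsto_intros Z bounded_bilinear.tendsto[OF bounded_bilinear_blinfun_compose])
  qed
  define R where "R = id_blinfun - Z"
  have "nonneg_op R"
    unfolding nonneg_op_iff
  proof (intro conjI allI)
    show "selfadj R" unfolding R_def by (intro selfadj_intros saZ)
    fix x
    have "inner (Z x) x \<le> norm (Z x) * norm x" by (rule norm_cauchy_schwarz)
    also have "\<dots> \<le> norm Z * norm x * norm x" by (intro mult_right_mono norm_blinfun) auto
    also have "\<dots> \<le> 1 * norm x * norm x" by (intro mult_right_mono \<open>norm Z \<le> 1\<close>) auto
    finally show "0 \<le> inner (R x) x"
      by (simp add: R_def blinfun_simps inner_diff dot_square_norm power2_eq_square)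
  qed
  moreover have "R o\<^sub>L R = A"
  proof (rule blinfun_eqI)
    fix x
    have "2 *\<^sub>R Z x = X x + Z (Z x)"
      using arg_cong[OF fixp, of "\<lambda>B. 2 *\<^sub>R B x"] by (simp add: blinfun_simps)
    then have "Z (Z x) = 2 *\<^sub>R Z x - x + A x"
      by (simp add: X_def blinfun_simps)
    then show "(R o\<^sub>L R) x = A x"
      by (simp add: R_def blinfun_simps scaleR_2)
  qed
  moreover have "T o\<^sub>L R = R o\<^sub>L T" if "T o\<^sub>L A = A o\<^sub>L T" for T
  proof -
    have "(\<lambda>n. T o\<^sub>L Y n) \<longlonglongrightarrow> (T o\<^sub>L Z)" "(\<lambda>n. Y n o\<^sub>L T) \<longlonglongrightarrow> (Z o\<^sub>L T)"
      by (intro bounded_bilinear.tendsto[OF bounded_bilinear_blinfun_compose] Z tendsto_const)+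
    then have "T o\<^sub>L Z = Z o\<^sub>L T"
      unfolding Y_comm[OF that] by (rule LIMSEQ_unique)
    then show ?thesis
      by (intro blinfun_eqI) (simp add: R_def blinfun_simps commute_apply)
  qed
  ultimately show ?thesis by blast
qed

lemma sqrt_exists:
  fixes A :: "'a::complex_hilbert_space \<Rightarrow>\<^sub>L 'a"
  assumes A: "nonneg_op A"
  shows "\<exists>R. nonneg_op R \<and> R o\<^sub>L R = A \<and> (\<forall>T. T o\<^sub>L A = A o\<^sub>L T \<longrightarrow> T o\<^sub>L R = R o\<^sub>L T)"
proof -
  \<comment> \<open>The summand one keeps the scaling factor positive when
    \<open>A = 0\<close>.\<close>
  define c where "c = norm A + 1"
  have c: "c > 0" by (simp add: c_def add_nonneg_pos)
  define B where "B = (1 / c) *\<^sub>R A"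
  have "nonneg_op B"
    using A c by (auto simp: B_def nonneg_op_iff selfadj_intros blinfun_simps)
  moreover have "inner (B x) x \<le> (norm x)\<^sup>2" for x
  proof -
    have "inner (A x) x \<le> norm (A x) * norm x" by (rule norm_cauchy_schwarz)
    also have "\<dots> \<le> norm A * norm x * norm x" by (intro mult_right_mono norm_blinfun) auto
    also have "\<dots> \<le> c * norm x * norm x" by (intro mult_right_mono) (auto simp: c_def)
    finally show ?thesis
      using c by (simp add: B_def blinfun_simps field_simps power2_eq_square)
  qed
  ultimately obtain R where R: "nonneg_op R" "R o\<^sub>L R = B"
      "\<And>T. T o\<^sub>L B = B o\<^sub>L T \<Longrightarrow> T o\<^sub>L R = R o\<^sub>L T"
    using contraction_sqrt_exists[of B] by blast
  let ?R = "sqrt c *\<^sub>R R"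
  have "nonneg_op ?R"
    using R(1) c by (auto simp: nonneg_op_iff selfadj_intros blinfun_simps)
  moreover have "?R o\<^sub>L ?R = A"
  proof (rule blinfun_eqI)
    fix x
    have "R (R x) = (1 / c) *\<^sub>R A x"
      using arg_cong[OF R(2), of "\<lambda>B. B x"] by (simp add: B_def blinfun_simps)
    then show "(?R o\<^sub>L ?R) x = A x" using c by (simp add: blinfun_simps)
  qed
  moreover have "T o\<^sub>L ?R = ?R o\<^sub>L T" if T: "T o\<^sub>L A = A o\<^sub>L T" for T
  proof -
    have "T o\<^sub>L B = B o\<^sub>L T"
      by (rule blinfun_eqI) (simp add: B_def blinfun_simps commute_apply[OF T])
    from R(3)[OF this] show ?thesis
      by (intro blinfun_eqI) (simp add: blinfun_simps commute_apply)
  qed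
  ultimately show ?thesis by blast
qed

text \<open>\<open>R\<close> commutes with \<open>A\<close>, hence with \<open>S\<close>, so
  \<open>R + S\<close> annihilates \<open>y = R x - S x\<close>. Both forms are nonnegative, so
  \<open>R y = S y = 0\<close>, and \<open>R - S\<close> applied to \<open>y\<close> is zero as
  well.\<close>

lemma sqrt_unique:
  fixes A :: "'a::complex_hilbert_space \<Rightarrow>\<^sub>L 'a"
  assumes R: "nonneg_op R" "R o\<^sub>L R = A"
      and S: "nonneg_op S" "S o\<^sub>L S = A" "\<And>T. T o\<^sub>L A = A o\<^sub>L T \<Longrightarrow> T o\<^sub>L S = S o\<^sub>L T"
  shows "R = S"
proof (rule blinfun_eqI)
  fix x
  have "R o\<^sub>L A = A o\<^sub>L R" by (simp flip: R(2) add: blinfun_compose_assoc)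
  then have RS: "R (S x) = S (R x)" for x using S(3) commute_apply by metis
  have sq: "R (R x) = S (S x)" for x
    by (metis R(2) S(2) blinfun_apply_blinfun_compose)
  define y where "y = R x - S x"
  have "R y + S y = 0" by (simp add: y_def blinfun_simps RS sq)
  then have "inner (R y) y + inner (S y) y = 0"
    by (metis inner_add_left inner_zero_left)
  then have "inner (R y) y = 0" "inner (S y) y = 0"
    using nonneg_op_inner[OF R(1), of y] nonneg_op_inner[OF S(1), of y] by auto
  then have "R y = 0" "S y = 0" using R(1) S(1) nonneg_op_kernel by blast+
  then have "inner x (R y - S y) = 0" by simp
  then have "inner y y = 0"
    using R(1) S(1) unfolding y_def
    by (simp add: inner_diff selfadj_inner nonneg_op_selfadj blinfun_simps)
  then show "R x = S x" by (simp add: y_def)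
qed

lemma sqrt_op_eqI:
  assumes "nonneg_op R" "R o\<^sub>L R = A" shows "sqrt_op A = R"
proof -
  have "nonneg_op A"
    using assms nonneg_op_selfadj[OF assms(1)]
    by (auto simp: nonneg_op_iff selfadj_square selfadj_square_inner simp flip: assms(2))
  from sqrt_exists[OF this] obtain S where
    S: "nonneg_op S" "S o\<^sub>L S = A" "\<And>T. T o\<^sub>L A = A o\<^sub>L T \<Longrightarrow> T o\<^sub>L S = S o\<^sub>L T" by blast
  show ?thesis
    unfolding sqrt_op_def
    by (rule the_equality) (use assms sqrt_unique[OF _ _ S] in auto)
qed

lemma
  assumes "nonneg_op A"
  shows nonneg_sqrt_op: "nonneg_op (sqrt_op A)"
    and sqrt_op_square: "sqrt_op A o\<^sub>L sqrt_op A = A"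
    and sqrt_op_commute: "T o\<^sub>L A = A o\<^sub>L T \<Longrightarrow> T o\<^sub>L sqrt_op A = sqrt_op A o\<^sub>L T"
proof -
  from sqrt_exists[OF assms] obtain S where
    S: "nonneg_op S" "S o\<^sub>L S = A" "\<And>T. T o\<^sub>L A = A o\<^sub>L T \<Longrightarrow> T o\<^sub>L S = S o\<^sub>L T" by blast
  show "nonneg_op (sqrt_op A)" "sqrt_op A o\<^sub>L sqrt_op A = A"
    "T o\<^sub>L A = A o\<^sub>L T \<Longrightarrow> T o\<^sub>L sqrt_op A = sqrt_op A o\<^sub>L T"
    unfolding sqrt_op_eqI[OF S(1,2)] by (fact S)+
qed

lemma nonneg_square: "selfadj A \<Longrightarrow> nonneg_op (A o\<^sub>L A)"
  by (auto simp: nonneg_op_iff selfadj_square selfadj_square_inner)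

lemma abs_op_selfadj: "selfadj A \<Longrightarrow> abs_op A = sqrt_op (A o\<^sub>L A)"
  by (simp add: abs_op_def selfadj_iff_adj)

lemma
  assumes "selfadj A"
  shows nonneg_abs_op: "nonneg_op (abs_op A)"
    and abs_op_square: "abs_op A o\<^sub>L abs_op A = A o\<^sub>L A"
    and abs_op_commute: "T o\<^sub>L A = A o\<^sub>L T \<Longrightarrow> T o\<^sub>L abs_op A = abs_op A o\<^sub>L T"
proof -
  note sq = nonneg_square[OF assms]
  show "nonneg_op (abs_op A)" "abs_op A o\<^sub>L abs_op A = A o\<^sub>L A"
    unfolding abs_op_selfadj[OF assms] by (rule nonneg_sqrt_op[OF sq] sqrt_op_square[OF sq])+
  assume "T o\<^sub>L A = A o\<^sub>L T"
  then have "T o\<^sub>L (A o\<^sub>L A) = (A o\<^sub>L A) o\<^sub>L T" by (metis blinfun_compose_assoc)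
  then show "T o\<^sub>L abs_op A = abs_op A o\<^sub>L T"
    unfolding abs_op_selfadj[OF assms] by (rule sqrt_op_commute[OF sq])
qed

section \<open>Orthogonal projections\<close>

lemma orth_projection_iff: "orth_projection P \<longleftrightarrow> selfadj P \<and> P o\<^sub>L P = P"
  by (auto simp: orth_projection_def selfadj_iff_adj)

lemma orth_projectionI: "selfadj P \<Longrightarrow> (\<And>x. P (P x) = P x) \<Longrightarrow> orth_projection P"
  by (auto simp: orth_projection_iff intro: blinfun_eqI)

lemma projection_selfadj: "orth_projection P \<Longrightarrow> selfadj P"
  by (simp add: orth_projection_iff)

lemma projection_idem: "orth_projection P \<Longrightarrow> P (P x) = P x"
  by (metis orth_projection_iff blinfun_apply_blinfun_compose)

lemma projection_inner: "orth_projection P \<Longrightarrow> inner (P x) x = (norm (P x))\<^sup>2"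
  using selfadj_square_inner[of P x] by (simp add: projection_selfadj projection_idem)

lemma projection_orthogonal: "orth_projection P \<Longrightarrow> inner (P x) (y - P y) = 0"
  by (simp add: selfadj_inner[OF projection_selfadj] blinfun_simps projection_idem)

lemma projection_pythagoras:
  "orth_projection P \<Longrightarrow> (norm x)\<^sup>2 = (norm (P x))\<^sup>2 + (norm (x - P x))\<^sup>2"
  using projection_orthogonal[of P x x]
  by (simp add: power2_norm_eq_inner inner_diff inner_commute)

lemma projection_norm_le: "orth_projection P \<Longrightarrow> norm (P x) \<le> norm x"
  using projection_pythagoras[of P x]
  by (metis le_add_same_cancel1 norm_ge_zero power2_le_imp_le zero_le_power2)

lemma projection_complement: "orth_projection P \<Longrightarrow> orth_projection (id_blinfun - P)"
  by (rule orth_projectionI)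
    (auto simp: selfadj_intros projection_selfadj blinfun_simps projection_idem)

text \<open>\<open>P x\<close> is the Riesz representative, on \<open>K\<close>, of the inner
  product with \<open>x\<close>; closure of \<open>K\<close> under complex multiples makes
  \<open>P\<close> complex linear.\<close>

lemma projection_onto_closed:
  fixes K :: "'a::complex_hilbert_space set"
  assumes K: "subspace K" "closed K" and c: "\<And>c x. x \<in> K \<Longrightarrow> c *\<^sub>C x \<in> K"
  shows "\<exists>P. orth_projection P \<and> (\<forall>x. P x = x \<longleftrightarrow> x \<in> K)"
proof -
  have "\<exists>y\<in>K. \<forall>z\<in>K. inner z x = inner z y" for x
    by (rule riesz_on_closed_subspace[OF K bounded_linear_inner_left[of x]]) auto
  then obtain p where pK: "\<And>x. p x \<in> K" and p: "\<And>x z. z \<in> K \<Longrightarrow> inner z x = inner z (p x)"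
    by metis
  have p_eqI: "p x = y" if "y \<in> K" "\<And>z. z \<in> K \<Longrightarrow> inner z x = inner z y" for x y
  proof -
    have "p x - y \<in> K" using pK that K(1) by (simp add: subspace_diff)
    from p[OF this, of x] that(2)[OF this] have "inner (p x - y) (p x - y) = 0"
      by (simp add: inner_diff_right)
    then show ?thesis by simp
  qed
  have p_id: "p x = x \<longleftrightarrow> x \<in> K" for x using p_eqI[of x x] pK by metis
  have blp: "bounded_linear p"
  proof (rule bounded_linear_intro[where K = 1])
    show "p (x + y) = p x + p y" for x y
      by (rule p_eqI) (use K(1) pK in \<open>auto simp: subspace_add inner_add_right simp flip: p\<close>)
    show "p (r *\<^sub>R x) = r *\<^sub>R p x" for r x
      by (rule p_eqI) (use K(1) pK in \<open>auto simp: subspace_scale simp flip: p\<close>)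
    show "norm (p x) \<le> norm x * 1" for x
    proof (cases "p x = 0")
      case False
      have "norm (p x) * norm (p x) = inner (p x) x"
        using p[OF pK] by (metis power2_norm_eq_inner power2_eq_square)
      also have "\<dots> \<le> norm (p x) * norm x" by (rule norm_cauchy_schwarz)
      finally show ?thesis using False by simp
    qed simp
  qed
  define P where "P = Blinfun p"
  have P: "P x = p x" for x by (simp add: P_def bounded_linear_Blinfun_apply blp)
  have "p (c *\<^sub>C x) = c *\<^sub>C p x" for c x
  proof (rule p_eqI)
    fix z assume "z \<in> K"
    have shift: "inner z (c *\<^sub>C u) = inner (cnj c *\<^sub>C z) u" for u
      by (simp add: inner_eq_Re_cinner cinner_scaleC_left cinner_scaleC_right)
    show "inner z (c *\<^sub>C x) = inner z (c *\<^sub>C p x)"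
      unfolding shift by (rule p[OF assms(3)[OF \<open>z \<in> K\<close>]])
  qed (use pK assms(3) in blast)
  moreover have "inner (p x) y = inner x (p y)" for x y
    using p[OF pK[of x], of y] p[OF pK[of y], of x] by (simp add: inner_commute)
  ultimately have "selfadj P" by (simp add: selfadj_def complex_linear_def P)
  then have "orth_projection P" by (rule orth_projectionI) (simp add: P p_id pK)
  then show ?thesis using p_id P by metis
qed

text \<open>Invariance of the range gives \<open>T E = E T E\<close>; taking adjoints gives
  \<open>E T = E T E\<close>.\<close>

lemma projection_commute:
  assumes E: "orth_projection E" and T: "selfadj T" and inv: "\<And>x. E x = x \<Longrightarrow> E (T x) = T x"
  shows "T o\<^sub>L E = E o\<^sub>L T"
proof (rule blinfun_eqI)
  fix x
  have ETE: "E (T (E y)) = T (E y)" for y using inv[of "E y"] projection_idem[OF E] by simp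
  have "inner z (T (E x)) = inner z (E (T x))" for z
  proof -
    have "inner z (T (E x)) = inner z (E (T (E x)))" by (simp add: ETE)
    also have "\<dots> = inner (T (E z)) (E x)"
      using selfadj_inner[OF T] selfadj_inner[OF projection_selfadj[OF E]] by metis
    also have "\<dots> = inner (T (E z)) x"
      using ETE selfadj_inner[OF projection_selfadj[OF E]] by metis
    also have "\<dots> = inner z (E (T x))"
      using selfadj_inner[OF T] selfadj_inner[OF projection_selfadj[OF E]] by metis
    finally show ?thesis .
  qed
  then show "(T o\<^sub>L E) x = (E o\<^sub>L T) x" using inner_ext by (metis blinfun_apply_blinfun_compose)
qed

lemma kernel_projection:
  fixes A :: "'a::complex_hilbert_space \<Rightarrow>\<^sub>L 'b::complex_hilbert_space"
  assumes "complex_linear A"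
  shows "\<exists>E. orth_projection E \<and> (\<forall>x. E x = x \<longleftrightarrow> A x = 0)"
proof -
  have "subspace {x. A x = 0}"
    by (auto simp: subspace_def blinfun_simps)
  moreover have "closed {x. A x = 0}"
    by (intro closed_Collect_eq continuous_intros)
  ultimately show ?thesis
    using projection_onto_closed[of "{x. A x = 0}"] assms by (simp add: complex_linear_apply)
qed

text \<open>The witness is the projection onto the kernel of the positive part of \<open>A\<close>.\<close>

lemma spectral_projection_exists:
  fixes A :: "'a::complex_hilbert_space \<Rightarrow>\<^sub>L 'a"
  assumes A: "selfadj A"
  shows "\<exists>E. orth_projection E \<and> (\<forall>x. E x = x \<longrightarrow> inner (A x) x \<le> 0) \<and>
    (\<forall>x. E x = 0 \<longrightarrow> x \<noteq> 0 \<longrightarrow> inner (A x) x > 0) \<and>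
    (\<forall>T. selfadj T \<longrightarrow> T o\<^sub>L A = A o\<^sub>L T \<longrightarrow> T o\<^sub>L E = E o\<^sub>L T)"
proof -
  define B where "B = abs_op A"
  have B: "nonneg_op B" and BB: "B (B x) = A (A x)" for x
    using nonneg_abs_op[OF A] abs_op_square[OF A]
    by (auto simp: B_def) (metis blinfun_apply_blinfun_compose)
  have AB: "A (B x) = B (A x)" for x
    unfolding B_def by (rule commute_apply, rule abs_op_commute[OF A]) simp
  have "complex_linear (B + A)"
    using A B by (intro complex_linear_intros) (auto simp: selfadj_linear nonneg_op_selfadj)
  \<comment> \<open>\<open>B + A\<close> is twice the positive part of \<open>A\<close>.\<close>
  then obtain E where E: "orth_projection E" and Eker: "\<And>x. E x = x \<longleftrightarrow> B x + A x = 0"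
    using kernel_projection[of "B + A"] by (auto simp: blinfun_simps)
  have comm: "T o\<^sub>L E = E o\<^sub>L T" if T: "selfadj T" "T o\<^sub>L A = A o\<^sub>L T" for T
  proof (rule projection_commute[OF E T(1)])
    fix x assume "E x = x"
    have "B (T x) + A (T x) = T (B x + A x)"
      using commute_apply[OF T(2)] commute_apply[OF abs_op_commute[OF A T(2)]]
      by (simp add: blinfun_simps B_def)
    also have "\<dots> = 0" using \<open>E x = x\<close> Eker by (simp add: blinfun_simps)
    finally show "E (T x) = T x" using Eker by blast
  qed
  have neg: "inner (A x) x \<le> 0" if "E x = x" for x
  proof -
    have "A x = - B x" using that Eker[of x] by (simp add: eq_neg_iff_add_eq_0 add.commute)
    then show ?thesis using nonneg_op_inner[OF B, of x] by simp
  qed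
  have pos: "inner (A x) x > 0" if "E x = 0" "x \<noteq> 0" for x
  proof -
    \<comment> \<open>\<open>(B + A) (B - A) = B B - A A = 0\<close>, so \<open>B x - A x\<close>
      lies in the range of \<open>E\<close>; since \<open>E x = 0\<close> and \<open>E\<close>
      commutes with both operators, it is also annihilated by \<open>E\<close>.\<close>
    have "B (B x - A x) + A (B x - A x) = 0"
      by (simp add: blinfun_simps BB AB)
    then have "E (B x - A x) = B x - A x" using Eker by blast
    moreover have "E (A x) = A (E x)" "E (B x) = B (E x)"
      using comm[OF A] comm[OF nonneg_op_selfadj[OF B]] AB
      by (simp_all add: blinfun_eq_iff)
    ultimately have "A x = B x" using that by (simp add: blinfun_simps)
    then have "inner (A x) x \<ge> 0" using nonneg_op_inner[OF B, of x] by simp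
    moreover have "inner (A x) x \<noteq> 0"
    proof
      assume "inner (A x) x = 0"
      then have "B x = 0" using \<open>A x = B x\<close> nonneg_op_kernel[OF B] by metis
      then have "E x = x" using Eker \<open>A x = B x\<close> by simp
      then show False using that by simp
    qed
    ultimately show ?thesis by simp
  qed
  show ?thesis using E neg pos comm by blast
qed

text \<open>For nested projections the squared distance of two images of \<open>x\<close> is the
  difference of their squared norms, and these are increasing and bounded.\<close>

lemma increasing_projections_converge:
  fixes P :: "nat \<Rightarrow> 'a::complex_hilbert_space \<Rightarrow>\<^sub>L 'a"
  assumes P: "\<And>n. orth_projection (P n)" and mono: "\<And>m n x. m \<le> n \<Longrightarrow> P n (P m x) = P m x"
  shows "\<exists>Q. orth_projection Q \<and> (\<forall>x. (\<lambda>n. P n x) \<longlonglongrightarrow> Q x)"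
proof -
  have dist_sq: "(norm (P n x - P m x))\<^sup>2 = (norm (P n x))\<^sup>2 - (norm (P m x))\<^sup>2" if "m \<le> n" for m n x
  proof -
    have "inner (P n x) (P m x) = inner x (P m x)"
      using selfadj_inner[OF projection_selfadj[OF P]] mono[OF that] by metis
    also have "\<dots> = inner (P m x) (P m x)"
      using projection_inner[OF P, of m x] by (simp add: inner_commute power2_norm_eq_inner)
    finally show ?thesis
      by (simp add: power2_norm_eq_inner inner_diff inner_commute)
  qed
  have conv: "convergent (\<lambda>n. P n x)" for x
  proof (rule Cauchy_convergent, rule Cauchy_if_dist_bounded[where p = 1])
    show "incseq (\<lambda>n. (norm (P n x))\<^sup>2)"
    proof (rule incseq_SucI)
      fix n show "(norm (P n x))\<^sup>2 \<le> (norm (P (Suc n) x))\<^sup>2"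
        using dist_sq[of n "Suc n" x] zero_le_power2[of "norm (P (Suc n) x - P n x)"] by simp
    qed
    show "(norm (P n x))\<^sup>2 \<le> (norm x)\<^sup>2" for n
      by (intro power_mono projection_norm_le P) auto
    show "(dist (P n x) (P m x)) ^ Suc 1 \<le> (norm (P n x))\<^sup>2 - (norm (P m x))\<^sup>2" if "m \<le> n" for m n
      using dist_sq[OF that, of x] by (simp add: dist_norm power2_eq_square)
  qed
  define q where "q x = lim (\<lambda>n. P n x)" for x
  have q: "(\<lambda>n. P n x) \<longlonglongrightarrow> q x" for x
    using conv unfolding q_def by (simp add: convergent_LIMSEQ_iff)
  have nq: "norm (q x) \<le> norm x" for x
  proof (rule LIMSEQ_le_const2)
    show "(\<lambda>n. norm (P n x)) \<longlonglongrightarrow> norm (q x)" by (intro tendsto_intros q)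
  qed (use projection_norm_le[OF P] in blast)
  have "bounded_linear q"
  proof (rule bounded_linear_intro[where K = 1])
    show "q (x + y) = q x + q y" for x y
      by (rule LIMSEQ_unique[OF q]) (simp add: blinfun_simps tendsto_add q)
    show "q (r *\<^sub>R x) = r *\<^sub>R q x" for r x
      by (rule LIMSEQ_unique[OF q]) (simp add: blinfun_simps tendsto_scaleR q)
  qed (use nq in simp)
  then obtain Q where Q: "\<And>x. blinfun_apply Q x = q x"
    using bounded_linear_Blinfun_apply by metis
  have "selfadj Q"
    by (rule selfadj_limit[of P]) (auto simp: Q q projection_selfadj P)
  moreover have "Q (Q x) = Q x" for x
  proof -
    have "P m (q x) = P m x" for m
    proof (rule LIMSEQ_unique)
      show "(\<lambda>n. P m (P n x)) \<longlonglongrightarrow> P m (q x)" by (intro blinfun.tendsto q tendsto_const)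
      have "P m (P n x) = P m x" if "n \<ge> m" for n
      proof (rule inner_ext)
        fix z
        show "inner z (P m (P n x)) = inner z (P m x)"
          using selfadj_inner[OF projection_selfadj[OF P]] mono[OF that] by metis
      qed
      then show "(\<lambda>n. P m (P n x)) \<longlonglongrightarrow> P m x"
        by (intro tendsto_eventually eventually_sequentiallyI)
    qed
    then show ?thesis using q[of "q x"] q[of x] LIMSEQ_unique by (simp add: Q)
  qed
  ultimately have "orth_projection Q" by (rule orth_projectionI)
  then show ?thesis using Q q by auto
qed

section \<open>The spectral theorem\<close>

lemma form_bound: "\<bar>inner (blinfun_apply A x) x\<bar> \<le> norm A * (norm (x::'a::real_inner))\<^sup>2"
proof -
  have "\<bar>inner (A x) x\<bar> \<le> norm (A x) * norm x" by (rule Cauchy_Schwarz_ineq2)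
  also have "\<dots> \<le> norm A * norm x * norm x" by (intro mult_right_mono norm_blinfun) auto
  finally show ?thesis by (simp add: power2_eq_square mult.assoc)
qed

lemma projection_inner_commute: "orth_projection P \<Longrightarrow> inner (P x) y = inner x (P y)"
  by (simp add: projection_selfadj selfadj_inner)

text \<open>The partial sums are increasing projections.\<close>

lemma orthogonal_projections_sum:
  fixes P :: "nat \<Rightarrow> 'a::complex_hilbert_space \<Rightarrow>\<^sub>L 'a"
  assumes P: "\<And>n. orth_projection (P n)" and orth: "\<And>m n x. m \<noteq> n \<Longrightarrow> P m (P n x) = 0"
  shows "\<exists>Q. orth_projection Q \<and> (\<forall>x. (\<lambda>n. P n x) sums Q x)"
proof -
  define S where "S n = sum P {..<n}" for n
  have Sx: "S n x = (\<Sum>i<n. P i x)" for n x by (simp add: S_def blinfun.sum_left)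
  have saS: "selfadj (S n)" for n
    by (induction n) (auto simp: S_def selfadj_intros projection_selfadj P)
  have PS: "P m (S n x) = (if m < n then P m x else 0)" for m n x
  proof -
    have "P m (S n x) = (\<Sum>i<n. P m (P i x))" by (simp add: Sx blinfun.sum_right)
    also have "\<dots> = (\<Sum>i<n. if i = m then P m x else 0)"
      by (intro sum.cong) (auto simp: orth projection_idem[OF P])
    finally show ?thesis by simp
  qed
  have SS: "S n (S m x) = S m x" if "m \<le> n" for m n x
  proof -
    have "S n (S m x) = (\<Sum>i<n. if i < m then P i x else 0)" by (simp add: Sx[of n] PS)
    also have "\<dots> = (\<Sum>i<m. P i x)"
      using that by (intro sum.mono_neutral_cong_right) auto
    finally show ?thesis by (simp add: Sx)
  qed
  have "\<exists>Q. orth_projection Q \<and> (\<forall>x. (\<lambda>n. S n x) \<longlonglongrightarrow> Q x)"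
    by (rule increasing_projections_converge) (auto intro: orth_projectionI saS SS)
  then show ?thesis unfolding sums_def Sx .
qed

text \<open>A Riemann-Stieltjes estimate: on \<open>n\<close> equal pieces the bounds telescope to
  \<open>(b - a) * (F b - F a) / n\<close>, which is arbitrarily small. It will identify the
  integral of \<open>t\<close> with the form of \<open>H\<close>.\<close>

lemma eq_endpoints_if_small_increments:
  fixes h F :: "real \<Rightarrow> real"
  assumes "a \<le> b" and h: "\<And>u v. a \<le> u \<Longrightarrow> u \<le> v \<Longrightarrow> v \<le> b \<Longrightarrow> \<bar>h v - h u\<bar> \<le> (v - u) * (F v - F u)"
  shows "h a = h b"
proof (rule ccontr)
  assume "h a \<noteq> h b"
  then have "\<bar>h b - h a\<bar> > 0" by simp
  then obtain n where n: "(b - a) * (F b - F a) < real n * \<bar>h b - h a\<bar>"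
    using reals_Archimedean3 by blast
  have "0 \<le> (b - a) * (F b - F a)" using h[of a b] \<open>a \<le> b\<close> by linarith
  then have "n > 0" using n by (cases n) auto
  define t where "t i = a + real i * ((b - a) / real n)" for i
  have t0: "t 0 = a" and tn: "t n = b" using \<open>n > 0\<close> by (auto simp: t_def)
  have t_step: "t (Suc i) - t i = (b - a) / real n" for i
    unfolding t_def of_nat_Suc distrib_right by simp
  have tin: "a \<le> t i" "t i \<le> t (Suc i)" "i < n \<Longrightarrow> t (Suc i) \<le> b" for i
  proof -
    show "a \<le> t i" using \<open>a \<le> b\<close> by (simp add: t_def)
    show "t i \<le> t (Suc i)" using t_step[of i] \<open>a \<le> b\<close> by (simp add: field_simps)
    assume "i < n"
    then have "real (Suc i) * ((b - a) / real n) \<le> real n * ((b - a) / real n)"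
      using \<open>a \<le> b\<close> by (intro mult_right_mono) auto
    then show "t (Suc i) \<le> b" using \<open>n > 0\<close> by (simp add: t_def)
  qed
  have "\<bar>h b - h a\<bar> = \<bar>\<Sum>i<n. h (t (Suc i)) - h (t i)\<bar>"
    by (simp only: sum_lessThan_telescope[of "\<lambda>i. h (t i)"] t0 tn)
  also have "\<dots> \<le> (\<Sum>i<n. \<bar>h (t (Suc i)) - h (t i)\<bar>)" by (rule sum_abs)
  also have "\<dots> \<le> (\<Sum>i<n. (b - a) / real n * (F (t (Suc i)) - F (t i)))"
    by (intro sum_mono) (metis h[OF tin] t_step lessThan_iff)
  also have "\<dots> = (b - a) / real n * (F b - F a)"
    by (simp only: sum_distrib_left[symmetric] sum_lessThan_telescope[of "\<lambda>i. F (t i)"] t0 tn)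
  finally have "real n * \<bar>h b - h a\<bar> \<le> (b - a) * (F b - F a)"
    using \<open>n > 0\<close> by (simp add: field_simps)
  with n show False by simp
qed

subsection \<open>Construction of the spectral measure\<close>

text \<open>\<open>E l\<close> stands for the spectral projection of \<open>{..l}\<close>.
  Strictness on the kernel alone places eigenvectors for \<open>l\<close> in the range and makes the
  family right continuous.\<close>

locale spectral_family =
  fixes H :: "'a::complex_hilbert_space \<Rightarrow>\<^sub>L 'a" and E :: "real \<Rightarrow> 'a \<Rightarrow>\<^sub>L 'a"
  assumes E: "orth_projection (E l)"
    and E_le: "E l x = x \<Longrightarrow> inner (H x) x \<le> l * (norm x)\<^sup>2"
    and E_gt: "E l x = 0 \<Longrightarrow> x \<noteq> 0 \<Longrightarrow> l * (norm x)\<^sup>2 < inner (H x) x"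
    and EH: "E l (H x) = H (E l x)"
    and EE: "E l (E m x) = E m (E l x)"
begin

text \<open>The defect vector \<open>z\<close> lies in the range of \<open>E l\<close> and the
  kernel of \<open>E m\<close>, where the bounds by \<open>l\<close> and \<open>m\<close> contradict
  each other unless \<open>z = 0\<close>.\<close>

lemma E_mono: assumes "l \<le> m" shows "E m (E l x) = E l x"
proof -
  define z where "z = E l x - E m (E l x)"
  have "E l z = z" "E m z = 0"
    by (simp_all add: z_def blinfun_simps EE[of l m] projection_idem[OF E])
  then have "inner (H z) z \<le> l * (norm z)\<^sup>2" "z \<noteq> 0 \<Longrightarrow> m * (norm z)\<^sup>2 < inner (H z) z"
    using E_le E_gt by blast+
  moreover have "l * (norm z)\<^sup>2 \<le> m * (norm z)\<^sup>2" using assms by (intro mult_right_mono) auto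
  ultimately have "z = 0" by linarith
  then show ?thesis by (simp add: z_def)
qed

definition F where "F x l = inner (E l x) x"

lemma F_diff:
  assumes "l \<le> m" shows "F x m - F x l = (norm (E m x - E l x))\<^sup>2"
proof -
  have "inner (E m x) (E l x) = F x l"
    unfolding F_def using E_mono[OF assms] projection_inner_commute[OF E] inner_commute by metis
  moreover have "inner (E m x) (E m x) = F x m" "inner (E l x) (E l x) = F x l"
    unfolding F_def using projection_inner[OF E] by (simp_all add: power2_norm_eq_inner)
  ultimately show ?thesis by (simp add: power2_norm_eq_inner inner_diff inner_commute)
qed

lemma F_mono: "l \<le> m \<Longrightarrow> F x l \<le> F x m"
  using F_diff[of l m x] zero_le_power2[of "norm (E m x - E l x)"] by linarith

lemma E_low: assumes "l < - norm H" shows "E l x = 0"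
proof (rule ccontr)
  assume "E l x \<noteq> 0"
  then have "l * (norm (E l x))\<^sup>2 < - norm H * (norm (E l x))\<^sup>2"
    using assms by (intro mult_strict_right_mono) auto
  moreover have "inner (H (E l x)) (E l x) \<le> l * (norm (E l x))\<^sup>2"
    by (rule E_le) (rule projection_idem[OF E])
  ultimately show False using form_bound[of H "E l x"] by auto
qed

lemma E_high: assumes "norm H \<le> l" shows "E l x = x"
proof -
  define z where "z = x - E l x"
  have "E l z = 0" by (simp add: z_def blinfun_simps projection_idem[OF E])
  then have "z \<noteq> 0 \<Longrightarrow> l * (norm z)\<^sup>2 < inner (H z) z" by (rule E_gt)
  moreover have "norm H * (norm z)\<^sup>2 \<le> l * (norm z)\<^sup>2" using assms by (intro mult_right_mono) auto
  ultimately have "z = 0" using form_bound[of H z] by (auto simp: abs_le_iff)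
  then show ?thesis by (simp add: z_def)
qed

text \<open>The limit \<open>z\<close> is fixed by every \<open>E (r m)\<close>, so the form on
  \<open>w = z - E a z\<close> is at most \<open>a\<close>, whereas \<open>E a w = 0\<close> makes
  it larger than \<open>a\<close> unless \<open>w = 0\<close>. Complements are used because they
  increase as \<open>r n\<close> decreases.\<close>

lemma E_right_limit: "(\<lambda>n. E (a + inverse (real (Suc n))) x) \<longlonglongrightarrow> E a x"
proof -
  define r where "r n = a + inverse (real (Suc n))" for n
  have r_mono: "r n \<le> r m" if "m \<le> n" for m n
    unfolding r_def using that by (simp add: le_imp_inverse_le)
  have r_ge: "a \<le> r n" for n by (simp add: r_def)
  define P where "P n = id_blinfun - E (r n)" for n
  have "\<exists>Q. orth_projection Q \<and> (\<forall>x. (\<lambda>n. P n x) \<longlonglongrightarrow> Q x)"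
  proof (rule increasing_projections_converge)
    show "orth_projection (P n)" for n unfolding P_def by (intro projection_complement E)
    fix m n :: nat and x assume "m \<le> n"
    then have "E (r n) (E (r m) x) = E (r n) x"
      using E_mono[OF r_mono] by (simp add: EE[of "r n" "r m"])
    then show "P n (P m x) = P m x" by (simp add: P_def blinfun_simps)
  qed
  then obtain Q where Q: "(\<lambda>n. P n x) \<longlonglongrightarrow> blinfun_apply Q x" by blast
  define z where "z = x - Q x"
  have "(\<lambda>n. x - P n x) \<longlonglongrightarrow> z" unfolding z_def by (intro tendsto_intros Q)
  then have lim: "(\<lambda>n. E (r n) x) \<longlonglongrightarrow> z" by (simp add: P_def blinfun_simps)
  have Ez: "E (r m) z = z" for m
  proof (rule LIMSEQ_unique)
    show "(\<lambda>n. E (r m) (E (r n) x)) \<longlonglongrightarrow> E (r m) z" by (intro blinfun.tendsto tendsto_const lim)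
    have "E (r m) (E (r n) x) = E (r n) x" if "n \<ge> m" for n by (rule E_mono[OF r_mono[OF that]])
    then have "\<forall>\<^sub>F n in sequentially. E (r n) x = E (r m) (E (r n) x)"
      by (intro eventually_sequentiallyI[of m]) simp
    then show "(\<lambda>n. E (r m) (E (r n) x)) \<longlonglongrightarrow> z" by (rule Lim_transform_eventually[OF lim])
  qed
  define w where "w = z - E a z"
  have "E (r m) w = w" for m
    using E_mono[OF r_ge] by (simp add: w_def blinfun_simps Ez)
  then have "inner (H w) w \<le> r m * (norm w)\<^sup>2" for m by (rule E_le)
  moreover have "(\<lambda>m. r m * (norm w)\<^sup>2) \<longlonglongrightarrow> (a + 0) * (norm w)\<^sup>2"
    unfolding r_def by (intro tendsto_intros LIMSEQ_inverse_real_of_nat)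
  ultimately have "inner (H w) w \<le> (a + 0) * (norm w)\<^sup>2"
    by (intro LIMSEQ_le_const) auto
  moreover have "E a w = 0" by (simp add: w_def blinfun_simps projection_idem[OF E])
  ultimately have "w = 0" using E_gt[of a w] by auto
  then have "z = E a z" by (simp add: w_def)
  also have "E a z = E a x"
  proof (rule LIMSEQ_unique)
    show "(\<lambda>n. E a (E (r n) x)) \<longlonglongrightarrow> E a z" by (intro blinfun.tendsto tendsto_const lim)
    show "(\<lambda>n. E a (E (r n) x)) \<longlonglongrightarrow> E a x"
      using E_mono[OF r_ge] by (simp add: EE[of a])
  qed
  finally show ?thesis using lim by (simp add: r_def)
qed

lemma F_right_cont: "continuous (at_right a) (F x)"
proof -
  have "\<exists>d>0. F x (a + d) - F x a < e" if "e > 0" for e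
  proof -
  have "(\<lambda>n. F x (a + inverse (real (Suc n)))) \<longlonglongrightarrow> F x a"
    unfolding F_def by (intro tendsto_intros E_right_limit)
  then have "\<forall>\<^sub>F n in sequentially. F x (a + inverse (real (Suc n))) < F x a + e"
    by (rule order_tendstoD) (use \<open>e > 0\<close> in simp)
  then obtain n where "F x (a + inverse (real (Suc n))) < F x a + e"
    using eventually_sequentially by auto
  then have "F x (a + inverse (real (Suc n))) - F x a < e" by simp
  then show ?thesis
    by (intro exI[of _ "inverse (real (Suc n))"]) simp
  qed
  then show ?thesis
    using continuous_at_right_real_increasing[of "F x" a, OF F_mono] by blast
qed

definition \<mu> where "\<mu> x = interval_measure (F x)"

lemma sets_\<mu> [measurable_cong]: "sets (\<mu> x) = sets borel" by (simp add: \<mu>_def)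
lemma space_\<mu>: "space (\<mu> x) = UNIV" by (simp add: \<mu>_def)

lemma emeasure_\<mu>_Ioc: "a \<le> b \<Longrightarrow> emeasure (\<mu> x) {a<..b} = ennreal (F x b - F x a)"
  unfolding \<mu>_def by (intro emeasure_interval_measure_Ioc F_mono F_right_cont)

lemma measure_\<mu>_Ioc: "a \<le> b \<Longrightarrow> measure (\<mu> x) {a<..b} = F x b - F x a"
  unfolding \<mu>_def by (intro measure_interval_measure_Ioc F_mono F_right_cont)

lemma emeasure_\<mu>_large:
  assumes "norm H < l" shows "emeasure (\<mu> x) {- l<..l} = ennreal ((norm x)\<^sup>2)"
proof -
  have "0 \<le> l" using assms norm_ge_zero[of H] by linarith
  then have "emeasure (\<mu> x) {- l<..l} = ennreal (F x l - F x (- l))"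
    by (intro emeasure_\<mu>_Ioc) simp
  then show ?thesis
    using assms by (simp add: F_def E_low E_high power2_norm_eq_inner)
qed

lemma emeasure_\<mu>_UNIV: "emeasure (\<mu> x) UNIV = ennreal ((norm x)\<^sup>2)"
proof (rule LIMSEQ_unique)
  have "(\<lambda>n. emeasure (\<mu> x) {- real n<..real n}) \<longlonglongrightarrow> emeasure (\<mu> x) (\<Union>n. {- real n<..real n})"
    by (intro Lim_emeasure_incseq) (auto simp: sets_\<mu> incseq_def)
  moreover have "(\<Union>n. {- real n<..real n}) = UNIV"
  proof -
    have "t \<in> (\<Union>n. {- real n<..real n})" for t
    proof -
      obtain n where "\<bar>t\<bar> < real n" using reals_Archimedean2 by blast
      then have "t \<in> {- real n<..real n}" by auto
      then show ?thesis by blast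
    qed
    then show ?thesis by blast
  qed
  ultimately show "(\<lambda>n. emeasure (\<mu> x) {- real n<..real n}) \<longlonglongrightarrow> emeasure (\<mu> x) UNIV" by simp
  obtain N :: nat where "norm H < real N" using reals_Archimedean2 by blast
  then have "emeasure (\<mu> x) {- real n<..real n} = ennreal ((norm x)\<^sup>2)" if "n \<ge> N" for n
    using that by (intro emeasure_\<mu>_large) (meson less_le_trans of_nat_mono)
  then show "(\<lambda>n. emeasure (\<mu> x) {- real n<..real n}) \<longlonglongrightarrow> ennreal ((norm x)\<^sup>2)"
    by (intro tendsto_eventually eventually_sequentiallyI)
qed

lemma finite_\<mu>: "finite_measure (\<mu> x)"
  by (rule finite_measureI) (simp add: space_\<mu> emeasure_\<mu>_UNIV)

lemma measure_\<mu>_UNIV: "measure (\<mu> x) UNIV = (norm x)\<^sup>2"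
  by (simp add: measure_def emeasure_\<mu>_UNIV)

text \<open>The measure of \<open>Q x\<close> already puts its whole mass on \<open>C\<close>, which
  leaves none for \<open>B\<close>.\<close>

lemma orthogonal_if_disjoint:
  assumes B: "B \<in> sets borel" "C \<in> sets borel" "B \<inter> C = {}"
    and P: "orth_projection P" "\<And>x. measure (\<mu> x) B = inner (P x) x"
    and Q: "orth_projection Q" "\<And>x. measure (\<mu> x) C = inner (Q x) x"
  shows "P (Q x) = 0"
proof -
  interpret finite_measure "\<mu> (Q x)" by (rule finite_\<mu>)
  have "measure (\<mu> (Q x)) B + measure (\<mu> (Q x)) C = measure (\<mu> (Q x)) (B \<union> C)"
    by (intro finite_measure_Union[symmetric]) (use B in \<open>auto simp: sets_\<mu>\<close>)
  also have "\<dots> \<le> measure (\<mu> (Q x)) UNIV"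
    using bounded_measure[of "B \<union> C"] by (simp add: space_\<mu>)
  finally have "(norm (P (Q x)))\<^sup>2 + (norm (Q x))\<^sup>2 \<le> (norm (Q x))\<^sup>2"
    by (simp add: P Q measure_\<mu>_UNIV projection_inner projection_idem dot_square_norm)
  then show ?thesis by simp
qed

text \<open>Dynkin induction from half-open intervals, whose projections are
  \<open>E b - E a\<close>. In the union step, disjointness of the sets makes the projections
  orthogonal, so they can be summed.\<close>

lemma borel_projection_exists:
  assumes "B \<in> sets borel"
  shows "\<exists>P. orth_projection P \<and> (\<forall>x. measure (\<mu> x) B = inner (P x) x)"
proof -
  let ?G = "range (\<lambda>(a, b). {a<..b::real})"
  have eq: "sets (borel :: real measure) = sigma_sets UNIV ?G"
    unfolding borel_sigma_sets_Ioc by simp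
  have "Int_stable ?G"
  proof (rule Int_stableI)
    fix S T assume "S \<in> ?G" "T \<in> ?G"
    then obtain a b c d where "S = {a<..b}" "T = {c<..d}" by auto
    then have "S \<inter> T = (\<lambda>(a, b). {a<..b}) (max a c, min b d)" by auto
    then show "S \<inter> T \<in> ?G" by blast
  qed
  moreover have "?G \<subseteq> Pow UNIV" by simp
  moreover have "B \<in> sigma_sets UNIV ?G" using assms eq by simp
  ultimately show ?thesis
  proof (induction rule: sigma_sets_induct_disjoint)
    case (basic S)
    then obtain a b where S: "S = {a<..b}" by auto
    show ?case
    proof (cases "a \<le> b")
      case True
      have "orth_projection (E b - E a)"
      proof (rule orth_projectionI)
        show "selfadj (E b - E a)" by (intro selfadj_intros projection_selfadj E)
        show "(E b - E a) ((E b - E a) x) = (E b - E a) x" for x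
          using E_mono[OF True] by (simp add: blinfun_simps projection_idem[OF E] EE[of a b])
      qed
      then show ?thesis
        using True by (intro exI[of _ "E b - E a"])
          (auto simp: S measure_\<mu>_Ioc F_def blinfun_simps inner_diff)
    qed (auto simp: S intro!: exI[of _ 0] orth_projectionI selfadj_zero)
  next
    case empty
    then show ?case by (auto intro!: exI[of _ 0] orth_projectionI selfadj_zero)
  next
    case (compl S)
    then obtain P where P: "orth_projection P" "\<And>x. measure (\<mu> x) S = inner (P x) x" by blast
    have "measure (\<mu> x) (UNIV - S) = inner ((id_blinfun - P) x) x" for x
    proof -
      interpret finite_measure "\<mu> x" by (rule finite_\<mu>)
      have "S \<in> sets (\<mu> x)" using compl by (simp add: sets_\<mu> eq)
      then show ?thesis
        using finite_measure_compl[of S]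
        by (simp add: space_\<mu> P measure_\<mu>_UNIV blinfun_simps inner_diff power2_norm_eq_inner)
    qed
    with projection_complement[OF P(1)] show ?case by blast
  next
    case (union A)
    then obtain P where P: "\<And>i. orth_projection (P i)" "\<And>i x. measure (\<mu> x) (A i) = inner (P i x) x"
      by metis
    have A: "range A \<subseteq> sets borel" using union eq by simp
    have "P m (P n x) = 0" if "m \<noteq> n" for m n x
    proof (rule orthogonal_if_disjoint[OF _ _ _ P(1) P(2) P(1) P(2)])
      show "A m \<in> sets borel" "A n \<in> sets borel" using A by auto
      show "A m \<inter> A n = {}" using union(1) that by (simp add: disjoint_family_on_def)
    qed
    then obtain Q where Q: "orth_projection Q" "\<And>x. (\<lambda>n. P n x) sums blinfun_apply Q x"
      using orthogonal_projections_sum[of P] P(1) by blast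
    have "measure (\<mu> x) (\<Union>i. A i) = inner (Q x) x" for x
    proof (rule sums_unique2)
      interpret finite_measure "\<mu> x" by (rule finite_\<mu>)
      show "(\<lambda>i. measure (\<mu> x) (A i)) sums measure (\<mu> x) (\<Union>i. A i)"
        by (intro finite_measure_UNION) (use A union(1) in \<open>auto simp: sets_\<mu>\<close>)
      show "(\<lambda>i. measure (\<mu> x) (A i)) sums inner (Q x) x"
        unfolding P by (rule bounded_linear.sums[OF bounded_linear_inner_left Q(2)])
    qed
    with Q(1) show ?case by blast
  qed
qed

definition G where
  "G B = (SOME P. orth_projection P \<and> (\<forall>x. measure (\<mu> x) B = inner (P x) x))"

lemma
  assumes "B \<in> sets borel"
  shows projection_G: "orth_projection (G B)" and measure_\<mu>: "measure (\<mu> x) B = inner (G B x) x"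
proof -
  have "orth_projection (G B) \<and> (\<forall>x. measure (\<mu> x) B = inner (G B x) x)"
    unfolding G_def by (rule someI_ex[OF borel_projection_exists[OF assms]])
  then show "orth_projection (G B)" "measure (\<mu> x) B = inner (G B x) x" by blast+
qed

lemma G_orthogonal:
  "B \<in> sets borel \<Longrightarrow> C \<in> sets borel \<Longrightarrow> B \<inter> C = {} \<Longrightarrow> G B (G C x) = 0"
  by (rule orthogonal_if_disjoint[of B C]) (auto simp: projection_G measure_\<mu>)

lemma G_Un:
  assumes "B \<in> sets borel" "C \<in> sets borel" "B \<inter> C = {}"
  shows "G (B \<union> C) = G B + G C"
proof (rule selfadj_eqI)
  fix x
  interpret finite_measure "\<mu> x" by (rule finite_\<mu>)
  have "measure (\<mu> x) (B \<union> C) = measure (\<mu> x) B + measure (\<mu> x) C"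
    by (intro finite_measure_Union) (use assms in \<open>auto simp: sets_\<mu>\<close>)
  then show "inner (G (B \<union> C) x) x = inner ((G B + G C) x) x"
    using assms by (simp add: measure_\<mu> blinfun_simps inner_add)
qed (use assms in \<open>auto simp: projection_G projection_selfadj selfadj_intros\<close>)

lemma G_Int:
  assumes [measurable]: "B \<in> sets borel" "C \<in> sets borel"
  shows "G (B \<inter> C) = G B o\<^sub>L G C"
proof (rule blinfun_eqI)
  fix x
  have "G B = G (B \<inter> C \<union> (B - C))" by (intro arg_cong[of _ _ G]) auto
  also have "\<dots> = G (B \<inter> C) + G (B - C)" by (intro G_Un) auto
  finally have B: "G B = G (B \<inter> C) + G (B - C)" .
  have "G C = G (B \<inter> C \<union> (C - B))" by (intro arg_cong[of _ _ G]) auto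
  also have "\<dots> = G (B \<inter> C) + G (C - B)" by (intro G_Un) auto
  finally have C: "G C = G (B \<inter> C) + G (C - B)" .
  have "G (B \<inter> C) (G (C - B) x) = 0" "G (B - C) (G (B \<inter> C) x) = 0" "G (B - C) (G (C - B) x) = 0"
    by (intro G_orthogonal; auto)+
  then show "G (B \<inter> C) x = (G B o\<^sub>L G C) x"
    by (simp add: B C blinfun_simps projection_idem[OF projection_G])
qed

lemma projection_valued_measure_G: "projection_valued_measure G"
  unfolding projection_valued_measure_def
proof (intro conjI ballI allI impI)
  show "orth_projection (G B)" if "B \<in> sets borel" for B by (rule projection_G[OF that])
  show "G UNIV = id_blinfun"
    by (rule selfadj_eqI)
      (auto simp: projection_G projection_selfadj selfadj_intros measure_\<mu>_UNIV power2_norm_eq_inner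
        simp flip: measure_\<mu>)
  show "G (B \<inter> C) = G B o\<^sub>L G C" if "B \<in> sets borel" "C \<in> sets borel" for B C
    by (rule G_Int[OF that])
  fix A :: "nat \<Rightarrow> real set" and x assume A: "range A \<subseteq> sets borel" "disjoint_family A"
  have GA: "orth_projection (G (A n))" for n by (intro projection_G) (use A in auto)
  have "G (A m) (G (A n) y) = 0" if "m \<noteq> n" for m n y
    by (intro G_orthogonal) (use A that in \<open>auto simp: disjoint_family_on_def\<close>)
  then obtain Q where Q: "orth_projection Q" "\<And>x. (\<lambda>n. G (A n) x) sums blinfun_apply Q x"
    using orthogonal_projections_sum[of "\<lambda>n. G (A n)"] GA by blast
  have UA: "(\<Union>n. A n) \<in> sets borel" using A by auto
  have "Q = G (\<Union>n. A n)"
  proof (rule selfadj_eqI)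
    fix x
    interpret finite_measure "\<mu> x" by (rule finite_\<mu>)
    have m: "measure (\<mu> x) (A i) = inner (G (A i) x) x" for i
      by (intro measure_\<mu>) (use A in auto)
    have "(\<lambda>i. inner (G (A i) x) x) sums measure (\<mu> x) (\<Union>i. A i)"
      unfolding m[symmetric] by (intro finite_measure_UNION) (use A in \<open>auto simp: sets_\<mu>\<close>)
    moreover have "(\<lambda>i. inner (G (A i) x) x) sums inner (Q x) x"
      by (rule bounded_linear.sums[OF bounded_linear_inner_left Q(2)])
    ultimately show "inner (Q x) x = inner (G (\<Union>n. A n) x) x"
      unfolding measure_\<mu>[OF UA, symmetric] by (rule sums_unique2[rotated])
  qed (use Q(1) UA in \<open>auto simp: projection_selfadj projection_G\<close>)
  then show "(\<lambda>n. G (A n) x) sums G (\<Union>n. A n) x" using Q by simp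
qed

lemma scalar_measure_G: "scalar_measure G x = \<mu> x"
proof -
  interpret finite_measure "\<mu> x" by (rule finite_\<mu>)
  have "scalar_measure G x = measure_of (space (\<mu> x)) (sets (\<mu> x)) (emeasure (\<mu> x))"
    unfolding scalar_measure_def space_\<mu> sets_\<mu>
  proof (rule measure_of_eq)
    fix B assume "B \<in> sigma_sets UNIV (sets (borel :: real measure))"
    then have "B \<in> sets borel" by (metis sets.sigma_sets_eq space_borel)
    then show "ennreal (Re (cinner (G B x) x)) = emeasure (\<mu> x) B"
      by (simp add: emeasure_eq_measure measure_\<mu> flip: inner_eq_Re_cinner)
  qed simp
  then show ?thesis by (simp add: measure_of_of_measure)
qed

text \<open>Over \<open>{u<..v}\<close> both the increment of the form of \<open>H\<close> and the
  integral lie between \<open>u\<close> and \<open>v\<close> times the mass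
  \<open>F x v - F x u\<close>. Their difference \<open>h\<close> therefore satisfies the increment
  bound of \<open>eq_endpoints_if_small_increments\<close>.\<close>

lemma
  shows integrable_\<mu>: "integrable (\<mu> x) (\<lambda>t. t)"
    and integral_\<mu>: "(\<integral>t. t \<partial>\<mu> x) = inner (H x) x"
proof -
  interpret finite_measure "\<mu> x" by (rule finite_\<mu>)
  \<comment> \<open>Strictly above the norm, because \<open>E_low\<close> holds only for
    \<open>l < - norm H\<close>.\<close>
  define N where "N = norm H + 1"
  have N: "0 \<le> N" "norm H < N" by (auto simp: N_def)
  have "emeasure (\<mu> x) (space (\<mu> x) - {- N<..N}) = emeasure (\<mu> x) (space (\<mu> x)) - emeasure (\<mu> x) {- N<..N}"
    by (intro emeasure_compl) (auto simp: sets_\<mu> emeasure_eq_measure)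
  also have "\<dots> = 0"
    by (simp add: space_\<mu> emeasure_\<mu>_UNIV emeasure_\<mu>_large[OF N(2)])
  finally have "UNIV - {- N<..N} \<in> null_sets (\<mu> x)"
    by (auto simp: null_sets_def sets_\<mu> space_\<mu>)
  then have AE: "AE t in \<mu> x. t \<in> {- N<..N}" by (rule AE_I') auto
  show int: "integrable (\<mu> x) (\<lambda>t. t)"
  proof (rule integrable_const_bound)
    show "AE t in \<mu> x. norm t \<le> N" using AE by eventually_elim auto
  qed simp
  have int_ind: "integrable (\<mu> x) (\<lambda>t. indicator {u<..v} t * t)" for u v :: real
    using integrable_mult_indicator[OF _ int, of "{u<..v}"] by (simp add: sets_\<mu>)
  have int_const: "integrable (\<mu> x) (\<lambda>t. indicator {u<..v} t * (c::real))" for u v c :: real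
    by (rule integrable_const_bound[where B = "\<bar>c\<bar>"]) (auto simp: indicator_def)
  define h where "h l = inner (H (E l x)) x - (\<integral>t. indicator {- N<..l} t * t \<partial>\<mu> x)" for l
  have "h (- N) = h N"
  proof (rule eq_endpoints_if_small_increments[where h = h and F = "F x"])
    show "- N \<le> N" using N by simp
    fix u v assume uv: "- N \<le> u" "u \<le> v" "v \<le> N"
    define w where "w = E v x - E u x"
    have w: "E v w = w" "E u w = 0" "(norm w)\<^sup>2 = F x v - F x u"
      using E_mono[OF uv(2)] F_diff[OF uv(2)]
      by (simp_all add: w_def blinfun_simps projection_idem[OF E] EE[of u v])
    have "inner (H w) w = inner (H w) (E v x) - inner (H w) (E u x)"
      by (simp add: w_def inner_diff)
    also have "\<dots> = inner (H (E v w)) x - inner (H (E u w)) x"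
      by (simp add: EH flip: projection_inner_commute[OF E])
    finally have Hw: "inner (H w) w = inner (H (E v x)) x - inner (H (E u x)) x"
      by (simp add: w) (simp add: w_def blinfun_simps inner_diff)
    have up: "inner (H w) w \<le> v * (F x v - F x u)" using E_le[OF w(1)] by (simp add: w)
    have lo: "u * (F x v - F x u) \<le> inner (H w) w"
      using E_gt[OF w(2)] w(3) by (cases "w = 0") auto
    define I where "I = (\<integral>t. indicator {u<..v} t * t \<partial>\<mu> x)"
    have "(\<integral>t. indicator {- N<..v} t * t \<partial>\<mu> x) - (\<integral>t. indicator {- N<..u} t * t \<partial>\<mu> x)
        = (\<integral>t. indicator {- N<..v} t * t - indicator {- N<..u} t * t \<partial>\<mu> x)"
      by (intro Bochner_Integration.integral_diff[symmetric] int_ind)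
    also have "\<dots> = I"
      unfolding I_def by (intro Bochner_Integration.integral_cong) (use uv in \<open>auto simp: indicator_def\<close>)
    finally have hI: "h v - h u = inner (H w) w - I"
      unfolding h_def Hw by linarith
    have const: "(\<integral>t. indicator {u<..v} t * c \<partial>\<mu> x) = c * (F x v - F x u)" for c :: real
      using measure_\<mu>_Ioc[OF uv(2), of x] by (simp add: space_\<mu> sets_\<mu> mult.commute)
    have "I \<le> (\<integral>t. indicator {u<..v} t * v \<partial>\<mu> x)"
      unfolding I_def by (intro integral_mono int_ind int_const) (auto simp: indicator_def)
    moreover have "(\<integral>t. indicator {u<..v} t * u \<partial>\<mu> x) \<le> I"
      unfolding I_def by (intro integral_mono int_ind int_const) (auto simp: indicator_def)
    ultimately have "u * (F x v - F x u) \<le> I" "I \<le> v * (F x v - F x u)"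
      unfolding const by auto
    with up lo show "\<bar>h v - h u\<bar> \<le> (v - u) * (F x v - F x u)"
      unfolding hI left_diff_distrib by linarith
  qed
  moreover have "h (- N) = 0" using N by (simp add: h_def E_low)
  moreover have "(\<integral>t. indicator {- N<..N} t * t \<partial>\<mu> x) = (\<integral>t. t \<partial>\<mu> x)"
  proof (rule integral_cong_AE)
    show "AE t in \<mu> x. indicator {- N<..N} t * t = t" using AE by eventually_elim simp
  qed simp_all
  moreover have "E N x = x" using N by (simp add: E_high)
  ultimately show "(\<integral>t. t \<partial>\<mu> x) = inner (H x) x" by (simp add: h_def)
qed

end

text \<open>Commutation of \<open>E l\<close> and \<open>E m\<close> comes from using the same
  clause twice: \<open>E l\<close> commutes with \<open>H\<close>, and \<open>E m\<close> commutes
  with every selfadjoint operator that does.\<close>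

lemma spectral_measure_exists:
  fixes H :: "'a::complex_hilbert_space \<Rightarrow>\<^sub>L 'a"
  assumes H: "selfadj H"
  shows "\<exists>E. is_spectral_measure E H"
proof -
  have "\<exists>E. orth_projection E \<and> (\<forall>x. E x = x \<longrightarrow> inner (H x) x \<le> l * (norm x)\<^sup>2) \<and>
    (\<forall>x. E x = 0 \<longrightarrow> x \<noteq> 0 \<longrightarrow> inner (H x) x > l * (norm x)\<^sup>2) \<and>
    (\<forall>T. selfadj T \<longrightarrow> T o\<^sub>L H = H o\<^sub>L T \<longrightarrow> T o\<^sub>L E = E o\<^sub>L T)" for l
  proof -
    let ?A = "H - l *\<^sub>R id_blinfun"
    have "selfadj ?A" by (intro selfadj_intros H)
    moreover have "T o\<^sub>L ?A = ?A o\<^sub>L T" if "T o\<^sub>L H = H o\<^sub>L T" for T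
      by (rule blinfun_eqI) (simp add: blinfun_simps commute_apply[OF that])
    moreover have "inner (?A x) x = inner (H x) x - l * (norm x)\<^sup>2" for x
      by (simp add: blinfun_simps inner_diff power2_norm_eq_inner)
    ultimately show ?thesis using spectral_projection_exists[of ?A] by auto
  qed
  then obtain E where E: "\<And>l. orth_projection (E l)"
    "\<And>l x. E l x = x \<Longrightarrow> inner (H x) x \<le> l * (norm x)\<^sup>2"
    "\<And>l x. E l x = 0 \<Longrightarrow> x \<noteq> 0 \<Longrightarrow> l * (norm x)\<^sup>2 < inner (H x) x"
    "\<And>l T. selfadj T \<Longrightarrow> T o\<^sub>L H = H o\<^sub>L T \<Longrightarrow> T o\<^sub>L E l = E l o\<^sub>L T"
    by metis
  have EH: "H o\<^sub>L E l = E l o\<^sub>L H" for l by (rule E(4)[OF H refl])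
  have EE: "E m o\<^sub>L E l = E l o\<^sub>L E m" for l m
    by (rule E(4)[OF projection_selfadj[OF E(1)] EH[symmetric]])
  interpret spectral_family H E
    by unfold_locales (use E EH EE commute_apply in metis)+
  have "is_spectral_measure G H"
    unfolding is_spectral_measure_def scalar_measure_G
    using projection_valued_measure_G integrable_\<mu> integral_\<mu> cinner_quadratic[OF H] by simp
  then show ?thesis by blast
qed

lemma is_spectral_measure_spectral_measure:
  "selfadj H \<Longrightarrow> is_spectral_measure (spectral_measure H) H"
  unfolding spectral_measure_def by (rule someI_ex[OF spectral_measure_exists])

section \<open>The negative spectral projection\<close>

lemma sets_scalar_measure [measurable_cong]: "sets (scalar_measure E x) = sets borel"
  unfolding scalar_measure_def
  by (metis sets.sigma_sets_eq sets_measure_of space_borel top_greatest Pow_UNIV)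

text \<open>\<open>measure_of\<close> attains the given values once countable additivity is
  established; this is the strong additivity of \<open>E\<close> tested against
  \<open>x\<close>.\<close>

lemma emeasure_scalar_measure:
  assumes E: "projection_valued_measure E" and B: "B \<in> sets borel"
  shows "emeasure (scalar_measure E x) B = ennreal (inner (E B x) x)"
proof -
  let ?f = "\<lambda>B. ennreal (inner (E B x) x)"
  have P: "orth_projection (E B)" if "B \<in> sets borel" for B
    using E that by (simp add: projection_valued_measure_def)
  have sums: "(\<lambda>n. E (A n) y) sums E (\<Union>n. A n) y"
    if "range A \<subseteq> sets borel" "disjoint_family A" for A :: "nat \<Rightarrow> real set" and y
    using E that by (simp add: projection_valued_measure_def)
  have "E {} x = 0"
  proof -
    have "(\<lambda>n::nat. E {} x) sums E {} x"
      using sums[of "\<lambda>_. {}" x] by (simp add: disjoint_family_on_def)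
    then have "(\<lambda>n::nat. E {} x) \<longlonglongrightarrow> 0" by (intro summable_LIMSEQ_zero sums_summable)
    then show ?thesis by (simp add: LIMSEQ_const_iff)
  qed
  have "scalar_measure E x = measure_of UNIV (sets borel) ?f"
    by (simp add: scalar_measure_def inner_eq_Re_cinner)
  then show ?thesis
  proof (rule emeasure_measure_of)
    show "positive (sets (scalar_measure E x)) ?f"
      using \<open>E {} x = 0\<close> by (simp add: positive_def)
    show "countably_additive (sets (scalar_measure E x)) ?f"
      unfolding countably_additive_def
    proof (intro allI impI)
      fix A :: "nat \<Rightarrow> real set"
      assume "range A \<subseteq> sets (scalar_measure E x)" "disjoint_family A"
      then have A: "range A \<subseteq> sets borel" "disjoint_family A" by (simp_all add: sets_scalar_measure)
      have "(\<lambda>n. inner (E (A n) x) x) sums inner (E (\<Union>n. A n) x) x"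
        using A by (intro bounded_linear.sums[OF bounded_linear_inner_left] sums) auto
      moreover have "0 \<le> inner (E (A n) x) x" for n
        using A projection_inner[OF P[of "A n"], of x] by auto
      ultimately show "(\<Sum>n. ?f (A n)) = ?f (\<Union>n. A n)" by (rule suminf_ennreal_eq[rotated])
    qed
  qed (use B in \<open>auto simp: scalar_measure_def\<close>)
qed

lemma space_scalar_measure: "space (scalar_measure E x) = UNIV"
  by (simp add: scalar_measure_def space_measure_of_conv)

text \<open>Stated for an arbitrary spectral measure of \<open>H\<close>, since the choice made in
  \<open>spectral_measure\<close> is known only through \<open>is_spectral_measure\<close>.\<close>

context
  fixes H :: "'a::complex_hilbert_space \<Rightarrow>\<^sub>L 'a" and E
  assumes H: "selfadj H" and E: "is_spectral_measure E H"
begin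

private lemma pvm: "projection_valued_measure E"
  using E by (simp add: is_spectral_measure_def)

private lemma E_projection: "B \<in> sets borel \<Longrightarrow> orth_projection (E B)"
  using pvm by (simp add: projection_valued_measure_def)

private lemma E_Int: "B \<in> sets borel \<Longrightarrow> C \<in> sets borel \<Longrightarrow> E (B \<inter> C) x = E B (E C x)"
  using pvm by (simp add: projection_valued_measure_def)

private lemma finite_scalar_measure: "finite_measure (scalar_measure E x)"
  by (rule finite_measureI) (simp add: space_scalar_measure emeasure_scalar_measure[OF pvm])

private lemma E_compl: "B \<in> sets borel \<Longrightarrow> E (- B) x = x - E B x"
proof -
  assume B: "B \<in> sets borel"
  have "E (- B) = id_blinfun - E B"
  proof (rule selfadj_eqI)
    fix x
    interpret finite_measure "scalar_measure E x" by (rule finite_scalar_measure)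
    have m: "measure (scalar_measure E x) C = inner (E C x) x" if "C \<in> sets borel" for C
      using projection_inner[OF E_projection[OF that], of x]
      by (simp add: measure_def emeasure_scalar_measure[OF pvm that])
    have "measure (scalar_measure E x) (space (scalar_measure E x) - B)
        = measure (scalar_measure E x) (space (scalar_measure E x)) - measure (scalar_measure E x) B"
      by (rule finite_measure_compl) (simp add: sets_scalar_measure B)
    moreover have "E UNIV = id_blinfun" using pvm by (simp add: projection_valued_measure_def)
    ultimately show "inner (E (- B) x) x = inner ((id_blinfun - E B) x) x"
      using B by (simp add: space_scalar_measure m blinfun_simps inner_diff Compl_eq_Diff_UNIV)
  qed (simp_all add: selfadj_intros projection_selfadj E_projection B borel_comp)
  then show ?thesis by (simp add: blinfun_simps)
qed

text \<open>Multiplicativity of \<open>E\<close> makes the measure of \<open>E B x\<close> the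
  restriction to \<open>B\<close> of the measure of \<open>x\<close>.\<close>

private lemma form_restrict:
  assumes B: "B \<in> sets borel"
  shows "inner (H (E B x)) (E B x) = (\<integral>t. indicator B t * t \<partial>scalar_measure E x)"
proof -
  have "scalar_measure E (E B x) = density (scalar_measure E x) (\<lambda>t. ennreal (indicator B t))"
  proof (rule measure_eqI)
    fix C assume "C \<in> sets (scalar_measure E (E B x))"
    then have C: "C \<in> sets borel" by (simp add: sets_scalar_measure)
    have "inner (E C (E B x)) (E B x) = inner (E (B \<inter> C) x) x"
    proof -
      have "E B (E C (E B x)) = E (B \<inter> C) x"
        by (metis E_Int[OF B C] E_Int[OF C B] Int_commute projection_idem[OF E_projection[OF B]])
      then show ?thesis by (metis projection_inner_commute[OF E_projection[OF B]])
    qed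
    then show "emeasure (scalar_measure E (E B x)) C
        = emeasure (density (scalar_measure E x) (\<lambda>t. ennreal (indicator B t))) C"
      using B C by (simp add: ennreal_indicator emeasure_restricted emeasure_scalar_measure[OF pvm]
          sets_scalar_measure)
  qed (simp add: sets_scalar_measure)
  moreover have "inner (H (E B x)) (E B x) = (\<integral>t. t \<partial>scalar_measure E (E B x))"
    using E by (simp add: is_spectral_measure_def inner_eq_Re_cinner)
  ultimately show ?thesis
    using B by (simp add: integral_density)
qed

private lemma integrable_restrict:
  "B \<in> sets borel \<Longrightarrow> integrable (scalar_measure E x) (\<lambda>t. indicator B t * t)"
  using integrable_mult_indicator[of B "scalar_measure E x" "\<lambda>t. t"] E
  by (simp add: sets_scalar_measure is_spectral_measure_def)

text \<open>The integral splits over \<open>B\<close> and its complement, so the form of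
  \<open>H\<close> has no cross terms between range and kernel of \<open>E B\<close>; hence the
  range is invariant.\<close>

private lemma E_commute:
  assumes B: "B \<in> sets borel" shows "H o\<^sub>L E B = E B o\<^sub>L H"
proof (rule projection_commute[OF E_projection[OF B] H])
  have split: "inner (H x) x = inner (H (E B x)) (E B x) + inner (H (x - E B x)) (x - E B x)" for x
  proof -
    have "(\<integral>t. t \<partial>scalar_measure E x)
      = (\<integral>t. indicator B t * t + indicator (- B) t * t \<partial>scalar_measure E x)"
      by (intro Bochner_Integration.integral_cong) (auto simp: indicator_def)
    also have "\<dots> = inner (H (E B x)) (E B x) + inner (H (x - E B x)) (x - E B x)"
      using B by (simp add: Bochner_Integration.integral_add integrable_restrict
          form_restrict[symmetric] E_compl)
    finally show ?thesis using E by (simp add: is_spectral_measure_def inner_eq_Re_cinner)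
  qed
  fix y assume y: "E B y = y"
  have cross: "inner (H y) z = 0" if z: "E B z = 0" for z
  proof -
    have "inner (H z) y = inner (H y) z" using selfadj_inner[OF H] inner_commute by metis
    then show ?thesis
      using split[of "y + z"] y z by (simp add: blinfun_simps inner_add)
  qed
  have "E B (H y - E B (H y)) = 0"
    by (simp add: blinfun_simps projection_idem[OF E_projection[OF B]])
  note cross[OF this]
  moreover have "inner (E B (H y)) (H y - E B (H y)) = 0"
    by (rule projection_orthogonal[OF E_projection[OF B]])
  ultimately have "inner (H y - E B (H y)) (H y - E B (H y)) = 0"
    by (simp add: inner_diff_left)
  then show "E B (H y) = H y" by simp
qed

text \<open>If the integral vanished, the measure of \<open>{..<0}\<close> would be zero, but for
  \<open>x\<close> in the range this measure is the squared norm of \<open>x\<close>.\<close>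

private lemma E_neg:
  assumes "E {..<0} x = x" "x \<noteq> 0" shows "inner (H x) x < 0"
proof -
  let ?M = "scalar_measure E x"
  have int: "integrable ?M (\<lambda>t. - (indicator {..<0} t * t))"
    using integrable_restrict[of "{..<0}" x] by simp
  have form: "inner (H x) x = - (\<integral>t. - (indicator {..<0} t * t) \<partial>?M)"
    using form_restrict[of "{..<0}" x] assms by simp
  have nn: "AE t in ?M. 0 \<le> - (indicator {..<0::real} t * t)"
    by (auto simp: indicator_def)
  have "(\<integral>t. - (indicator {..<0} t * t) \<partial>?M) \<noteq> 0"
  proof
    assume "(\<integral>t. - (indicator {..<0} t * t) \<partial>?M) = 0"
    then have "AE t in ?M. - (indicator {..<0::real} t * t) = 0"
      using integral_nonneg_eq_0_iff_AE[OF int nn] by simp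
    then have "AE t in ?M. \<not> t < 0" by eventually_elim (auto simp: indicator_def)
    then have "emeasure ?M {..<0} = 0"
      by (subst (asm) AE_iff_measurable[of "{..<0}"]) (auto simp: sets_scalar_measure space_scalar_measure)
    then have "inner (E {..<0} x) x \<le> 0"
      by (simp add: emeasure_scalar_measure[OF pvm] ennreal_eq_0_iff)
    then have "inner x x \<le> 0" using assms by simp
    then show False using assms(2) by (metis inner_gt_zero_iff not_le)
  qed
  moreover have "0 \<le> (\<integral>t. - (indicator {..<0} t * t) \<partial>?M)"
    by (rule integral_nonneg_AE[OF nn])
  ultimately show ?thesis using form by simp
qed

private lemma E_nonneg:
  assumes "E {..<0} x = 0" shows "inner (H x) x \<ge> 0"
proof -
  have "- {..<0::real} = {0..}" by auto
  then have "E {0..} x = x" using E_compl[of "{..<0}" x] assms by simp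
  then have "inner (H x) x = (\<integral>t. indicator {0..} t * t \<partial>scalar_measure E x)"
    using form_restrict[of "{0..}" x] by simp
  also have "\<dots> \<ge> 0" by (rule integral_nonneg_AE) (auto simp: indicator_def)
  finally show ?thesis .
qed

lemmas spectral_measure_negative_facts =
  E_projection[of "{..<0}", simplified] E_commute[of "{..<0}", simplified] E_neg E_nonneg

text \<open>The sign function is one minus twice the indicator of \<open>{..<0}\<close>, so the sign
  operator reduces to the negative projection.\<close>

lemma sign_integral:
  "(\<integral>t. (if t \<ge> 0 then 1 else - 1) \<partial>scalar_measure E x) = inner ((id_blinfun - 2 *\<^sub>R E {..<0}) x) x"
proof -
  interpret finite_measure "scalar_measure E x" by (rule finite_scalar_measure)
  have int: "integrable (scalar_measure E x) (indicator B :: real \<Rightarrow> real)" if "B \<in> sets borel" for B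
    by (rule integrable_const_bound[where B = 1]) (use that in \<open>auto simp: indicator_def\<close>)
  have m: "measure (scalar_measure E x) C = inner (E C x) x" if "C \<in> sets borel" for C
    using projection_inner[OF E_projection[OF that], of x]
    by (simp add: measure_def emeasure_scalar_measure[OF pvm that])
  have "E UNIV = id_blinfun" using pvm by (simp add: projection_valued_measure_def)
  have "(\<integral>t. (if t \<ge> 0 then 1 else - 1 :: real) \<partial>scalar_measure E x)
    = (\<integral>t. indicator UNIV t - 2 * indicator {..<0} t \<partial>scalar_measure E x)"
    by (intro Bochner_Integration.integral_cong) (auto simp: indicator_def)
  also have "\<dots> = (\<integral>t. indicator UNIV t \<partial>scalar_measure E x)
      - (\<integral>t. 2 * indicator {..<0} t \<partial>scalar_measure E x)"
    by (intro Bochner_Integration.integral_diff integrable_mult_right int) auto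
  also have "\<dots> = measure (scalar_measure E x) UNIV - 2 * measure (scalar_measure E x) {..<0}"
    by (simp add: space_scalar_measure)
  also have "\<dots> = inner ((id_blinfun - 2 *\<^sub>R E {..<0}) x) x"
    by (simp add: m \<open>E UNIV = id_blinfun\<close> blinfun_simps inner_diff)
  finally show ?thesis .
qed

end

section \<open>Sign and absolute value expressed by the negative projection\<close>

definition neg_projection :: "('a::complex_hilbert_space \<Rightarrow>\<^sub>L 'a) \<Rightarrow> ('a \<Rightarrow>\<^sub>L 'a)" where
  "neg_projection H = spectral_measure H {..<0}"

text \<open>Apart from the definition of \<open>nu_minus\<close>, the rest of the proof reaches the
  spectral measure only through these five facts.\<close>

lemma
  assumes "selfadj H"
  shows projection_neg_projection: "orth_projection (neg_projection H)"
    and neg_projection_neg: "neg_projection H x = x \<Longrightarrow> x \<noteq> 0 \<Longrightarrow> inner (H x) x < 0"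
    and neg_projection_nonneg: "neg_projection H x = 0 \<Longrightarrow> inner (H x) x \<ge> 0"
    and neg_projection_self_commute: "H o\<^sub>L neg_projection H = neg_projection H o\<^sub>L H"
    and sign_op_eq: "sign_op H = id_blinfun - 2 *\<^sub>R neg_projection H"
proof -
  let ?P = "neg_projection H"
  note E = is_spectral_measure_spectral_measure[OF assms]
  note facts = spectral_measure_negative_facts[OF assms E, folded neg_projection_def]
  show P: "orth_projection ?P" and "?P x = x \<Longrightarrow> x \<noteq> 0 \<Longrightarrow> inner (H x) x < 0"
    and "?P x = 0 \<Longrightarrow> inner (H x) x \<ge> 0" and "H o\<^sub>L ?P = ?P o\<^sub>L H"
    by (fact facts)+
  note sign = sign_integral[OF assms E, folded neg_projection_def]
  have sa: "selfadj (id_blinfun - 2 *\<^sub>R ?P)" by (intro selfadj_intros projection_selfadj P)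
  show "sign_op H = id_blinfun - 2 *\<^sub>R ?P"
    unfolding sign_op_def functional_calculus_def sign
  proof (rule the_equality)
    show "complex_linear (id_blinfun - 2 *\<^sub>R ?P) \<and>
      (\<forall>x. cinner ((id_blinfun - 2 *\<^sub>R ?P) x) x = complex_of_real (inner ((id_blinfun - 2 *\<^sub>R ?P) x) x))"
      using sa cinner_quadratic selfadj_linear by blast
    fix A assume A: "complex_linear A \<and>
      (\<forall>x. cinner (A x) x = complex_of_real (inner ((id_blinfun - 2 *\<^sub>R ?P) x) x))"
    then have "selfadj A" by (intro selfadj_of_real_form) auto
    then show "A = id_blinfun - 2 *\<^sub>R ?P"
      using sa A by (intro selfadj_eqI) (auto simp: inner_eq_Re_cinner)
  qed
qed

lemma sign_op_apply: "selfadj H \<Longrightarrow> sign_op H x = x - 2 *\<^sub>R neg_projection H x"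
  by (simp add: sign_op_eq blinfun_simps)

lemma selfadj_sign_op: "selfadj H \<Longrightarrow> selfadj (sign_op H)"
  unfolding sign_op_eq by (intro selfadj_intros projection_selfadj[OF projection_neg_projection])

lemma sign_op_involution: "selfadj H \<Longrightarrow> sign_op H (sign_op H x) = x"
  by (simp add: sign_op_apply blinfun_simps projection_idem[OF projection_neg_projection]
      scaleR_2)

lemma sign_op_form:
  assumes "selfadj H"
  shows "inner (sign_op H x) x = (norm (x - neg_projection H x))\<^sup>2 - (norm (neg_projection H x))\<^sup>2"
proof -
  have "inner (sign_op H x) x = (norm x)\<^sup>2 - 2 * (norm (neg_projection H x))\<^sup>2"
    using projection_inner[OF projection_neg_projection[OF assms], of x]
    by (simp add: sign_op_apply[OF assms] inner_diff_left dot_square_norm)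
  then show ?thesis
    using projection_pythagoras[OF projection_neg_projection[OF assms], of x] by linarith
qed

lemma sign_op_self_commute: "selfadj H \<Longrightarrow> sign_op H (H x) = H (sign_op H x)"
  using commute_apply[OF neg_projection_self_commute, symmetric]
  by (simp add: sign_op_apply blinfun_simps)

text \<open>\<open>H o\<^sub>L sign_op H\<close> is a root of \<open>H o\<^sub>L H\<close>. With
  \<open>x = u + v\<close> split by the negative projection, the cross terms of its form cancel,
  leaving the form at \<open>v\<close> minus the form at \<open>u\<close>.\<close>

lemma abs_op_eq_sign:
  assumes H: "selfadj H" shows "abs_op H = H o\<^sub>L sign_op H"
  unfolding abs_op_selfadj[OF H]
proof (rule sqrt_op_eqI)
  let ?P = "neg_projection H"
  note P = projection_neg_projection[OF H]
  show "(H o\<^sub>L sign_op H) o\<^sub>L (H o\<^sub>L sign_op H) = H o\<^sub>L H"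
    by (rule blinfun_eqI) (simp add: sign_op_self_commute[OF H] sign_op_involution[OF H])
  show "nonneg_op (H o\<^sub>L sign_op H)"
    unfolding nonneg_op_iff
  proof (intro conjI allI)
    show "selfadj (H o\<^sub>L sign_op H)"
      by (intro selfadj_compose H selfadj_sign_op) (auto intro: blinfun_eqI simp: sign_op_self_commute[OF H])
    fix x
    define u where "u = ?P x"
    define v where "v = x - ?P x"
    have uv: "?P u = u" "?P v = 0" "x = u + v" "sign_op H x = v - u"
      by (simp_all add: u_def v_def blinfun_simps projection_idem[OF P] sign_op_apply[OF H]
          scaleR_2)
    have "inner (H u) u \<le> 0" using neg_projection_neg[OF H uv(1)] by (cases "u = 0") auto
    moreover have "inner (H v) v \<ge> 0" using neg_projection_nonneg[OF H uv(2)] .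
    moreover have "inner (H u) v = inner (H v) u"
      using selfadj_inner[OF H] inner_commute by metis
    ultimately show "0 \<le> inner ((H o\<^sub>L sign_op H) x) x"
      unfolding blinfun_apply_blinfun_compose uv(4)
      by (simp add: uv(3) blinfun_simps inner_diff inner_add)
  qed
qed

text \<open>The kernel of the negative projection is invariant under \<open>T\<close>: there
  \<open>abs_op H\<close> agrees with \<open>H\<close>, both commute with \<open>T\<close>, and
  \<open>H\<close> is injective on the negative range because its form is strictly negative
  there.\<close>

lemma neg_projection_commute:
  assumes H: "selfadj H" and T: "selfadj T" "T o\<^sub>L H = H o\<^sub>L T"
  shows "T o\<^sub>L neg_projection H = neg_projection H o\<^sub>L T"
proof -
  let ?P = "neg_projection H"
  note P = projection_neg_projection[OF H]
  have "T o\<^sub>L (id_blinfun - ?P) = (id_blinfun - ?P) o\<^sub>L T"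
  proof (rule projection_commute[OF projection_complement[OF P] T(1)])
    fix x assume "(id_blinfun - ?P) x = x"
    then have Px: "?P x = 0" by (simp add: blinfun_simps)
    have abs: "abs_op H y = H y - 2 *\<^sub>R H (?P y)" for y
      by (simp add: abs_op_eq_sign[OF H] sign_op_apply[OF H] blinfun_simps)
    have "abs_op H (T x) = T (abs_op H x)"
      using commute_apply[OF abs_op_commute[OF H T(2)]] by simp
    also have "\<dots> = H (T x)"
      by (simp add: abs Px blinfun_simps commute_apply[OF T(2)])
    finally have "H (?P (T x)) = 0" by (simp add: abs)
    then have "?P (T x) = 0"
      using neg_projection_neg[OF H projection_idem[OF P], of "T x"] by fastforce
    then show "(id_blinfun - ?P) (T x) = T x" by (simp add: blinfun_simps)
  qed
  then show ?thesis
    by (auto simp: blinfun_eq_iff blinfun_simps)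
qed

section \<open>Factorization of \<open>H\<close> into the root of its absolute value and its
  sign\<close>

definition abs_root :: "('a::complex_hilbert_space \<Rightarrow>\<^sub>L 'a) \<Rightarrow> ('a \<Rightarrow>\<^sub>L 'a)" where
  "abs_root H = sqrt_op (abs_op H)"

lemma
  assumes H: "selfadj H"
  shows nonneg_abs_root: "nonneg_op (abs_root H)"
    and abs_root_square: "abs_root H (abs_root H x) = H (sign_op H x)"
    and abs_root_commute: "T o\<^sub>L H = H o\<^sub>L T \<Longrightarrow> T o\<^sub>L abs_root H = abs_root H o\<^sub>L T"
proof -
  note abs = nonneg_abs_op[OF H]
  show "nonneg_op (abs_root H)" unfolding abs_root_def by (rule nonneg_sqrt_op[OF abs])
  show "abs_root H (abs_root H x) = H (sign_op H x)"
    using sqrt_op_square[OF abs] by (simp add: abs_root_def abs_op_eq_sign[OF H] blinfun_eq_iff)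
  show "T o\<^sub>L abs_root H = abs_root H o\<^sub>L T" if "T o\<^sub>L H = H o\<^sub>L T"
    unfolding abs_root_def by (intro sqrt_op_commute[OF abs] abs_op_commute[OF H] that)
qed

lemma selfadj_abs_root: "selfadj H \<Longrightarrow> selfadj (abs_root H)"
  by (rule nonneg_op_selfadj[OF nonneg_abs_root])

lemma abs_root_neg_projection:
  "selfadj H \<Longrightarrow> abs_root H (neg_projection H x) = neg_projection H (abs_root H x)"
  using commute_apply[OF abs_root_commute[OF _ neg_projection_self_commute[symmetric]]] by metis

lemma abs_root_sign: "selfadj H \<Longrightarrow> abs_root H (sign_op H x) = sign_op H (abs_root H x)"
  by (simp add: sign_op_apply blinfun_simps abs_root_neg_projection)

text \<open>This factorization takes the place of an inverse of \<open>H\<close> in the Schur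
  complements.\<close>

lemma abs_root_sign_abs_root: "selfadj H \<Longrightarrow> abs_root H (sign_op H (abs_root H x)) = H x"
  by (simp add: abs_root_sign abs_root_square sign_op_self_commute sign_op_involution)

lemma abs_root_eq_0_iff: assumes H: "selfadj H" shows "abs_root H x = 0 \<longleftrightarrow> H x = 0"
proof
  assume "abs_root H x = 0"
  then have "abs_root H (sign_op H (abs_root H x)) = 0" by (simp add: blinfun_simps)
  then show "H x = 0" by (simp add: abs_root_sign_abs_root[OF H])
next
  assume "H x = 0"
  then have "H (sign_op H x) = 0"
    by (simp add: blinfun_simps flip: sign_op_self_commute[OF H])
  then have "abs_root H (abs_root H x) = 0" by (simp add: abs_root_square[OF H])
  then have "(norm (abs_root H x))\<^sup>2 = 0"
    using selfadj_square_inner[OF selfadj_abs_root[OF H], of x] by simp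
  then show "abs_root H x = 0" by simp
qed

section \<open>Negative squares\<close>

lemma complex_subspace_range: "complex_linear A \<Longrightarrow> complex_vector.subspace (range A)"
  unfolding complex_vector.subspace_def
  by (auto simp: image_iff) (metis blinfun.zero_right, metis blinfun.add_right, metis complex_linear_apply)

lemma complex_subspace_diff:
  "complex_vector.subspace S \<Longrightarrow> x \<in> S \<Longrightarrow> y \<in> S \<Longrightarrow> x - y \<in> S"
  by (rule complex_vector.subspace_diff)

lemma module_hom_complex_linear:
  "complex_linear A \<Longrightarrow> module_hom ((*\<^sub>C)) ((*\<^sub>C)) (blinfun_apply A)"
  by (simp add: module_hom_iff complex_vector.module_axioms blinfun_simps complex_linear_apply)

lemma finite_subspace_dim_basis:
  assumes S: "complex_vector.subspace S" and fin: "subspace_dim S = enat k"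
  obtains B where "finite B" "complex_vector.independent B" "complex_vector.span B = S" "card B = k"
proof -
  from fin obtain C where C: "finite C" "S \<subseteq> complex_vector.span C" and k: "complex_vector.dim S = k"
    by (auto simp: subspace_dim_def split: if_splits)
  obtain B where B: "B \<subseteq> S" "complex_vector.independent B" "S \<subseteq> complex_vector.span B"
      "card B = complex_vector.dim S"
    using complex_vector.basis_exists[of S] by blast
  have "finite B" using complex_vector.independent_span_bound[of C B] B C by blast
  moreover have "complex_vector.span B = S"
    using B S complex_vector.span_minimal[of B S] by blast
  ultimately show ?thesis using that B k by blast
qed

lemma subspace_dim_span:
  assumes "finite B" "complex_vector.independent B"
  shows "subspace_dim (complex_vector.span B) = enat (card B)"
proof -
  have "complex_vector.dim (complex_vector.span B) = card B"
    using assms by (simp add: complex_vector.dim_eq_card)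
  then show ?thesis using assms by (auto simp: subspace_dim_def)
qed

lemma nu_minus_eq: "nu_minus H = subspace_dim (range (neg_projection H))"
  by (simp add: nu_minus_def neg_projection_def)

lemma complex_linear_neg_projection: "selfadj H \<Longrightarrow> complex_linear (neg_projection H)"
  by (rule selfadj_linear[OF projection_selfadj[OF projection_neg_projection]])

lemma neg_range_subspace: "selfadj H \<Longrightarrow> complex_vector.subspace (range (neg_projection H))"
  by (rule complex_subspace_range[OF complex_linear_neg_projection])

lemma neg_projection_range: "selfadj H \<Longrightarrow> x \<in> range (neg_projection H) \<longleftrightarrow> neg_projection H x = x"
  using projection_idem[OF projection_neg_projection, of H] by (auto simp: image_iff intro: sym)

text \<open>Law of inertia: \<open>G\<close> is nonnegative on the kernel of its negative
  projection, so this projection after \<open>L\<close> is injective on \<open>S\<close> and embeds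
  \<open>S\<close> into the negative range.\<close>

lemma negative_subspace_dim_le:
  fixes L :: "'a::complex_hilbert_space \<Rightarrow>\<^sub>L 'b::complex_hilbert_space"
  assumes G: "selfadj G" and L: "complex_linear L" and S: "complex_vector.subspace S"
    and negative: "\<And>x. x \<in> S \<Longrightarrow> x \<noteq> 0 \<Longrightarrow> inner (G (L x)) (L x) < 0"
  shows "subspace_dim S \<le> nu_minus G"
proof (cases "nu_minus G")
  case (enat k)
  let ?P = "neg_projection G"
  have P: "complex_linear ?P"
    using G by (rule complex_linear_neg_projection)
  obtain C where C: "finite C" "complex_vector.span C = range ?P" "card C = k"
    using finite_subspace_dim_basis[OF neg_range_subspace[OF G], of k] enat by (auto simp: nu_minus_eq)
  interpret module_hom "(*\<^sub>C)" "(*\<^sub>C)" "blinfun_apply (?P o\<^sub>L L)"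
    by (intro module_hom_complex_linear complex_linear_intros P L)
  have inj: "inj_on (?P o\<^sub>L L) S"
  proof (rule inj_onI)
    fix x y assume xy: "x \<in> S" "y \<in> S" "(?P o\<^sub>L L) x = (?P o\<^sub>L L) y"
    then have "?P (L (x - y)) = 0" by (simp add: blinfun_simps)
    then have "inner (G (L (x - y))) (L (x - y)) \<ge> 0" by (rule neg_projection_nonneg[OF G])
    then show "x = y" using negative[of "x - y"] complex_subspace_diff[OF S xy(1,2)] by force
  qed
  obtain D where D: "D \<subseteq> S" "complex_vector.independent D" "S \<subseteq> complex_vector.span D"
      "card D = complex_vector.dim S"
    using complex_vector.basis_exists[of S] by blast
  have spanD: "complex_vector.span D = S"
    using D S complex_vector.span_minimal[of D S] by blast
  have "complex_vector.independent ((?P o\<^sub>L L) ` D)"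
    by (rule independent_injective_image) (use D inj spanD in auto)
  moreover have "(?P o\<^sub>L L) ` D \<subseteq> complex_vector.span C" using C by auto
  ultimately have "finite ((?P o\<^sub>L L) ` D)" "card ((?P o\<^sub>L L) ` D) \<le> k"
    using complex_vector.independent_span_bound[OF C(1)] C(3) by blast+
  moreover have injD: "inj_on (?P o\<^sub>L L) D" using inj D(1) by (rule inj_on_subset)
  ultimately have "finite D" "card D \<le> k"
    using finite_imageD[OF _ injD] card_image[OF injD] by simp_all
  then show ?thesis using subspace_dim_span[of D] D spanD enat by simp
qed simp

lemma nu_minus_mono:
  fixes L :: "'a::complex_hilbert_space \<Rightarrow>\<^sub>L 'b::complex_hilbert_space"
  assumes H: "selfadj H" and G: "selfadj G" and L: "complex_linear L"
    and le: "\<And>x. inner (G (L x)) (L x) \<le> inner (H x) x"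
  shows "nu_minus H \<le> nu_minus G"
  unfolding nu_minus_eq[of H]
proof (rule negative_subspace_dim_le[OF G L neg_range_subspace[OF H]])
  fix x assume "x \<in> range (neg_projection H)" "x \<noteq> 0"
  then have "inner (H x) x < 0" using neg_projection_neg[OF H] neg_projection_range[OF H] by blast
  with le[of x] show "inner (G (L x)) (L x) < 0" by simp
qed

text \<open>Completing the square produces the form of \<open>sign_op A\<close> rather than that of
  \<open>A\<close>. Where it is negative, the component of \<open>L x\<close> in the negative range
  is nonzero, and \<open>A\<close> is negative on that component.\<close>

lemma nu_minus_le_sign:
  fixes L :: "'a::complex_hilbert_space \<Rightarrow>\<^sub>L 'b::complex_hilbert_space"
  assumes H: "selfadj H" and A: "selfadj A" and L: "complex_linear L"
    and le: "\<And>x. inner (sign_op A (L x)) (L x) \<le> inner (H x) x"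
  shows "nu_minus H \<le> nu_minus A"
  unfolding nu_minus_eq[of H]
proof (rule negative_subspace_dim_le[OF A _ neg_range_subspace[OF H]])
  let ?P = "neg_projection A"
  show "complex_linear (?P o\<^sub>L L)"
    using A L by (intro complex_linear_compose complex_linear_neg_projection)
  fix x assume "x \<in> range (neg_projection H)" "x \<noteq> 0"
  then have "inner (H x) x < 0" using neg_projection_neg[OF H] neg_projection_range[OF H] by blast
  with le[of x] have "(norm (L x - ?P (L x)))\<^sup>2 < (norm (?P (L x)))\<^sup>2"
    by (simp add: sign_op_form[OF A])
  then have "?P (L x) \<noteq> 0" by (auto simp: not_less)
  then show "inner (A ((?P o\<^sub>L L) x)) ((?P o\<^sub>L L) x) < 0"
    using neg_projection_neg[OF A] projection_idem[OF projection_neg_projection[OF A]] by simp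
qed

lemma form_scaleC:
  assumes "complex_linear M"
  shows "inner (M (c *\<^sub>C w)) (c *\<^sub>C w) = (cmod c)\<^sup>2 * inner (M w) w"
proof -
  have "cinner (M (c *\<^sub>C w)) (c *\<^sub>C w) = (c * cnj c) * cinner (M w) w"
    using assms by (simp add: complex_linear_apply cinner_scaleC_left cinner_scaleC_right)
  then show ?thesis by (simp add: inner_eq_Re_cinner flip: complex_norm_square)
qed

text \<open>
  Otherwise \<open>z\<close> together with the image of \<open>N\<close> would span a negative subspace of dimension \<open>k + 1\<close>.
\<close>

lemma maximal_negative_subspace:
  fixes L :: "'a::complex_hilbert_space \<Rightarrow>\<^sub>L 'b::complex_hilbert_space"
  assumes M: "selfadj M" and L: "complex_linear L" and N: "complex_vector.subspace N"
    and k: "subspace_dim N = enat k" "nu_minus M \<le> enat k"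
    and negative: "\<And>n. n \<in> N \<Longrightarrow> n \<noteq> 0 \<Longrightarrow> inner (M (L n)) (L n) < 0"
  shows "\<exists>n\<in>N. 0 \<le> inner (M (z + L n)) (z + L n)"
proof (rule ccontr)
  assume "\<not> ?thesis"
  then have z: "inner (M (z + L n)) (z + L n) < 0" if "n \<in> N" for n using that by force
  obtain B where B: "finite B" "complex_vector.independent B" "complex_vector.span B = N" "card B = k"
    using finite_subspace_dim_basis[OF N k(1)] by blast
  interpret module_hom "(*\<^sub>C)" "(*\<^sub>C)" "blinfun_apply L" by (rule module_hom_complex_linear[OF L])
  have inj: "inj_on L N"
  proof (rule inj_onI)
    fix x y assume xy: "x \<in> N" "y \<in> N" "L x = L y"
    then have "L (x - y) = 0" by (simp add: blinfun_simps)
    then show "x = y" using negative[of "x - y"] complex_subspace_diff[OF N xy(1,2)] by force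
  qed
  have span: "complex_vector.span (L ` B) = L ` N" using span_image[of B] B(3) by simp
  have "z \<notin> L ` N"
  proof
    assume "z \<in> L ` N"
    then obtain n where "n \<in> N" "z = L n" by blast
    then have "- n \<in> N" "z + L (- n) = 0"
      using complex_vector.subspace_neg[OF N] by (auto simp: blinfun_simps)
    then show False using z[of "- n"] by simp
  qed
  define C where "C = insert z (L ` B)"
  have "inj_on L B" using inj B(3) complex_vector.span_superset[of B] inj_on_subset by blast
  moreover have "z \<notin> L ` B"
    using \<open>z \<notin> L ` N\<close> B(3) complex_vector.span_superset[of B] by blast
  ultimately have C: "finite C" "card C = Suc k"
    using B by (simp_all add: C_def card_image)
  have "complex_vector.independent (L ` B)"
    by (rule independent_injective_image) (use B inj in auto)
  then have indep: "complex_vector.independent C"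
    unfolding C_def using \<open>z \<notin> L ` N\<close> span by (intro complex_vector.independent_insertI) auto
  have "subspace_dim (complex_vector.span C) \<le> nu_minus M"
  proof (rule negative_subspace_dim_le[OF M complex_linear_id complex_vector.subspace_span])
    fix x assume x: "x \<in> complex_vector.span C" "x \<noteq> 0"
    then obtain c n where n: "n \<in> N" "x - c *\<^sub>C z = L n"
      unfolding C_def complex_vector.span_insert span by blast
    have "inner (M x) x < 0"
    proof (cases "c = 0")
      case True
      then have "x = L n" using n by simp
      moreover from this have "n \<noteq> 0" using x by (auto simp: blinfun_simps)
      ultimately show ?thesis using negative[OF n(1)] by simp
    next
      case False
      define m where "m = inverse c *\<^sub>C n"
      have "m \<in> N" unfolding m_def using N n(1) by (rule complex_vector.subspace_scale)
      have "L n = c *\<^sub>C L m"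
        using False L by (simp add: m_def complex_linear_apply)
      then have "x = c *\<^sub>C (z + L m)"
        using n(2) by (simp add: scaleC_add_right algebra_simps)
      then have "inner (M x) x = (cmod c)\<^sup>2 * inner (M (z + L m)) (z + L m)"
        using form_scaleC[OF selfadj_linear[OF M]] by simp
      then show ?thesis using z[OF \<open>m \<in> N\<close>] False by (simp add: mult_pos_neg)
    qed
    then show "inner (M (id_blinfun x)) (id_blinfun x) < 0" by simp
  qed
  then have "enat (Suc k) \<le> enat k"
    using subspace_dim_span[OF C(1) indep] C(2) k(2) by (metis order_trans)
  then show False by simp
qed

text \<open>\<open>R x\<close> is expanded in an orthogonal basis \<open>Q\<close> of the image and
  lifted back by chosen preimages \<open>g\<close>; injectivity identifies the lift with
  \<open>x\<close>, so \<open>b\<close> only has to bound the lifting.\<close>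

lemma finite_dimensional_bounded_below:
  fixes R :: "'a::complex_hilbert_space \<Rightarrow>\<^sub>L 'b::complex_hilbert_space"
  assumes N: "complex_vector.subspace N" and k: "subspace_dim N = enat k"
    and inj: "\<And>x. x \<in> N \<Longrightarrow> R x = 0 \<Longrightarrow> x = 0"
  obtains b where "b \<ge> 0" "\<And>x. x \<in> N \<Longrightarrow> norm x \<le> b * norm (R x)"
proof -
  obtain B where B: "finite B" "complex_vector.independent B" "complex_vector.span B = N" "card B = k"
    by (rule finite_subspace_dim_basis[OF N k])
  \<comment> \<open>Adding the multiples by \<open>\<i>\<close> turns a complex spanning set into a
    finite real one.\<close>
  define T where "T = span (B \<union> (\<lambda>x. \<i> *\<^sub>C x) ` B)"
  have iT: "\<i> *\<^sub>C x \<in> T" if "x \<in> T" for x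
    using that unfolding T_def
  proof (induction rule: span_induct_alt)
    case (step c x y)
    have "\<i> *\<^sub>C (c *\<^sub>R x + y) = c *\<^sub>R (\<i> *\<^sub>C x) + \<i> *\<^sub>C y"
      by (simp add: scaleC_add_right scaleC_scaleR)
    moreover have "\<i> *\<^sub>C x \<in> span (B \<union> (\<lambda>x. \<i> *\<^sub>C x) ` B)"
    proof (cases "x \<in> B")
      case False
      then obtain u where u: "u \<in> B" "x = \<i> *\<^sub>C u" using step by auto
      then have "\<i> *\<^sub>C x = (- 1) *\<^sub>R u" by (simp add: scaleC_scaleC scaleR_scaleC)
      then show ?thesis using u by (metis UnI1 span_base span_scale)
    qed (auto intro: span_base)
    ultimately show ?case using step by (simp add: span_add span_scale)
  qed (simp add: span_zero)
  have "complex_vector.subspace T"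
    unfolding complex_vector.subspace_def
  proof (intro conjI ballI allI)
    fix c x assume "x \<in> T"
    have "c *\<^sub>C x = Re c *\<^sub>R x + Im c *\<^sub>R (\<i> *\<^sub>C x)"
      unfolding scaleR_scaleC scaleC_scaleC scaleC_add_left[symmetric]
      by (simp add: complex_eq mult.commute)
    then show "c *\<^sub>C x \<in> T" using \<open>x \<in> T\<close> iT unfolding T_def by (simp add: span_add span_scale)
  qed (auto simp: T_def span_add span_zero)
  then have "N \<subseteq> T"
    unfolding B(3)[symmetric] by (intro complex_vector.span_minimal) (auto simp: T_def intro: span_base)
  have subN: "subspace N"
    using N unfolding complex_vector.subspace_def subspace_def by (simp add: scaleR_scaleC)
  obtain C where C: "C \<subseteq> N" "independent C" "N \<subseteq> span C"
    using real_vector.maximal_independent_subset[of N] by blast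
  have "finite C"
    using real_vector.independent_span_bound[of "B \<union> (\<lambda>x. \<i> *\<^sub>C x) ` B" C] C \<open>N \<subseteq> T\<close> B(1)
    by (auto simp: T_def)
  have "span C = N" using C subN span_minimal[of C N] by blast
  obtain Q where Q: "finite Q" "span Q = span (R ` C)" "pairwise orthogonal Q"
    using basis_orthogonal[of "R ` C"] \<open>finite C\<close> by auto
  have "span (R ` C) = R ` N"
    using linear_span_image[of R C] \<open>span C = N\<close> blinfun.bounded_linear_right[of R]
    by (simp add: bounded_linear.linear)
  then have spanQ: "span Q = R ` N" using Q by simp
  have "Q \<subseteq> R ` N" using span_superset[of Q] spanQ by simp
  then have "\<forall>q\<in>Q. \<exists>g\<in>N. R g = q" by blast
  then obtain g where g: "\<And>q. q \<in> Q \<Longrightarrow> g q \<in> N" "\<And>q. q \<in> Q \<Longrightarrow> R (g q) = q" by metis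
  \<comment> \<open>\<open>Q\<close> may contain zero; division by zero gives zero, and such a
    \<open>q\<close> contributes nothing to the expansion either.\<close>
  define b where "b = (\<Sum>q\<in>Q. norm (g q) / norm q)"
  have "norm x \<le> b * norm (R x)" if x: "x \<in> N" for x
  proof -
    define a where "a q = inner (R x) q / inner q q" for q
    define y where "y = (\<Sum>q\<in>Q. a q *\<^sub>R g q)"
    have "y \<in> N" unfolding y_def using g subN by (intro subspace_sum subspace_scale) auto
    then have "x - y \<in> N" using x N by (intro complex_subspace_diff)
    have Ry: "R y = (\<Sum>q\<in>Q. a q *\<^sub>R q)"
      by (simp add: y_def blinfun.sum_right blinfun.scaleR_right g)
    have "R (x - y) = 0"
    proof -
      have "orthogonal (R (x - y)) q" if "q \<in> Q" for q
      proof -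
        have "inner (R y) q = (\<Sum>p\<in>Q. if p = q then inner (R x) q else 0)"
          unfolding Ry inner_sum_left
        proof (rule sum.cong)
          fix p assume "p \<in> Q"
          show "inner (a p *\<^sub>R p) q = (if p = q then inner (R x) q else 0)"
            using Q(3) \<open>p \<in> Q\<close> that by (auto simp: a_def pairwise_def orthogonal_def)
        qed simp
        then show ?thesis
          using Q(1) that by (simp add: orthogonal_def blinfun_simps inner_diff)
      qed
      moreover have "R (x - y) \<in> span Q" using spanQ \<open>x - y \<in> N\<close> by simp
      ultimately have "orthogonal (R (x - y)) (R (x - y))" by (rule orthogonal_to_span[rotated])
      then show ?thesis by (simp add: orthogonal_def)
    qed
    then have "x = y" using inj[OF \<open>x - y \<in> N\<close>] by simp
    have "norm y \<le> (\<Sum>q\<in>Q. norm (a q *\<^sub>R g q))" unfolding y_def by (rule norm_sum)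
    also have "\<dots> \<le> (\<Sum>q\<in>Q. norm (R x) * (norm (g q) / norm q))"
    proof (rule sum_mono)
      fix q assume "q \<in> Q"
      show "norm (a q *\<^sub>R g q) \<le> norm (R x) * (norm (g q) / norm q)"
      proof (cases "q = 0")
        case False
        have "\<bar>inner (R x) q\<bar> \<le> norm (R x) * norm q" by (rule Cauchy_Schwarz_ineq2)
        then have "\<bar>a q\<bar> \<le> norm (R x) / norm q"
          using False by (simp add: a_def dot_square_norm power2_eq_square field_simps)
        then have "\<bar>a q\<bar> * norm (g q) \<le> norm (R x) / norm q * norm (g q)"
          by (rule mult_right_mono) simp
        then show ?thesis by simp
      qed (simp add: a_def)
    qed
    also have "\<dots> = b * norm (R x)" by (simp add: b_def sum_distrib_left mult.commute)
    finally show ?thesis by (simp add: \<open>x = y\<close>)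
  qed
  moreover have "b \<ge> 0" unfolding b_def by (intro sum_nonneg) auto
  ultimately show ?thesis using that by blast
qed

section \<open>Operator matrices with a minimal number of negative squares\<close>

lemma selfadj_block:
  "selfadj A \<Longrightarrow> complex_linear B \<Longrightarrow> selfadj C \<Longrightarrow> selfadj (block_op A (adj B) B C)"
  unfolding selfadj_def complex_linear_def
  by (auto simp: scaleC_prod_def inner_prod_def scaleC_add_right inner_add complex_linear_def
      inner_adj inner_adj' complex_linear_adj[unfolded complex_linear_def])

lemma block_form:
  assumes "complex_linear B"
  shows "inner (block_op A (adj B) B C (x, y)) (x, y) = inner (A x) x + 2 * inner (B x) y + inner (C y) y"
  using inner_adj[OF assms, of x y] by (simp add: inner_prod_def inner_add inner_commute)

definition first_embedding :: "'a::complex_hilbert_space \<Rightarrow>\<^sub>L ('a \<times> 'b::complex_hilbert_space)" where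
  "first_embedding = column_op id_blinfun 0"

lemma first_embedding_apply [simp]: "first_embedding x = (x, 0)"
  by (simp add: first_embedding_def)

lemma complex_linear_first_embedding: "complex_linear first_embedding"
  by (simp add: complex_linear_def scaleC_prod_def)

lemma nu_minus_corner_le:
  assumes M: "selfadj M" and A: "selfadj A"
    and corner: "\<And>x. inner (M (x, 0)) (x, 0) = inner (A x) x"
  shows "nu_minus A \<le> nu_minus M"
  by (rule nu_minus_mono[OF A M complex_linear_first_embedding]) (simp add: corner)

lemma form_abs_root:
  assumes A: "selfadj A"
  shows "inner (A x) x
    = (norm (abs_root A (x - neg_projection A x)))\<^sup>2 - (norm (abs_root A (neg_projection A x)))\<^sup>2"
proof -
  have "inner (A x) x = inner (sign_op A (abs_root A x)) (abs_root A x)"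
    using selfadj_inner[OF selfadj_abs_root[OF A]] abs_root_sign_abs_root[OF A] by metis
  then show ?thesis
    by (simp add: sign_op_form[OF A] blinfun_simps abs_root_neg_projection[OF A])
qed

lemma norm_sign_op: assumes A: "selfadj A" shows "norm (sign_op A x) = norm x"
proof -
  have "(norm (sign_op A x))\<^sup>2 = (norm x)\<^sup>2"
    using selfadj_square_inner[OF selfadj_sign_op[OF A], of x]
    by (simp add: sign_op_involution[OF A] dot_square_norm)
  then show ?thesis by simp
qed

section \<open>Schur complements for an indefinite, possibly singular corner\<close>

context
  fixes A :: "'a::complex_hilbert_space \<Rightarrow>\<^sub>L 'a" and C :: "'b::complex_hilbert_space \<Rightarrow>\<^sub>L 'b"
    and B :: "'a \<Rightarrow>\<^sub>L 'b" and k :: nat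
  assumes A: "selfadj A" and C: "selfadj C" and B: "complex_linear B"
    and k: "nu_minus A = enat k"
begin

private abbreviation (input) "R \<equiv> abs_root A"
private abbreviation (input) "P \<equiv> neg_projection A"
private abbreviation (input) "K \<equiv> sign_op A"
private abbreviation (input) "M \<equiv> block_op A (adj B) B C"

private lemma P: "orth_projection P"
  by (rule projection_neg_projection[OF A])

private lemma correct_by_negative:
  assumes "nu_minus M \<le> enat k"
  shows "\<exists>n. P n = n \<and> 0 \<le> inner (M (x + n, y)) (x + n, y)"
proof -
  have "\<exists>n\<in>range P. 0 \<le> inner (M ((x, y) + first_embedding n)) ((x, y) + first_embedding n)"
  proof (rule maximal_negative_subspace[OF selfadj_block[OF A B C] complex_linear_first_embedding])
    show "complex_vector.subspace (range P)" by (rule neg_range_subspace[OF A])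
    show "subspace_dim (range P) = enat k" using k by (simp add: nu_minus_eq)
    fix n assume "n \<in> range P" "n \<noteq> 0"
    then have "inner (A n) n < 0" using neg_projection_range[OF A] neg_projection_neg[OF A] by blast
    then show "inner (M (first_embedding n)) (first_embedding n) < 0"
      using block_form[OF B, of A C n 0] by simp
  qed fact
  then obtain n where "n \<in> range P" "0 \<le> inner (M (x + n, y)) (x + n, y)" by auto
  then show ?thesis using neg_projection_range[OF A] by blast
qed

text \<open>On the finite-dimensional negative range \<open>R\<close> is injective, hence bounded
  below. On the kernel of \<open>P\<close> the matrix form is nonnegative after a correction
  \<open>n\<close> in the negative range, and the terms containing \<open>n\<close> are absorbed by
  a multiple of the square of \<open>norm y\<close>.\<close>

lemma dominated_by_abs_root:
  assumes M: "nu_minus M \<le> enat k"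
  shows "\<exists>c\<ge>0. \<forall>x. norm (B x) \<le> c * norm (R x)"
proof -
  have "x = 0" if "x \<in> range P" "R x = 0" for x
  proof (rule ccontr)
    assume "x \<noteq> 0"
    then have "inner (A x) x < 0" using that neg_projection_range[OF A] neg_projection_neg[OF A] by blast
    moreover have "A x = 0" using that abs_root_eq_0_iff[OF A] by blast
    ultimately show False by simp
  qed
  then obtain b where b: "b \<ge> 0" "\<And>x. x \<in> range P \<Longrightarrow> norm x \<le> b * norm (R x)"
    using finite_dimensional_bounded_below[OF neg_range_subspace[OF A]] k
    by (metis nu_minus_eq)
  define \<beta> where "\<beta> = norm B * b"
  have \<beta>: "norm (B n) \<le> \<beta> * norm (R n)" if "P n = n" for n
  proof -
    have "norm (B n) \<le> norm B * norm n" by (rule norm_blinfun)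
    also have "\<dots> \<le> norm B * (b * norm (R n))"
      using b(2) that neg_projection_range[OF A] by (intro mult_left_mono) auto
    finally show ?thesis by (simp add: \<beta>_def mult.assoc)
  qed
  have "\<beta> \<ge> 0" using b(1) by (simp add: \<beta>_def)
  \<comment> \<open>\<open>\<beta>\<^sup>2\<close> pays for the absorbed correction,
    \<open>norm C\<close> for the lower right block, and one keeps \<open>d\<close>
    positive.\<close>
  define d where "d = \<beta>\<^sup>2 + norm C + 1"
  have d: "d \<ge> 1" by (simp add: d_def)
  have quad: "0 \<le> (norm (R x))\<^sup>2 + 2 * inner (B x) y + (d - 1) * (norm y)\<^sup>2" if Px: "P x = 0" for x y
  proof -
    obtain n where n: "P n = n" "0 \<le> inner (M (x + n, y)) (x + n, y)"
      using correct_by_negative[OF M] by blast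
    have "inner (A (x + n)) (x + n) = (norm (R x))\<^sup>2 - (norm (R n))\<^sup>2"
      using form_abs_root[OF A, of "x + n"] n(1) Px by (simp add: blinfun_simps)
    with n(2) have 1: "0 \<le> (norm (R x))\<^sup>2 - (norm (R n))\<^sup>2 + 2 * (inner (B x) y + inner (B n) y) + inner (C y) y"
      unfolding block_form[OF B] by (simp add: blinfun.add_right inner_add_left)
    have "inner (B n) y \<le> norm (B n) * norm y" by (rule norm_cauchy_schwarz)
    also have "\<dots> \<le> (\<beta> * norm (R n)) * norm y" by (intro mult_right_mono \<beta> n) simp
    finally have 2: "2 * inner (B n) y \<le> 2 * (norm (R n) * (\<beta> * norm y))" by (simp add: mult_ac)
    have 3: "2 * (norm (R n) * (\<beta> * norm y)) \<le> (norm (R n))\<^sup>2 + (\<beta> * norm y)\<^sup>2"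
      using sum_squares_bound[of "norm (R n)" "\<beta> * norm y"] by simp
    have 4: "inner (C y) y \<le> norm C * (norm y)\<^sup>2" using form_bound[of C y] by simp
    have "(d - 1) * (norm y)\<^sup>2 = (\<beta> * norm y)\<^sup>2 + norm C * (norm y)\<^sup>2"
      by (simp add: d_def power_mult_distrib distrib_right)
    with 1 2 3 4 show ?thesis by argo
  qed
  have ker: "norm (B x) \<le> sqrt d * norm (R x)" if Px: "P x = 0" for x
  proof -
    \<comment> \<open>The quadratic inequality is tested at \<open>y = - B x / d\<close>.\<close>
    let ?t = "1 / d"
    have "0 \<le> (norm (R x))\<^sup>2 - 2 * ?t * (norm (B x))\<^sup>2 + (d - 1) * (?t\<^sup>2 * (norm (B x))\<^sup>2)"
      using quad[OF Px, of "(- ?t) *\<^sub>R B x"] by (simp add: dot_square_norm power_mult_distrib power_divide)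
    also have "\<dots> \<le> (norm (R x))\<^sup>2 - 2 * ?t * (norm (B x))\<^sup>2 + d * (?t\<^sup>2 * (norm (B x))\<^sup>2)"
      by (intro add_left_mono mult_right_mono) auto
    also have "\<dots> = (norm (R x))\<^sup>2 - (norm (B x))\<^sup>2 / d"
      using d by (simp add: power2_eq_square)
    finally have "(norm (B x))\<^sup>2 \<le> d * (norm (R x))\<^sup>2" using d by (simp add: field_simps)
    also have "\<dots> = (sqrt d * norm (R x))\<^sup>2" using d by (simp add: power_mult_distrib)
    finally show ?thesis by (rule power2_le_imp_le) (use d in simp)
  qed
  have "norm (B x) \<le> (\<beta> + sqrt d) * norm (R x)" for x
  proof -
    have "norm (B (P x)) \<le> \<beta> * norm (R (P x))" by (intro \<beta> projection_idem[OF P])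
    also have "\<dots> \<le> \<beta> * norm (R x)"
      using \<open>\<beta> \<ge> 0\<close> by (intro mult_left_mono) (simp_all add: abs_root_neg_projection[OF A] projection_norm_le[OF P])
    finally have 1: "norm (B (P x)) \<le> \<beta> * norm (R x)" .
    have "norm (B (x - P x)) \<le> sqrt d * norm (R (x - P x))"
      by (rule ker) (simp add: blinfun_simps projection_idem[OF P])
    also have "\<dots> \<le> sqrt d * norm (R x)"
      using d projection_norm_le[OF projection_complement[OF P], of "R x"]
      by (intro mult_left_mono) (simp_all add: blinfun_simps abs_root_neg_projection[OF A])
    finally have 2: "norm (B (x - P x)) \<le> sqrt d * norm (R x)" .
    have "B x = B (P x) + B (x - P x)" by (simp add: blinfun_simps)
    then have "norm (B x) \<le> norm (B (P x)) + norm (B (x - P x))" by (metis norm_triangle_ineq)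
    with 1 2 show ?thesis by (simp add: distrib_right)
  qed
  moreover have "\<beta> + sqrt d \<ge> 0" using \<open>\<beta> \<ge> 0\<close> d by simp
  ultimately show ?thesis by blast
qed

text \<open>Completing the square, with \<open>A = R K R\<close> and \<open>K K = I\<close> in place
  of an inverse of \<open>A\<close>.\<close>

lemma schur_identity:
  assumes S: "\<And>x y. inner (B x) y = inner (R x) (blinfun_apply S y)"
  shows "inner (M (x, y)) (x, y)
    = inner (K (R x + K (S y))) (R x + K (S y)) + (inner (C y) y - inner (K (S y)) (S y))"
proof -
  note sa = selfadj_inner[OF selfadj_sign_op[OF A]]
  have "inner (A x) x = inner (K (R x)) (R x)"
    using selfadj_inner[OF selfadj_abs_root[OF A]] abs_root_sign_abs_root[OF A] by metis
  moreover have "inner (K (R x)) (K (S y)) = inner (R x) (S y)"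
    by (simp add: sa sign_op_involution[OF A])
  moreover have "inner (S y) (R x) = inner (R x) (S y)" by (rule inner_commute)
  moreover have "inner (S y) (K (S y)) = inner (K (S y)) (S y)" by (rule inner_commute)
  ultimately show ?thesis
    unfolding block_form[OF B] by (simp add: S blinfun_simps inner_add sign_op_involution[OF A])
qed

text \<open>The vector \<open>- K u\<close> with \<open>R u\<close> close to \<open>S y\<close>
  nearly cancels the square in \<open>schur_identity\<close>. The correction \<open>n\<close> that
  makes the form nonnegative enters the square only through the negative range, which cannot raise
  the form of \<open>K\<close>.\<close>

lemma schur_complement_necessary:
  assumes S: "\<And>x y. inner (B x) y = inner (R x) (blinfun_apply S y)" "S y \<in> closure (range R)"
    and M: "nu_minus M \<le> enat k"
  shows "inner (K (S y)) (S y) \<le> inner (C y) y"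
proof (rule field_le_epsilon)
  fix e :: real assume "e > 0"
  then obtain u where u: "dist (R u) (S y) < sqrt e"
    using S(2) unfolding closure_approachable by fastforce
  obtain n where n: "P n = n" "0 \<le> inner (M (- K u + n, y)) (- K u + n, y)"
    using correct_by_negative[OF M] by blast
  \<comment> \<open>\<open>R\<close> commutes with \<open>K\<close> and \<open>P\<close>, so
    \<open>?w\<close> is \<open>K (S y - R u) + R n\<close> with \<open>R n\<close> in the range of
    \<open>P\<close>.\<close>
  let ?w = "R (- K u + n) + K (S y)"
  have "norm (?w - P ?w) \<le> norm (S y - R u)"
  proof -
    let ?v = "K (S y - R u)"
    have "?w - P ?w = ?v - P ?v"
      by (simp add: blinfun_simps abs_root_sign[OF A] abs_root_neg_projection[OF A, symmetric] n(1))
    also have "norm \<dots> \<le> norm ?v"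
      using projection_norm_le[OF projection_complement[OF P], of ?v] by (simp add: blinfun.diff_left)
    also have "\<dots> = norm (S y - R u)" by (rule norm_sign_op[OF A])
    finally show ?thesis .
  qed
  also have "\<dots> \<le> sqrt e" using u by (simp add: dist_norm norm_minus_commute)
  finally have "(norm (?w - P ?w))\<^sup>2 \<le> (sqrt e)\<^sup>2" by (rule power_mono) simp
  moreover have "inner (K ?w) ?w \<le> (norm (?w - P ?w))\<^sup>2" by (simp add: sign_op_form[OF A])
  ultimately have "inner (K ?w) ?w \<le> e" using \<open>e > 0\<close> by simp
  then show "inner (K (S y)) (S y) \<le> inner (C y) y + e"
    using n(2) unfolding schur_identity[of S, OF S(1)] by linarith
qed

text \<open>\<open>L\<close> is the vector squared in \<open>schur_identity\<close>. The map itself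
  is kept, and not just the resulting index bound, because the estimate for the defect combines the
  maps of both problems.\<close>

lemma schur_complement_sufficient:
  assumes S: "\<And>x y. inner (B x) y = inner (R x) (blinfun_apply S y)" "complex_linear S"
    and le: "\<And>y. inner (K (S y)) (S y) \<le> inner (C y) y"
  shows "\<exists>L. complex_linear L \<and> (\<forall>z. inner (K (L z)) (L z) \<le> inner (M z) z)"
proof (intro exI conjI allI)
  let ?L = "(R o\<^sub>L fst_blinfun) + (K o\<^sub>L S o\<^sub>L snd_blinfun)"
  have "complex_linear R" "complex_linear K"
    using A by (auto intro: selfadj_linear selfadj_abs_root selfadj_sign_op)
  then show "complex_linear ?L"
    using S(2) by (simp add: complex_linear_def blinfun.add_left scaleC_prod_def scaleC_add_right)
  fix z :: "'a \<times> 'b"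
  obtain x y where z: "z = (x, y)" by (cases z)
  show "inner (K (?L z)) (?L z) \<le> inner (M z) z"
    using le[of y] unfolding z schur_identity[of S, OF S(1)] by (simp add: blinfun.add_left)
qed

end

section \<open>Factoring through the closed range of a selfadjoint operator\<close>

lemma subspace_closure:
  fixes S :: "'a::real_normed_vector set"
  assumes S: "subspace S" shows "subspace (closure S)"
  unfolding subspace_def
proof (intro conjI ballI allI)
  show "0 \<in> closure S" using subspace_0[OF S] closure_subset by blast
next
  fix x y assume "x \<in> closure S" "y \<in> closure S"
  then obtain f g where f: "\<And>n. f n \<in> S" "f \<longlonglongrightarrow> x" and g: "\<And>n. g n \<in> S" "g \<longlonglongrightarrow> y"
    unfolding closure_sequential by blast
  then show "x + y \<in> closure S"
    unfolding closure_sequential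
    by (intro exI[of _ "\<lambda>n. f n + g n"]) (simp add: subspace_add[OF S] tendsto_add)
next
  fix r x assume "x \<in> closure S"
  then obtain f where f: "\<And>n. f n \<in> S" "f \<longlonglongrightarrow> x" unfolding closure_sequential by blast
  then show "r *\<^sub>R x \<in> closure S"
    unfolding closure_sequential
    by (intro exI[of _ "\<lambda>n. r *\<^sub>R f n"]) (simp add: subspace_scale[OF S] tendsto_scaleR)
qed

lemma scaleC_closure:
  assumes "\<And>x. x \<in> S \<Longrightarrow> c *\<^sub>C x \<in> S" "x \<in> closure S"
  shows "c *\<^sub>C x \<in> closure S"
  using closure_bounded_linear_image_subset[OF bounded_linear_scaleC, of c S]
    closure_mono[of "(*\<^sub>C) c ` S" S] assms by blast

text \<open>The kernel of a selfadjoint operator is the orthogonal complement of its range.\<close>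

lemma closure_range_projection:
  fixes D :: "'a::complex_hilbert_space \<Rightarrow>\<^sub>L 'a"
  assumes D: "selfadj D"
  shows "\<exists>Q. orth_projection Q \<and> (\<forall>x. Q x = x \<longleftrightarrow> x \<in> closure (range D)) \<and>
    (\<forall>x. D (Q x) = D x) \<and> (\<forall>z. D z = 0 \<longrightarrow> Q z = 0)"
proof -
  have blD: "bounded_linear D" by (rule blinfun.bounded_linear_right)
  have "subspace (range D)" using linear_subspace_image[OF bounded_linear.linear[OF blD]] by simp
  then have "subspace (closure (range D))"
    by (rule subspace_closure)
  moreover have "c *\<^sub>C x \<in> closure (range D)" if "x \<in> closure (range D)" for c x
    using that
    by (rule scaleC_closure[rotated]) (auto simp flip: complex_linear_apply[OF selfadj_linear[OF D]])
  ultimately obtain Q where Q: "orth_projection Q" "\<And>x. Q x = x \<longleftrightarrow> x \<in> closure (range D)"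
    using projection_onto_closed[of "closure (range D)"] by auto
  have QD: "Q (D x) = D x" for x using Q(2) closure_subset[of "range D"] by blast
  have "D (Q x) = D x" for x
  proof (rule inner_ext)
    fix z show "inner z (D (Q x)) = inner z (D x)"
      using selfadj_inner[OF D] projection_inner_commute[OF Q(1)] QD by metis
  qed
  moreover have "Q z = 0" if "D z = 0" for z
  proof -
    have "closed {u. inner z u = 0}" by (intro closed_Collect_eq continuous_intros)
    moreover have "range D \<subseteq> {u. inner z u = 0}"
      using that selfadj_inner[OF D, of z] by auto
    ultimately have "closure (range D) \<subseteq> {u. inner z u = 0}" by (intro closure_minimal)
    moreover have "Q z \<in> closure (range D)" using Q projection_idem by blast
    ultimately have "inner z (Q z) = 0" by blast
    then show ?thesis using projection_inner[OF Q(1), of z] by (simp add: inner_commute)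
  qed
  ultimately show ?thesis using Q by blast
qed

text \<open>
  The closure of the relation between \<open>D x\<close> and \<open>B x\<close> is the graph of a bounded operator on the
  closed range of \<open>D\<close>.
\<close>

lemma factor_through_dominating:
  fixes D :: "'a::complex_hilbert_space \<Rightarrow>\<^sub>L 'a" and B :: "'a \<Rightarrow>\<^sub>L 'b::complex_hilbert_space"
  assumes D: "selfadj D" and B: "complex_linear B"
    and bound: "c \<ge> 0" "\<And>x. norm (B x) \<le> c * norm (D x)"
  shows "\<exists>V. complex_linear V \<and> (\<forall>x. V (D x) = B x) \<and> (\<forall>y. adj V y \<in> closure (range D)) \<and>
    graph_op V = closure (moore_penrose D O graph_op B)"
proof -
  obtain Q where Q: "orth_projection Q" "\<And>x. Q x = x \<longleftrightarrow> x \<in> closure (range D)"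
      "\<And>x. D (Q x) = D x" "\<And>z. D z = 0 \<Longrightarrow> Q z = 0"
    using closure_range_projection[OF D] by blast
  define G where "G = closure (range (\<lambda>x. (D x, B x)))"
  have G_bound: "norm w \<le> c * norm u" if "(u, w) \<in> G" for u w
  proof -
    have "closed {p :: 'a \<times> 'b. norm (snd p) \<le> c * norm (fst p)}"
      by (intro closed_Collect_le continuous_intros)
    moreover have "range (\<lambda>x. (D x, B x)) \<subseteq> {p. norm (snd p) \<le> c * norm (fst p)}"
      using bound by auto
    ultimately have "G \<subseteq> {p. norm (snd p) \<le> c * norm (fst p)}"
      unfolding G_def by (intro closure_minimal)
    then show ?thesis using that by auto
  qed
  have bl: "bounded_linear (\<lambda>x. (D x, B x))"
    by (intro bounded_linear_Pair blinfun.bounded_linear_right)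
  have subG: "subspace G"
    unfolding G_def using linear_subspace_image[OF bounded_linear.linear[OF bl] subspace_UNIV]
    by (rule subspace_closure)
  have cG: "(a *\<^sub>C u, a *\<^sub>C w) \<in> G" if "(u, w) \<in> G" for a u w
  proof -
    have "a *\<^sub>C (u, w) \<in> G"
      using that unfolding G_def
      by (rule scaleC_closure[rotated])
        (auto simp: scaleC_prod_def simp flip: complex_linear_apply[OF B] complex_linear_apply[OF selfadj_linear[OF D]])
    then show ?thesis by (simp add: scaleC_prod_def)
  qed
  \<comment> \<open>The bound survives closure, so the closed relation contains no pair
    \<open>(0, w)\<close> with \<open>w\<close> nonzero.\<close>
  have G_unique: "w = w'" if "(u, w) \<in> G" "(u, w') \<in> G" for u w w'
    using G_bound[of 0 "w - w'"] subspace_diff[OF subG that] by simp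
  have approx: "\<exists>s x. s \<longlonglongrightarrow> Q y \<and> (\<forall>n. s n = D (x n))" for y
  proof -
    have "Q y \<in> closure (range D)" using Q(1,2) projection_idem by blast
    then obtain s where s: "\<And>n. s n \<in> range D" "s \<longlonglongrightarrow> Q y" by (auto simp: closure_sequential)
    have "\<exists>x. s n = D x" for n using s(1)[of n] by blast
    then show ?thesis using s(2) by metis
  qed
  have "\<exists>w. (Q y, w) \<in> G" for y
  proof -
    obtain s x where s: "s \<longlonglongrightarrow> Q y" and x: "\<And>n. s n = D (x n)" using approx by blast
    have "Cauchy (\<lambda>n. B (x n))"
    proof (rule metric_CauchyI)
      fix e :: real assume "e > 0"
      have "Cauchy s" using s by (rule LIMSEQ_imp_Cauchy)
      \<comment> \<open>Dividing by \<open>c + 1\<close> covers the case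
        \<open>c = 0\<close>.\<close>
      then obtain N where N: "\<And>m n. m \<ge> N \<Longrightarrow> n \<ge> N \<Longrightarrow> dist (s m) (s n) < e / (c + 1)"
        unfolding Cauchy_def using divide_pos_pos[OF \<open>e > 0\<close> add_nonneg_pos[OF bound(1) zero_less_one]]
        by blast
      have "dist (B (x m)) (B (x n)) < e" if "m \<ge> N" "n \<ge> N" for m n
      proof -
        have "dist (B (x m)) (B (x n)) = norm (B (x m - x n))"
          by (simp add: dist_norm blinfun_simps)
        also have "\<dots> \<le> c * norm (D (x m - x n))" by (rule bound)
        also have "\<dots> \<le> (c + 1) * dist (s m) (s n)"
          by (simp add: dist_norm x blinfun_simps mult_right_mono)
        also have "\<dots> < e" using N[OF that] bound(1) by (simp add: field_simps)
        finally show ?thesis .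
      qed
      then show "\<exists>M. \<forall>m\<ge>M. \<forall>n\<ge>M. dist (B (x m)) (B (x n)) < e" by blast
    qed
    then obtain w where "(\<lambda>n. B (x n)) \<longlonglongrightarrow> w" using Cauchy_convergent convergent_def by blast
    then have "(\<lambda>n. (D (x n), B (x n))) \<longlonglongrightarrow> (Q y, w)"
      using s by (intro tendsto_Pair) (simp_all flip: x)
    then have "(Q y, w) \<in> G"
      unfolding G_def closure_sequential by (intro exI[of _ "\<lambda>n. (D (x n), B (x n))"]) simp
    then show ?thesis by blast
  qed
  then obtain v where v: "\<And>y. (Q y, v y) \<in> G" by metis
  have "bounded_linear v"
  proof (rule bounded_linear_intro[where K = c])
    show "v (x + y) = v x + v y" for x y
      by (rule G_unique[OF v]) (use subspace_add[OF subG v[of x] v[of y]] in \<open>simp add: blinfun_simps\<close>)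
    show "v (r *\<^sub>R x) = r *\<^sub>R v x" for r x
      by (rule G_unique[OF v]) (use subspace_scale[OF subG v[of x]] in \<open>simp add: blinfun_simps\<close>)
    show "norm (v y) \<le> norm y * c" for y
    proof -
      have "norm (v y) \<le> c * norm (Q y)" by (rule G_bound[OF v])
      also have "\<dots> \<le> c * norm y" by (intro mult_left_mono projection_norm_le Q bound)
      finally show ?thesis by (simp add: mult.commute)
    qed
  qed
  then obtain V where V: "\<And>y. blinfun_apply V y = v y"
    using bounded_linear_Blinfun_apply by metis
  have linV: "complex_linear V"
    unfolding complex_linear_def V
  proof (intro allI)
    fix a y
    show "v (a *\<^sub>C y) = a *\<^sub>C v y"
      by (rule G_unique[OF v])
        (use cG[OF v[of y]] in \<open>simp add: complex_linear_apply selfadj_linear projection_selfadj Q(1)\<close>)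
  qed
  have VD: "V (D x) = B x" for x
    unfolding V
  proof (rule G_unique[OF v])
    have "D x \<in> closure (range D)" by (rule subsetD[OF closure_subset]) simp
    then have "Q (D x) = D x" using Q(2) by blast
    moreover have "(D x, B x) \<in> G" unfolding G_def by (rule subsetD[OF closure_subset]) blast
    ultimately show "(Q (D x), B x) \<in> G" by simp
  qed
  have V0: "V z = 0" if "D z = 0" for z
    using G_bound[OF v[of z]] Q(4)[OF that] by (simp add: V)
  have VQ: "V (Q y) = V y" for y
    using V0[of "Q y - y"] Q(3) by (simp add: blinfun_simps)
  have "adj V y \<in> closure (range D)" for y
  proof -
    let ?w = "adj V y"
    have "inner z (Q ?w) = inner z ?w" for z
      using projection_inner_commute[OF Q(1)] inner_adj[OF linV] VQ by metis
    then show ?thesis using inner_ext Q(2) by blast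
  qed
  moreover have "graph_op V = closure (moore_penrose D O graph_op B)"
  proof
    have "closed {p. V (fst p) = snd p}" by (intro closed_Collect_eq continuous_intros)
    moreover have "moore_penrose D O graph_op B \<subseteq> {p. V (fst p) = snd p}"
      by (auto simp: moore_penrose_def graph_op_def blinfun_simps VD V0)
    ultimately have "closure (moore_penrose D O graph_op B) \<subseteq> {p. V (fst p) = snd p}"
      by (intro closure_minimal)
    then show "closure (moore_penrose D O graph_op B) \<subseteq> graph_op V"
      by (force simp: graph_op_def)
    show "graph_op V \<subseteq> closure (moore_penrose D O graph_op B)"
    proof
      fix p assume "p \<in> graph_op V"
      then obtain y where p: "p = (y, V y)" by (auto simp: graph_op_def)
      obtain s x where s: "s \<longlonglongrightarrow> Q y" and x: "\<And>n. s n = D (x n)" using approx by blast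
      \<comment> \<open>\<open>Q (x n)\<close> is the preimage of \<open>s n\<close> in the closed
        range, as the Moore-Penrose inverse demands, and \<open>y - Q y\<close> is the kernel
        component.\<close>
      have mem: "(s n + (y - Q y), V (s n)) \<in> moore_penrose D O graph_op B" for n
      proof (rule relcompI)
        have "s n = D (Q (x n))" by (simp add: x Q(3))
        moreover have "Q (x n) \<in> closure (range D)" using Q(1,2) projection_idem by blast
        moreover have "D (y - Q y) = 0" by (simp add: blinfun_simps Q(3))
        ultimately show "(s n + (y - Q y), Q (x n)) \<in> moore_penrose D"
          unfolding moore_penrose_def by (intro CollectI exI[of _ "Q (x n)"] exI[of _ "y - Q y"]) simp
        have "V (s n) = B (Q (x n))" using VD[of "Q (x n)"] by (simp add: x Q(3))
        then show "(Q (x n), V (s n)) \<in> graph_op B" by (simp add: graph_op_def)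
      qed
      have "(\<lambda>n. (s n + (y - Q y), V (s n))) \<longlonglongrightarrow> (Q y + (y - Q y), V (Q y))"
        by (intro tendsto_intros s blinfun.tendsto)
      then show "p \<in> closure (moore_penrose D O graph_op B)"
        using mem unfolding p closure_sequential
        by (intro exI[of _ "\<lambda>n. (s n + (y - Q y), V (s n))"]) (simp add: VQ)
    qed
  qed
  ultimately show ?thesis using linV VD by blast
qed

section \<open>Products of commuting operators\<close>

text \<open>With \<open>q\<close> the root of \<open>B\<close>, commutation turns \<open>A B\<close>
  into \<open>q A q\<close>.\<close>

lemma nonneg_op_compose:
  assumes A: "nonneg_op A" and B: "nonneg_op B" and AB: "A o\<^sub>L B = B o\<^sub>L A"
  shows "nonneg_op (A o\<^sub>L B)"
  unfolding nonneg_op_iff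
proof (intro conjI allI)
  show "selfadj (A o\<^sub>L B)" using A B AB by (intro selfadj_compose nonneg_op_selfadj)
  fix x
  let ?q = "sqrt_op B"
  have q: "selfadj ?q" "A o\<^sub>L ?q = ?q o\<^sub>L A"
    using nonneg_op_selfadj[OF nonneg_sqrt_op[OF B]] sqrt_op_commute[OF B AB] by auto
  have "B x = ?q (?q x)" using sqrt_op_square[OF B] by (simp add: blinfun_eq_iff)
  then have "A (B x) = ?q (A (?q x))" using commute_apply[OF q(2)] by simp
  then have "inner (A (B x)) x = inner (A (?q x)) (?q x)" by (simp add: selfadj_inner[OF q(1)])
  then show "0 \<le> inner ((A o\<^sub>L B) x) x" using nonneg_op_inner[OF A] by simp
qed

context
  fixes A B :: "'a::complex_hilbert_space \<Rightarrow>\<^sub>L 'a"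
  assumes A: "selfadj A" and B: "selfadj B" and AB: "A o\<^sub>L B = B o\<^sub>L A"
begin

lemma abs_op_commute_both: "abs_op A o\<^sub>L abs_op B = abs_op B o\<^sub>L abs_op A"
  by (rule abs_op_commute[OF B, OF abs_op_commute[OF A AB[symmetric], symmetric]])

lemma abs_root_commute_both: "abs_root A o\<^sub>L abs_root B = abs_root B o\<^sub>L abs_root A"
  by (rule abs_root_commute[OF B, OF abs_root_commute[OF A AB[symmetric], symmetric]])

lemma sign_op_commute_other: "sign_op A o\<^sub>L B = B o\<^sub>L sign_op A"
  using commute_apply[OF neg_projection_commute[OF A B AB[symmetric]]]
  by (intro blinfun_eqI) (simp add: sign_op_apply[OF A] blinfun_simps)

text \<open>Both sides are nonnegative roots of one operator; commutation is what makes the product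
  on the right nonnegative.\<close>

lemma abs_op_mult: "abs_op (A o\<^sub>L B) = abs_op A o\<^sub>L abs_op B"
  unfolding abs_op_selfadj[OF selfadj_compose[OF A B AB]]
proof (rule sqrt_op_eqI)
  show "nonneg_op (abs_op A o\<^sub>L abs_op B)"
    by (intro nonneg_op_compose nonneg_abs_op A B abs_op_commute_both)
  have sq: "abs_op A (abs_op A x) = A (A x)" "abs_op B (abs_op B x) = B (B x)" for x
    using abs_op_square[OF A] abs_op_square[OF B] by (simp_all add: blinfun_eq_iff)
  show "(abs_op A o\<^sub>L abs_op B) o\<^sub>L (abs_op A o\<^sub>L abs_op B) = (A o\<^sub>L B) o\<^sub>L (A o\<^sub>L B)"
    by (rule blinfun_eqI)
      (simp add: sq commute_apply[OF AB, symmetric] commute_apply[OF abs_op_commute_both, symmetric])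
qed

lemma abs_root_mult: "abs_root (A o\<^sub>L B) = abs_root A o\<^sub>L abs_root B"
  unfolding abs_root_def[of "A o\<^sub>L B"] abs_op_mult
proof (rule sqrt_op_eqI)
  show "nonneg_op (abs_root A o\<^sub>L abs_root B)"
    by (intro nonneg_op_compose nonneg_abs_root A B abs_root_commute_both)
  have sq: "abs_root A (abs_root A x) = abs_op A x" "abs_root B (abs_root B x) = abs_op B x" for x
    by (simp_all add: abs_root_square A B abs_op_eq_sign)
  show "(abs_root A o\<^sub>L abs_root B) o\<^sub>L (abs_root A o\<^sub>L abs_root B) = abs_op A o\<^sub>L abs_op B"
    by (rule blinfun_eqI) (simp add: sq commute_apply[OF abs_root_commute_both, symmetric])
qed

text \<open>On the kernel of \<open>A B\<close> the two sides may differ, because the sign of zero is one.\<close>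

lemma sign_op_mult:
  assumes w: "w \<in> closure (range (abs_root (A o\<^sub>L B)))"
  shows "sign_op (A o\<^sub>L B) w = sign_op A (sign_op B w)"
proof -
  let ?C = "A o\<^sub>L B"
  let ?E = "sign_op ?C - (sign_op A o\<^sub>L sign_op B)"
  note C = selfadj_compose[OF A B AB]
  \<comment> \<open>Either sign turns \<open>A B\<close> into its absolute value, so the two can
    differ only by vectors in the kernel of \<open>A B\<close>.\<close>
  have "?C (?E x) = 0" for x
  proof -
    have "?C (sign_op ?C x) = A (sign_op A (B (sign_op B x)))"
      using arg_cong[OF abs_op_mult, of "\<lambda>F. F x"] by (simp add: abs_op_eq_sign A B C)
    also have "\<dots> = A (B (sign_op A (sign_op B x)))"
      by (simp add: commute_apply[OF sign_op_commute_other])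
    finally show ?thesis by (simp add: blinfun_simps)
  qed
  then have "abs_root ?C (?E x) = 0" for x using abs_root_eq_0_iff[OF C] by blast
  moreover have "abs_root ?C (?E x) = ?E (abs_root ?C x)" for x
  proof -
    have "sign_op A o\<^sub>L ?C = ?C o\<^sub>L sign_op A"
      by (rule blinfun_eqI) (simp add: sign_op_self_commute[OF A] commute_apply[OF sign_op_commute_other])
    moreover have "sign_op B o\<^sub>L ?C = ?C o\<^sub>L sign_op B"
    proof -
      have "sign_op B o\<^sub>L A = A o\<^sub>L sign_op B"
        using commute_apply[OF neg_projection_commute[OF B A AB]]
        by (intro blinfun_eqI) (simp add: sign_op_apply[OF B] blinfun_simps)
      then show ?thesis
        by (intro blinfun_eqI) (simp add: sign_op_self_commute[OF B] commute_apply)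
    qed
    ultimately show ?thesis
      by (simp add: blinfun_simps abs_root_sign[OF C] commute_apply[OF abs_root_commute[OF C], symmetric])
  qed
  ultimately have "range (abs_root ?C) \<subseteq> {u. ?E u = 0}" by (metis (mono_tags) image_subsetI mem_Collect_eq)
  moreover have "closed {u. ?E u = 0}" by (intro closed_Collect_eq continuous_intros)
  ultimately have "?E w = 0" using w closure_minimal by blast
  then show ?thesis by (simp add: blinfun_simps)
qed

end

section \<open>Negative squares of the defect\<close>

abbreviation defect :: "('a::complex_hilbert_space \<Rightarrow>\<^sub>L 'a) \<Rightarrow> ('a \<Rightarrow>\<^sub>L 'a)" where
  "defect H \<equiv> id_blinfun - (H o\<^sub>L H)"

text \<open>Under the condition \<open>s * s = 1\<close> the parameter is a sign, so both completion
  problems are handled at once.\<close>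

abbreviation shift :: "real \<Rightarrow> ('a::complex_hilbert_space \<Rightarrow>\<^sub>L 'a) \<Rightarrow> ('a \<Rightarrow>\<^sub>L 'a)" where
  "shift s H \<equiv> id_blinfun + s *\<^sub>R H"

lemma selfadj_shift: "selfadj H \<Longrightarrow> selfadj (shift s H)"
  by (intro selfadj_intros)

lemma selfadj_defect: "selfadj H \<Longrightarrow> selfadj (defect H)"
  by (intro selfadj_diff selfadj_id selfadj_square)

lemma shift_mult: "s * s = 1 \<Longrightarrow> shift s H o\<^sub>L shift (- s) H = defect H"
  by (rule blinfun_eqI) (simp add: blinfun_simps algebra_simps)

lemma shift_commute: "shift s H o\<^sub>L shift t H = shift t H o\<^sub>L shift s H"
  by (rule blinfun_eqI) (simp add: blinfun_simps algebra_simps)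

lemma shift_defect_commute: "shift s H o\<^sub>L defect H = defect H o\<^sub>L shift s H"
  by (rule blinfun_eqI) (simp add: blinfun_simps algebra_simps)

lemma defect_form: "selfadj H \<Longrightarrow> inner (defect H x) x = (norm x)\<^sup>2 - (norm (H x))\<^sup>2"
  by (simp add: blinfun_simps inner_diff dot_square_norm selfadj_square_inner)

text \<open>By Cauchy-Schwarz the hypothesis forces \<open>norm x < norm (H x)\<close>.\<close>

lemma shift_negative_imp_defect_negative:
  assumes H: "selfadj H" and s: "s * s = 1" and neg: "inner (shift s H x) x < 0"
  shows "inner (defect H x) x < 0"
proof -
  have "\<bar>s\<bar> = 1" using s by (metis abs_mult_self_eq abs_square_eq_1 power2_eq_square)
  have "(norm x)\<^sup>2 < - (s * inner (H x) x)"
    using neg by (simp add: blinfun_simps inner_add dot_square_norm)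
  also have "\<dots> \<le> \<bar>s\<bar> * \<bar>inner (H x) x\<bar>" by (metis abs_ge_minus_self abs_mult)
  also have "\<dots> \<le> norm (H x) * norm x"
    using Cauchy_Schwarz_ineq2[of "H x" x] \<open>\<bar>s\<bar> = 1\<close> by simp
  finally have "norm x < norm (H x)"
    by (simp add: power2_eq_square mult_less_cancel_right)
  then have "(norm x)\<^sup>2 < (norm (H x))\<^sup>2" by (intro power_strict_mono) auto
  then show ?thesis by (simp add: defect_form[OF H])
qed

lemma nu_minus_shift_le_defect:
  assumes H: "selfadj H" and s: "s * s = 1"
  shows "nu_minus (shift s H) \<le> nu_minus (defect H)"
  unfolding nu_minus_eq[of "shift s H"]
proof (rule negative_subspace_dim_le[OF selfadj_defect[OF H] complex_linear_id
      neg_range_subspace[OF selfadj_shift[OF H]]])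
  fix x assume "x \<in> range (neg_projection (shift s H))" "x \<noteq> 0"
  then have "inner (shift s H x) x < 0"
    using neg_projection_neg[OF selfadj_shift[OF H]] neg_projection_range[OF selfadj_shift[OF H]] by blast
  from shift_negative_imp_defect_negative[OF H s this]
  show "inner (defect H (id_blinfun x)) (id_blinfun x) < 0" by simp
qed

text \<open>The projections commute, so a nonzero image would lie in both negative ranges, although
  the two forms add up to twice the squared norm.\<close>

lemma neg_projection_shift_orthogonal:
  assumes H: "selfadj H" and s: "s * s = 1"
  shows "neg_projection (shift s H) (neg_projection (shift (- s) H) y) = 0"
proof (rule ccontr)
  let ?P = "neg_projection (shift s H)" and ?Q = "neg_projection (shift (- s) H)"
  let ?v = "?P (?Q y)"
  assume v: "?v \<noteq> 0"
  note P = projection_neg_projection[OF selfadj_shift[OF H]]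
  have "shift (- s) H o\<^sub>L ?P = ?P o\<^sub>L shift (- s) H"
    by (rule neg_projection_commute[OF selfadj_shift[OF H] selfadj_shift[OF H] shift_commute])
  then have "?P o\<^sub>L ?Q = ?Q o\<^sub>L ?P"
    by (intro neg_projection_commute[OF selfadj_shift[OF H] projection_selfadj[OF P]]) simp
  then have "?P ?v = ?v" "?Q ?v = ?v"
    using projection_idem[OF P] commute_apply by metis+
  then have "inner (shift s H ?v) ?v < 0" "inner (shift (- s) H ?v) ?v < 0"
    using v neg_projection_neg[OF selfadj_shift[OF H]] by blast+
  then have "inner ?v ?v < 0"
    by (simp add: blinfun_simps inner_add inner_diff)
  then show False by (metis inner_ge_zero not_less)
qed

text \<open>With \<open>p = I + M\<close> and \<open>m = I - M\<close>, twice the defect is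
  \<open>m p m + p m p\<close>. The vectors \<open>m x\<close> and \<open>p x\<close> stay in the
  kernels of the negative projections, so both summands are nonnegative at \<open>x\<close>.\<close>

lemma nonneg_defect_if_no_negative_part:
  assumes M: "selfadj M" and x: "\<And>s. s * s = 1 \<Longrightarrow> neg_projection (shift s M) x = 0"
  shows "0 \<le> inner (defect M x) x"
proof -
  let ?p = "shift 1 M" and ?m = "shift (- 1) M"
  have step: "0 \<le> inner (shift s M (shift t M x)) (shift t M x)" if "s * s = 1" for s t
  proof (rule neg_projection_nonneg[OF selfadj_shift[OF M]])
    have "shift t M o\<^sub>L neg_projection (shift s M) = neg_projection (shift s M) o\<^sub>L shift t M"
      by (rule neg_projection_commute[OF selfadj_shift[OF M] selfadj_shift[OF M] shift_commute])
    from commute_apply[OF this, of x]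
    show "neg_projection (shift s M) (shift t M x) = 0" using x[OF that] by (simp add: blinfun.zero_right)
  qed
  have "inner (?p (?m x)) (?m x) + inner (?m (?p x)) (?p x) = inner (defect M x) (?m x + ?p x)"
    using shift_mult[of 1 M] shift_mult[of "- 1" M] by (simp add: blinfun_eq_iff inner_add_right)
  also have "?m x + ?p x = 2 *\<^sub>R x" by (simp add: blinfun_simps scaleR_2)
  finally show ?thesis using step[of 1 "- 1"] step[of "- 1" 1] by simp
qed

text \<open>A negative vector of the defect of \<open>M\<close> has a negative part for at least one
  sign. Each part is carried into the negative range of the corresponding shift of \<open>H\<close>,
  where the defect of \<open>H\<close> is negative, and the two images have no cross term.\<close>

lemma nu_minus_defect_le:
  fixes H :: "'a::complex_hilbert_space \<Rightarrow>\<^sub>L 'a" and M :: "'b::complex_hilbert_space \<Rightarrow>\<^sub>L 'b"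
  assumes H: "selfadj H" and M: "selfadj M"
    and dom: "\<And>s. s * s = 1 \<Longrightarrow> \<exists>L. complex_linear L \<and>
      (\<forall>z. inner (sign_op (shift s H) (L z)) (L z) \<le> inner (shift s M z) z)"
  shows "nu_minus (defect M) \<le> nu_minus (defect H)"
proof -
  obtain L where L: "complex_linear (L s)"
      "inner (sign_op (shift s H) (L s z)) (L s z) \<le> inner (shift s M z) z" if "s * s = 1" for s z
    using dom by metis
  define P where "P s = neg_projection (shift s H)" for s
  define Q where "Q s = neg_projection (shift s M)" for s
  note P = projection_neg_projection[OF selfadj_shift[OF H], folded P_def]
  note Q = projection_neg_projection[OF selfadj_shift[OF M], folded Q_def]
  \<comment> \<open>\<open>L s\<close> need not map into the negative range of
    \<open>shift s H\<close>, so it is compressed by the projections on both sides. Domination keeps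
    \<open>U s\<close> from annihilating a nonzero \<open>Q s x\<close>.\<close>
  define U where "U s = P s o\<^sub>L L s o\<^sub>L Q s" for s
  have linU: "complex_linear (U s)" if "s * s = 1" for s
    unfolding U_def using L[OF that] P Q
    by (intro complex_linear_compose selfadj_linear[OF projection_selfadj])
  have PU: "P s (U s x) = U s x" for s x by (simp add: U_def projection_idem[OF P])
  have U0: "Q s x = 0" if s: "s * s = 1" and "U s x = 0" for s x
  proof (rule ccontr)
    assume "Q s x \<noteq> 0"
    then have "inner (shift s M (Q s x)) (Q s x) < 0"
      using neg_projection_neg[OF selfadj_shift[OF M], of s, folded Q_def] projection_idem[OF Q] by blast
    moreover have "0 \<le> inner (sign_op (shift s H) (L s (Q s x))) (L s (Q s x))"
      using that(2) by (simp add: sign_op_form[OF selfadj_shift[OF H]] U_def P_def)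
    ultimately show False using L(2)[OF s, of "Q s x"] by simp
  qed
  have negU: "inner (defect H (U s x)) (U s x) < 0" if "s * s = 1" "U s x \<noteq> 0" for s x
  proof -
    have "inner (shift s H (U s x)) (U s x) < 0"
      using neg_projection_neg[OF selfadj_shift[OF H], of s, folded P_def] PU that by blast
    then show ?thesis by (rule shift_negative_imp_defect_negative[OF H that(1)])
  qed
  have cross: "inner (defect H (U 1 x)) (U (- 1) x) = 0" for x
  proof -
    have "defect H o\<^sub>L P 1 = P 1 o\<^sub>L defect H"
      unfolding P_def
      by (rule neg_projection_commute[OF selfadj_shift[OF H] selfadj_defect[OF H] shift_defect_commute[symmetric]])
    then have "inner (defect H (U 1 x)) (U (- 1) x) = inner (defect H (U 1 x)) (P 1 (U (- 1) x))"
      using PU[of 1 x] commute_apply projection_inner_commute[OF P] by metis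
    also have "P 1 (U (- 1) x) = 0"
      using neg_projection_shift_orthogonal[OF H, of 1 "L (- 1) (Q (- 1) x)"] by (simp add: U_def P_def)
    finally show ?thesis by simp
  qed
  show ?thesis
    unfolding nu_minus_eq[of "defect M"]
  proof (rule negative_subspace_dim_le[OF selfadj_defect[OF H] _ neg_range_subspace[OF selfadj_defect[OF M]]])
    show "complex_linear (U 1 + U (- 1))" by (intro complex_linear_add linU) auto
    fix x assume "x \<in> range (neg_projection (defect M))" "x \<noteq> 0"
    then have neg: "inner (defect M x) x < 0"
      using neg_projection_neg[OF selfadj_defect[OF M]] neg_projection_range[OF selfadj_defect[OF M]] by blast
    have "U 1 x \<noteq> 0 \<or> U (- 1) x \<noteq> 0"
    proof (rule ccontr)
      assume "\<not> ?thesis"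
      then have "Q 1 x = 0" "Q (- 1) x = 0" using U0[of 1 x] U0[of "- 1" x] by auto
      then have "neg_projection (shift s M) x = 0" if "s * s = 1" for s
        using that by (auto simp: Q_def square_eq_1_iff)
      then show False using nonneg_defect_if_no_negative_part[OF M, of x] neg by force
    qed
    moreover have le: "inner (defect H (U s x)) (U s x) \<le> 0" if "s * s = 1" for s
      using negU[OF that, of x] by (cases "U s x = 0") (auto intro: less_imp_le)
    ultimately have "inner (defect H (U 1 x)) (U 1 x) + inner (defect H (U (- 1) x)) (U (- 1) x) < 0"
    proof (elim disjE)
      assume "U 1 x \<noteq> 0"
      then show ?thesis by (intro add_neg_nonpos negU le) simp_all
    next
      assume "U (- 1) x \<noteq> 0"
      then show ?thesis by (intro add_nonpos_neg negU le) simp_all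
    qed
    moreover have "inner (defect H (U (- 1) x)) (U 1 x) = 0"
      using cross[of x] selfadj_inner[OF selfadj_defect[OF H]] by (metis inner_commute)
    ultimately show "inner (defect H ((U 1 + U (- 1)) x)) ((U 1 + U (- 1)) x) < 0"
      using cross[of x] unfolding blinfun.add_left[of "U 1"] blinfun.add_right[of "defect H"]
      by (simp add: inner_add)
  qed
qed

section \<open>Reduction to a Hilbert space completion problem\<close>

lemma fundamental_symmetry_iff:
  "fundamental_symmetry J \<longleftrightarrow> selfadj J \<and> J o\<^sub>L J = id_blinfun"
  by (auto simp: fundamental_symmetry_def selfadj_iff_adj)

lemma fundamental_symmetry_involution: "fundamental_symmetry J \<Longrightarrow> J (J x) = x"
  by (simp add: fundamental_symmetry_iff blinfun_eq_iff)

lemma norm_fundamental_symmetry: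
  assumes "fundamental_symmetry J" shows "norm (J x) = norm x"
proof -
  have "selfadj J" using assms by (simp add: fundamental_symmetry_iff)
  from selfadj_square_inner[OF this, of x] have "(norm (J x))\<^sup>2 = (norm x)\<^sup>2"
    by (simp add: fundamental_symmetry_involution[OF assms] dot_square_norm)
  then show ?thesis by simp
qed

lemma krein_selfadjoint_iff:
  assumes J: "fundamental_symmetry J"
  shows "krein_selfadjoint J T \<longleftrightarrow> selfadj (J o\<^sub>L T)"
proof -
  have lin: "complex_linear J" and adjJ: "adj J = J"
    using J by (auto simp: fundamental_symmetry_def)
  have JJ: "J o\<^sub>L (J o\<^sub>L T) = T" for T :: "'a \<Rightarrow>\<^sub>L 'a"
    by (rule blinfun_eqI) (simp add: fundamental_symmetry_involution[OF J])
  show ?thesis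
  proof
    assume "krein_selfadjoint J T"
    then have T: "complex_linear T" "T = J o\<^sub>L adj T o\<^sub>L J"
      by (auto simp: krein_selfadjoint_def krein_adj_def)
    have "adj (J o\<^sub>L T) = adj T o\<^sub>L J" by (simp add: adj_compose[OF lin T(1)] adjJ)
    also have "\<dots> = J o\<^sub>L T" by (subst (2) T(2)) (simp add: blinfun_compose_assoc JJ)
    finally show "selfadj (J o\<^sub>L T)" by (simp add: selfadj_iff_adj complex_linear_compose lin T(1))
  next
    assume JT: "selfadj (J o\<^sub>L T)"
    have "complex_linear T"
      using complex_linear_compose[OF lin selfadj_linear[OF JT]] by (simp add: JJ)
    moreover from this have "J o\<^sub>L T = adj T o\<^sub>L J"
      using JT by (simp add: selfadj_iff_adj adj_compose lin adjJ)
    then have "T = J o\<^sub>L adj T o\<^sub>L J" by (metis JJ blinfun_compose_assoc)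
    ultimately show "krein_selfadjoint J T" by (simp add: krein_selfadjoint_def krein_adj_def)
  qed
qed

lemma krein_le_iff:
  assumes X: "selfadj (J o\<^sub>L X)" and Y: "selfadj (J o\<^sub>L Y)"
  shows "krein_le J X Y \<longleftrightarrow> (\<forall>f. inner (J (X f)) f \<le> inner (J (Y f)) f)"
proof -
  have "selfadj ((J o\<^sub>L Y) - (J o\<^sub>L X))" by (intro selfadj_diff X Y)
  then have "cinner (J ((Y - X) f)) f = complex_of_real (inner (J (Y f)) f - inner (J (X f)) f)" for f
    using cinner_quadratic[of "(J o\<^sub>L Y) - (J o\<^sub>L X)" f] by (simp add: blinfun_simps inner_diff)
  then show ?thesis
    unfolding krein_le_def krein_inner_def by (simp del: of_real_diff)
qed

locale krein_column =
  fixes J1 T11 :: "'a::complex_hilbert_space \<Rightarrow>\<^sub>L 'a"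
    and J2 :: "'b::complex_hilbert_space \<Rightarrow>\<^sub>L 'b"
    and T21 :: "'a \<Rightarrow>\<^sub>L 'b"
  assumes J1: "fundamental_symmetry J1" and J2: "fundamental_symmetry J2"
    and T11: "krein_selfadjoint J1 T11" and T21: "complex_linear T21"
begin

abbreviation "J \<equiv> sum_symmetry J1 J2"

definition H where "H = J1 o\<^sub>L T11"
definition B where "B = J2 o\<^sub>L T21"
definition matrix where "matrix X = block_op H (adj B) B X"
definition ext where "ext X = J o\<^sub>L matrix X"

abbreviation "column_defect \<equiv> id_blinfun - (adj (column_op T11 T21) o\<^sub>L column_op T11 T21)"

lemma J_apply [simp]: "J (x, y) = (J1 x, J2 y)"
  by (simp add: sum_symmetry_def)

lemma fundamental_symmetry_J: "fundamental_symmetry J"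
proof -
  have "selfadj J1" "selfadj J2" using J1 J2 by (simp_all add: fundamental_symmetry_iff)
  then have "selfadj J"
    by (auto simp: selfadj_def complex_linear_def scaleC_prod_def inner_prod_def)
  moreover have "J o\<^sub>L J = id_blinfun"
    by (rule blinfun_eqI) (auto simp: fundamental_symmetry_involution J1 J2)
  ultimately show ?thesis by (simp add: fundamental_symmetry_iff)
qed

lemma selfadj_H: "selfadj H"
  using T11 by (simp add: H_def krein_selfadjoint_iff[OF J1])

lemma complex_linear_B: "complex_linear B"
  using J2 T21 by (simp add: B_def complex_linear_compose fundamental_symmetry_def)

lemma J1_H: "J1 (H x) = T11 x"
  by (simp add: H_def fundamental_symmetry_involution[OF J1])

lemma J2_B: "J2 (B x) = T21 x"
  by (simp add: B_def fundamental_symmetry_involution[OF J2])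

lemma adj_B: "adj B = adj T21 o\<^sub>L J2"
  using J2 T21 by (simp add: B_def adj_compose fundamental_symmetry_def)

lemma selfadj_matrix: "selfadj X \<Longrightarrow> selfadj (matrix X)"
  unfolding matrix_def by (intro selfadj_block selfadj_H complex_linear_B)

lemma J_ext: "J o\<^sub>L ext X = matrix X"
  by (rule blinfun_eqI) (simp add: ext_def fundamental_symmetry_involution[OF fundamental_symmetry_J])

lemma matrix_apply: "matrix X (x, y) = (H x + adj B y, B x + X y)"
  by (simp add: matrix_def)

lemma ext_eq: "ext X = block_op T11 (J1 o\<^sub>L adj B) T21 (J2 o\<^sub>L X)"
  by (rule blinfun_eqI) (auto simp: ext_def matrix_apply J1_H J2_B blinfun_simps)

text \<open>After multiplication by \<open>J\<close> the first column is prescribed and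
  selfadjointness forces the upper right block, so \<open>X\<close> is the only freedom.\<close>

lemma selfadjoint_extension_iff:
  "selfadjoint_extension J1 J2 T11 T21 T \<longleftrightarrow> (\<exists>X. selfadj X \<and> T = ext X)"
proof
  assume T: "selfadjoint_extension J1 J2 T11 T21 T"
  define N where "N = J o\<^sub>L T"
  have N: "selfadj N"
    using T by (simp add: N_def selfadjoint_extension_def krein_selfadjoint_iff[OF fundamental_symmetry_J])
  have Nx: "N (x, 0) = (H x, B x)" for x
    using T by (simp add: N_def selfadjoint_extension_def H_def B_def)
  define X where "X = snd_blinfun o\<^sub>L N o\<^sub>L column_op 0 id_blinfun"
  have X: "X y = snd (N (0, y))" for y by (simp add: X_def)
  have fst_N: "fst (N (0, y)) = adj B y" for y
  proof (rule inner_ext)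
    fix x
    have "inner x (fst (N (0, y))) = inner (x, 0) (N (0, y))" by (simp add: inner_prod_def)
    also have "\<dots> = inner (N (x, 0)) (0, y)" by (simp add: selfadj_inner[OF N])
    also have "\<dots> = inner x (adj B y)" by (simp add: Nx inner_prod_def inner_adj[OF complex_linear_B])
    finally show "inner x (fst (N (0, y))) = inner x (adj B y)" .
  qed
  have "selfadj X"
    unfolding selfadj_def complex_linear_def X
  proof (intro conjI allI)
    show "snd (N (0, c *\<^sub>C y)) = c *\<^sub>C snd (N (0, y))" for c y
      using complex_linear_apply[OF selfadj_linear[OF N], of c "(0, y)"] by (simp add: scaleC_prod_def)
    show "inner (snd (N (0, y))) z = inner y (snd (N (0, z)))" for y z
      using selfadj_inner[OF N, of "(0, y)" "(0, z)"] by (simp add: inner_prod_def)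
  qed
  moreover have "N = matrix X"
  proof (rule blinfun_eqI)
    fix z :: "'a \<times> 'b"
    obtain x y where z: "z = (x, 0) + (0, y)" by (cases z) auto
    have "N (0, y) = (adj B y, X y)" by (simp add: prod_eq_iff fst_N X)
    then show "N z = matrix X z" unfolding z blinfun.add_right by (simp add: Nx matrix_apply)
  qed
  moreover have "T = J o\<^sub>L N"
    by (rule blinfun_eqI) (simp add: N_def fundamental_symmetry_involution[OF fundamental_symmetry_J])
  ultimately show "\<exists>X. selfadj X \<and> T = ext X" by (auto simp: ext_def)
next
  assume "\<exists>X. selfadj X \<and> T = ext X"
  then obtain X where "selfadj X" "T = ext X" by blast
  then show "selfadjoint_extension J1 J2 T11 T21 T"
    using selfadj_matrix[of X]
    by (simp add: selfadjoint_extension_def krein_selfadjoint_iff[OF fundamental_symmetry_J] J_ext)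
      (simp add: ext_eq)
qed

lemma completion_via_iff:
  "completion_via s J1 J2 T11 T21 T \<longleftrightarrow>
    (\<exists>X. selfadj X \<and> T = ext X \<and> nu_minus (shift s (matrix X)) = nu_minus (shift s H))"
proof -
  have "completes (id_blinfun + s *\<^sub>R ext X)
      (id_blinfun + s *\<^sub>R T11) (s *\<^sub>R krein_adj J1 J2 T21) (s *\<^sub>R T21)" if "selfadj X" for X
    unfolding completes_def
  proof (intro exI conjI)
    show "complex_linear (id_blinfun + s *\<^sub>R (J2 o\<^sub>L X))"
      using J2 that by (intro complex_linear_intros) (auto simp: fundamental_symmetry_def selfadj_def)
    show "id_blinfun + s *\<^sub>R ext X = block_op (id_blinfun + s *\<^sub>R T11)
      (s *\<^sub>R krein_adj J1 J2 T21) (s *\<^sub>R T21) (id_blinfun + s *\<^sub>R (J2 o\<^sub>L X))"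
      by (rule blinfun_eqI)
        (auto simp: ext_eq krein_adj_def adj_B blinfun_simps algebra_simps)
  qed
  then show ?thesis
    unfolding completion_via_def selfadjoint_extension_iff by (auto simp: J_ext H_def)
qed

lemma krein_le_ext_iff:
  assumes "selfadj X" "selfadj Y"
  shows "krein_le J (ext X) (ext Y) \<longleftrightarrow> (\<forall>y. inner (X y) y \<le> inner (Y y) y)"
proof -
  have "J (ext X f) = matrix X f" for X f using J_ext by (metis blinfun_apply_blinfun_compose)
  then have "krein_le J (ext X) (ext Y) \<longleftrightarrow> (\<forall>x y. inner (matrix X (x, y)) (x, y) \<le> inner (matrix Y (x, y)) (x, y))"
    using krein_le_iff[of J "ext X" "ext Y"] assms by (simp add: J_ext selfadj_matrix)
  then show ?thesis by (simp add: matrix_apply inner_prod_def inner_add)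
qed

lemma defect_T11: "id_blinfun - (adj T11 o\<^sub>L T11) = defect H"
proof -
  have "complex_linear J1" "adj J1 = J1" using J1 by (auto simp: fundamental_symmetry_def)
  moreover have "T11 = J1 o\<^sub>L H" by (rule blinfun_eqI) (simp add: J1_H)
  ultimately have "adj T11 = H o\<^sub>L J1"
    using adj_compose[of J1 H] selfadj_H by (simp add: selfadj_iff_adj)
  then have "adj T11 o\<^sub>L T11 = H o\<^sub>L H"
    by (intro blinfun_eqI) (simp add: H_def)
  then show ?thesis by simp
qed

lemma complex_linear_T11: "complex_linear T11"
  using T11 by (simp add: krein_selfadjoint_def)

lemma complex_linear_column: "complex_linear (column_op T11 T21)"
  using complex_linear_T11 T21 by (simp add: complex_linear_def scaleC_prod_def)

text \<open>The fundamental symmetries are isometries, so \<open>T11\<close> and \<open>T21\<close>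
  have the norms of \<open>H\<close> and \<open>B\<close>.\<close>

lemma defect_column_form:
  "inner (column_defect x) x
    = inner (defect H x) x - (norm (B x))\<^sup>2"
proof -
  have "inner (adj (column_op T11 T21) (T11 x, T21 x)) x = (norm (T11 x))\<^sup>2 + (norm (T21 x))\<^sup>2"
  proof -
    have "inner (adj (column_op T11 T21) (T11 x, T21 x)) x
        = inner (column_op T11 T21 x) (T11 x, T21 x)"
      by (metis inner_adj[OF complex_linear_column] inner_commute)
    then show ?thesis by (simp add: inner_prod_def dot_square_norm)
  qed
  then show ?thesis
    unfolding defect_form[OF selfadj_H]
    by (simp add: blinfun.diff_left inner_diff dot_square_norm H_def B_def norm_fundamental_symmetry J1 J2)
qed

lemma selfadj_defect_column: "selfadj column_defect"
  by (intro selfadj_diff selfadj_id selfadj_adj_compose complex_linear_column)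

lemma nu_minus_defect_le_column:
  "nu_minus (defect H) \<le> nu_minus column_defect"
  by (rule nu_minus_mono[OF selfadj_defect[OF selfadj_H] selfadj_defect_column complex_linear_id])
    (simp add: defect_column_form)

lemma defect_ext:
  assumes "selfadj X" shows "id_blinfun - (adj (ext X) o\<^sub>L ext X) = defect (matrix X)"
proof -
  have "complex_linear J" "adj J = J"
    using fundamental_symmetry_J by (auto simp: fundamental_symmetry_def)
  then have "adj (ext X) = matrix X o\<^sub>L J"
    using selfadj_matrix[OF assms] by (simp add: ext_def adj_compose selfadj_iff_adj)
  then have "adj (ext X) o\<^sub>L ext X = matrix X o\<^sub>L matrix X"
    by (simp add: blinfun_compose_assoc J_ext)
  then show ?thesis by simp
qed

text \<open>\<open>column_defect\<close> is the upper left corner of the defect of the full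
  matrix.\<close>

lemma nu_minus_column_le_ext:
  assumes X: "selfadj X"
  shows "nu_minus column_defect \<le> nu_minus (defect (matrix X))"
proof (rule nu_minus_corner_le[OF selfadj_defect[OF selfadj_matrix[OF X]] selfadj_defect_column])
  fix x
  have "(norm (matrix X (x, 0)))\<^sup>2 = (norm (H x))\<^sup>2 + (norm (B x))\<^sup>2"
    by (simp add: matrix_apply power2_norm_eq_inner inner_prod_def)
  then show "inner (defect (matrix X) (x, 0)) (x, 0)
      = inner (column_defect x) x"
    unfolding defect_form[OF selfadj_matrix[OF X]] defect_column_form defect_form[OF selfadj_H]
    by (simp add: norm_Pair)
qed

lemma completion_via_ext_iff:
  "selfadj X \<Longrightarrow> completion_via s J1 J2 T11 T21 (ext X) \<longleftrightarrow> nu_minus (shift s (matrix X)) = nu_minus (shift s H)"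
proof -
  have "X = Y" if "ext X = ext Y" for Y
  proof (rule blinfun_eqI)
    fix y
    have "matrix X (0, y) = matrix Y (0, y)" using that J_ext by metis
    then show "X y = Y y" by (simp add: matrix_apply)
  qed
  then show "selfadj X \<Longrightarrow> completion_via s J1 J2 T11 T21 (ext X) \<longleftrightarrow> nu_minus (shift s (matrix X)) = nu_minus (shift s H)"
    unfolding completion_via_iff by blast
qed

text \<open>The index of \<open>column_defect\<close> is squeezed between that of
  \<open>defect H\<close> and that of the completed defect.\<close>

lemma index_condition_necessary:
  assumes T: "T \<in> Ext_set J1 J2 T11 T21"
    and nu: "nu_minus (id_blinfun - (adj T o\<^sub>L T)) = nu_minus (defect H)"
  shows "nu_minus (defect H) = nu_minus column_defect"
proof -
  obtain X where "selfadj X" "T = ext X"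
    using T by (auto simp: Ext_set_def completion_via_iff)
  then show ?thesis
    using nu_minus_column_le_ext[of X] nu_minus_defect_le_column nu defect_ext[of X] by auto
qed

lemma shift_matrix: "shift s (matrix X) = block_op (shift s H) (adj (s *\<^sub>R B)) (s *\<^sub>R B) (shift s X)"
proof -
  have "adj (s *\<^sub>R B) = s *\<^sub>R adj B"
    by (rule adj_eqI)
      (simp_all add: complex_linear_scaleR complex_linear_B blinfun_simps inner_adj[OF complex_linear_B])
  then show ?thesis
    by (intro blinfun_eqI) (auto simp: matrix_apply blinfun_simps algebra_simps)
qed

text \<open>The index condition bounds the negative index of the matrix with corner
  \<open>defect H\<close> and lower right block \<open>I\<close> by \<open>\<kappa>\<close>.
  Domination then gives \<open>V\<close>, and the Schur condition with \<open>C = I\<close> gives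
  the inequality.\<close>

lemma contraction_exists:
  assumes \<kappa>: "nu_minus (defect H) = enat \<kappa>"
    and cond: "nu_minus (defect H) = nu_minus column_defect"
  obtains V where "complex_linear V" "\<And>x. V (abs_root (defect H) x) = B x"
    "\<And>y. adj V y \<in> closure (range (abs_root (defect H)))"
    "graph_op V = closure (moore_penrose (abs_root (defect H)) O graph_op B)"
    "\<And>y. inner (sign_op (defect H) (adj V y)) (adj V y) \<le> (norm y)\<^sup>2"
proof -
  note C = selfadj_defect[OF selfadj_H]
  have lin_fst: "complex_linear (fst_blinfun :: ('a \<times> 'b) \<Rightarrow>\<^sub>L 'a)"
    by (simp add: complex_linear_def scaleC_prod_def)
  have nu: "nu_minus (block_op (defect H) (adj B) B id_blinfun) \<le> enat \<kappa>"
    unfolding \<kappa>[symmetric] cond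
  proof (rule nu_minus_mono[OF selfadj_block[OF C complex_linear_B selfadj_id] selfadj_defect_column lin_fst])
    fix z :: "'a \<times> 'b"
    obtain x y where z: "z = (x, y)" by (cases z)
    \<comment> \<open>This square is exactly the gap between the matrix form and the form of
      \<open>column_defect\<close>.\<close>
    have "0 \<le> (norm (B x + y))\<^sup>2" by simp
    then have "0 \<le> (norm (B x))\<^sup>2 + 2 * inner (B x) y + (norm y)\<^sup>2"
      by (simp add: power2_norm_eq_inner inner_add inner_commute)
    then show "inner (column_defect (fst_blinfun z)) (fst_blinfun z)
        \<le> inner (block_op (defect H) (adj B) B id_blinfun z) z"
      unfolding z block_form[OF complex_linear_B] fst_blinfun.rep_eq fst_conv defect_column_form
      by (simp add: dot_square_norm)
  qed
  obtain c where c: "c \<ge> 0" "\<And>x. norm (B x) \<le> c * norm (abs_root (defect H) x)"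
    using dominated_by_abs_root[OF C selfadj_id complex_linear_B \<kappa> nu] by blast
  obtain V where V: "complex_linear V" "\<And>x. V (abs_root (defect H) x) = B x"
    "\<And>y. adj V y \<in> closure (range (abs_root (defect H)))"
    "graph_op V = closure (moore_penrose (abs_root (defect H)) O graph_op B)"
    using factor_through_dominating[OF selfadj_abs_root[OF C] complex_linear_B c] by blast
  have "inner (B x) y = inner (abs_root (defect H) x) (adj V y)" for x y
    by (simp add: V(1) flip: V(2) inner_adj)
  from schur_complement_necessary[OF C selfadj_id complex_linear_B \<kappa> this V(3) nu]
  have "inner (sign_op (defect H) (adj V y)) (adj V y) \<le> (norm y)\<^sup>2" for y
    by (simp add: dot_square_norm)
  with V show ?thesis using that by blast
qed

end

section \<open>The extremal completions\<close>

text \<open>The assumptions on \<open>V\<close> are those that \<open>contraction_exists\<close>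
  delivers under the index condition.\<close>

locale contractive_column = krein_column +
  fixes V :: "'a \<Rightarrow>\<^sub>L 'b" and \<kappa> :: nat
  assumes \<kappa>: "nu_minus (defect H) = enat \<kappa>" and V: "complex_linear V"
    and V_abs_root: "V (abs_root (defect H) x) = B x"
    and adj_V_closure: "adj V y \<in> closure (range (abs_root (defect H)))"
    and adj_V_le: "inner (sign_op (defect H) (adj V y)) (adj V y) \<le> (norm y)\<^sup>2"
begin

text \<open>The Schur complement for the corner \<open>shift s H\<close>, already written in terms
  of \<open>V\<close> as in the block formulas.\<close>

definition W where "W s = V o\<^sub>L (shift (- s) H o\<^sub>L sign_op (defect H)) o\<^sub>L adj V"

lemma selfadj_W: "selfadj (W s)"
  unfolding W_def
proof (intro selfadj_congruence V selfadj_compose selfadj_shift selfadj_sign_op selfadj_defect selfadj_H)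
  show "shift (- s) H o\<^sub>L sign_op (defect H) = sign_op (defect H) o\<^sub>L shift (- s) H"
    by (rule sign_op_commute_other[symmetric])
      (intro selfadj_defect selfadj_shift selfadj_H shift_defect_commute[symmetric])+
qed

lemma W_form: "inner (W s y) y = inner (shift (- s) H (sign_op (defect H) (adj V y))) (adj V y)"
  by (simp add: W_def inner_adj[OF V])

text \<open>The factor \<open>S\<close> of the Schur lemmas for the off-diagonal block
  \<open>s *\<^sub>R B\<close>; it arises by splitting \<open>abs_root (defect H)\<close> into the
  roots of the two shifts.\<close>

definition S where "S s = s *\<^sub>R (abs_root (shift (- s) H) o\<^sub>L adj V)"

lemma shift_mult': "s * s = 1 \<Longrightarrow> shift (- s) H o\<^sub>L shift s H = defect H"
  using shift_mult[of s H] shift_commute[of "- s" H s] by simp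

lemma abs_root_defect: "s * s = 1 \<Longrightarrow>
    abs_root (defect H) x = abs_root (shift s H) (abs_root (shift (- s) H) x)"
  using abs_root_mult[OF selfadj_shift[OF selfadj_H] selfadj_shift[OF selfadj_H] shift_commute, of s "- s"]
    shift_mult[of s H] by simp

lemma abs_root_shift_commute:
  "abs_root (shift s H) (abs_root (shift t H) x) = abs_root (shift t H) (abs_root (shift s H) x)"
  by (rule commute_apply[OF abs_root_commute_both])
    (intro selfadj_shift selfadj_H shift_commute)+

lemma complex_linear_S: "complex_linear (S s)"
  unfolding S_def
  by (intro complex_linear_scaleR complex_linear_compose complex_linear_adj V
      selfadj_linear[OF selfadj_abs_root] selfadj_shift selfadj_H)

lemma S_factor:
  assumes s: "s * s = 1"
  shows "inner ((s *\<^sub>R B) x) y = inner (abs_root (shift s H) x) (S s y)"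
proof -
  have "inner (B x) y = inner (abs_root (shift (- s) H) (abs_root (shift s H) x)) (adj V y)"
    unfolding V_abs_root[symmetric] abs_root_defect[OF s] inner_adj[OF V]
    by (simp only: abs_root_shift_commute[of s "- s"])
  also have "\<dots> = inner (abs_root (shift s H) x) (abs_root (shift (- s) H) (adj V y))"
    by (intro selfadj_inner selfadj_abs_root selfadj_shift selfadj_H)
  finally show ?thesis by (simp add: S_def blinfun_simps)
qed

text \<open>The commuting roots show that \<open>abs_root (shift (- s) H)\<close> maps the range of
  \<open>abs_root (defect H)\<close> into the range of \<open>abs_root (shift s H)\<close>;
  continuity extends this to closures.\<close>

lemma S_closure:
  assumes s: "s * s = 1" shows "S s y \<in> closure (range (abs_root (shift s H)))"
proof -
  let ?f = "\<lambda>x. s *\<^sub>R abs_root (shift (- s) H) x"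
  have "bounded_linear ?f"
    by (intro bounded_linear_const_scaleR blinfun.bounded_linear_right)
  then have "?f ` closure (range (abs_root (defect H))) \<subseteq> closure (?f ` range (abs_root (defect H)))"
    by (rule closure_bounded_linear_image_subset)
  also have "\<dots> \<subseteq> closure (range (abs_root (shift s H)))"
  proof (intro closure_mono subsetI)
    fix u assume "u \<in> ?f ` range (abs_root (defect H))"
    then obtain x where "u = s *\<^sub>R abs_root (shift (- s) H) (abs_root (defect H) x)" by blast
    then have "u = abs_root (shift s H) (s *\<^sub>R abs_root (shift (- s) H) (abs_root (shift (- s) H) x))"
      by (simp only: abs_root_defect[OF s] abs_root_shift_commute[of "- s" s] blinfun.scaleR_right)
    then show "u \<in> range (abs_root (shift s H))" by blast
  qed
  finally show ?thesis using adj_V_closure[of y] by (auto simp: S_def blinfun_simps)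
qed

text \<open>Moving the two outer roots together gives \<open>(I - s H) sign (I - s H)\<close>; the
  remaining signs multiply to \<open>sign_op (defect H)\<close> because \<open>adj V y\<close> lies
  in the closed range.\<close>

lemma S_form:
  assumes s: "s * s = 1"
  shows "inner (sign_op (shift s H) (S s y)) (S s y) = inner (W s y) y"
proof -
  let ?w = "adj V y" and ?R = "abs_root (shift (- s) H)" and ?K = "sign_op (shift s H)"
  note sa = selfadj_shift[OF selfadj_H]
  have KR: "?R (?K x) = ?K (?R x)" for x
    by (rule commute_apply[OF abs_root_commute[OF sa, OF sign_op_commute_other[OF sa sa shift_commute]],
          symmetric])
  have "inner (?K (S s y)) (S s y) = inner (?K (?R ?w)) (?R ?w)"
    using s by (simp add: S_def blinfun_simps flip: mult.assoc)
  also have "\<dots> = inner (?R (?K (?R ?w))) ?w"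
    by (rule selfadj_inner[OF selfadj_abs_root[OF sa], symmetric])
  also have "\<dots> = inner (?R (?R (?K ?w))) ?w" by (simp only: KR)
  also have "\<dots> = inner (shift (- s) H (sign_op (shift (- s) H) (?K ?w))) ?w"
    by (simp only: abs_root_square[OF sa])
  also have "sign_op (shift (- s) H) (?K ?w) = sign_op (defect H) ?w"
    using sign_op_mult[OF sa sa shift_commute, of ?w "- s" s] adj_V_closure[of y]
    unfolding shift_mult'[OF s] by simp
  finally show ?thesis by (simp only: W_form)
qed

text \<open>A cycle: equality of the indices gives the Schur inequality, this gives the map
  \<open>L\<close>, and \<open>L\<close> bounds the index from above while the corner bounds it from
  below. The map is recorded separately for the defect estimate.\<close>

lemma
  assumes s: "s * s = 1" and X: "selfadj X"
  shows completion_iff: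
      "completion_via s J1 J2 T11 T21 (ext X) \<longleftrightarrow> (\<forall>y. inner (W s y) y \<le> inner (shift s X y) y)"
    and completion_dominated: "completion_via s J1 J2 T11 T21 (ext X) \<Longrightarrow> \<exists>L. complex_linear L \<and>
      (\<forall>z. inner (sign_op (shift s H) (L z)) (L z) \<le> inner (shift s (matrix X) z) z)"
proof -
  note A = selfadj_shift[OF selfadj_H, of s] and C = selfadj_shift[OF X, of s]
  note B = complex_linear_scaleR[OF complex_linear_B, of s]
  note M = selfadj_shift[OF selfadj_matrix[OF X], of s]
  \<comment> \<open>The Schur lemmas require a finite index of the corner; it is bounded by
    \<open>\<kappa>\<close>.\<close>
  obtain k where k: "nu_minus (shift s H) = enat k"
    using nu_minus_shift_le_defect[OF selfadj_H s] \<kappa> by (cases "nu_minus (shift s H)") auto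
  let ?le = "\<forall>y. inner (W s y) y \<le> inner (shift s X y) y"
  let ?dom = "\<exists>L. complex_linear L \<and>
    (\<forall>z. inner (sign_op (shift s H) (L z)) (L z) \<le> inner (shift s (matrix X) z) z)"
  have "?le" if "nu_minus (shift s (matrix X)) = nu_minus (shift s H)"
  proof -
    have "nu_minus (block_op (shift s H) (adj (s *\<^sub>R B)) (s *\<^sub>R B) (shift s X)) \<le> enat k"
      using that by (simp add: shift_matrix k)
    from schur_complement_necessary[OF A C B k S_factor[OF s] S_closure[OF s] this]
    show ?thesis by (simp add: S_form[OF s])
  qed
  moreover have "?dom" if "?le"
    using schur_complement_sufficient[OF A C B k S_factor[OF s] complex_linear_S] that
    unfolding S_form[OF s] shift_matrix by blast
  moreover have "nu_minus (shift s (matrix X)) = nu_minus (shift s H)" if "?dom"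
  proof (rule antisym)
    show "nu_minus (shift s (matrix X)) \<le> nu_minus (shift s H)"
      using that nu_minus_le_sign[OF M A] by blast
    show "nu_minus (shift s H) \<le> nu_minus (shift s (matrix X))"
      by (rule nu_minus_corner_le[OF M A]) (simp add: blinfun_simps matrix_apply inner_prod_def)
  qed
  ultimately show "completion_via s J1 J2 T11 T21 (ext X) \<longleftrightarrow> ?le"
    and "completion_via s J1 J2 T11 T21 (ext X) \<Longrightarrow> ?dom"
    unfolding completion_via_ext_iff[OF X] by blast+
qed

lemma defect_nu_minus:
  assumes X: "selfadj X" and T: "ext X \<in> Ext_set J1 J2 T11 T21"
  shows "nu_minus (defect (matrix X)) \<le> nu_minus (defect H)"
  using T by (intro nu_minus_defect_le selfadj_H selfadj_matrix X completion_dominated)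
    (auto simp: Ext_set_def square_eq_1_iff)

text \<open>\<open>W s \<le> I + s X\<close> solved for \<open>X\<close>: the lower bound for
  \<open>s = 1\<close>, the upper bound for \<open>s = - 1\<close>.\<close>

definition extremal where "extremal s = s *\<^sub>R (W s - id_blinfun)"

lemma selfadj_extremal: "selfadj (extremal s)"
  unfolding extremal_def by (intro selfadj_intros selfadj_W)

lemma completion_iff_extremal:
  assumes s: "s * s = 1" and X: "selfadj X"
  shows "completion_via s J1 J2 T11 T21 (ext X)
    \<longleftrightarrow> (\<forall>y. s * inner (extremal s y) y \<le> s * inner (X y) y)"
proof -
  have "s * inner (extremal s y) y = inner (W s y) y - inner y y" for y
    using s by (simp add: extremal_def blinfun_simps inner_diff flip: mult.assoc)
  moreover have "inner (shift s X y) y = inner y y + s * inner (X y) y" for y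
    by (simp add: blinfun_simps inner_add)
  ultimately show ?thesis unfolding completion_iff[OF assms] by (simp add: le_diff_eq diff_le_eq add.commute)
qed

lemma krein_le_solutions_iff:
  assumes s: "s * s = 1" and X: "selfadj X" "selfadj Y"
  shows "krein_le J (id_blinfun + s *\<^sub>R ext X) (id_blinfun + s *\<^sub>R ext Y)
    \<longleftrightarrow> (\<forall>y. s * inner (X y) y \<le> s * inner (Y y) y)"
proof -
  from s consider "s = 1" | "s = - 1" by (auto simp: square_eq_1_iff)
  then show ?thesis
  proof cases
    case 1
    then show ?thesis using krein_le_ext_iff[OF X] by (simp add: krein_le_def)
  next
    case 2
    then show ?thesis using krein_le_ext_iff[OF X(2,1)] by (simp add: krein_le_def)
  qed
qed

text \<open>The bound is attained by a solution. Uniqueness, which the definite description in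
  \<open>minimal_completion\<close> relies on, holds since selfadjoint operators with equal forms
  coincide.\<close>

lemma J2_minimal_solution_iff:
  assumes s: "s * s = 1"
  shows "J2_minimal_solution s J1 J2 T11 T21 A \<longleftrightarrow> A = id_blinfun + s *\<^sub>R ext (extremal s)"
proof -
  have sol: "A \<in> completion_solutions s J1 J2 T11 T21 \<longleftrightarrow>
    (\<exists>X. selfadj X \<and> A = id_blinfun + s *\<^sub>R ext X \<and> (\<forall>y. s * inner (extremal s y) y \<le> s * inner (X y) y))" for A
  proof -
    have "completion_via s J1 J2 T11 T21 T \<longleftrightarrow>
      (\<exists>X. selfadj X \<and> T = ext X \<and> (\<forall>y. s * inner (extremal s y) y \<le> s * inner (X y) y))" for T
    proof
      assume T: "completion_via s J1 J2 T11 T21 T"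
      then obtain X where "selfadj X" "T = ext X" unfolding completion_via_iff by blast
      then show "\<exists>X. selfadj X \<and> T = ext X \<and> (\<forall>y. s * inner (extremal s y) y \<le> s * inner (X y) y)"
        using T completion_iff_extremal[OF s] by blast
    qed (use completion_iff_extremal[OF s] in blast)
    then show ?thesis unfolding completion_solutions_def by auto
  qed
  show ?thesis
  proof
    assume "J2_minimal_solution s J1 J2 T11 T21 A"
    then have A: "A \<in> completion_solutions s J1 J2 T11 T21"
      and min: "\<And>A'. A' \<in> completion_solutions s J1 J2 T11 T21 \<Longrightarrow> krein_le J A A'"
      by (auto simp: J2_minimal_solution_def)
    obtain X where X: "selfadj X" "A = id_blinfun + s *\<^sub>R ext X"
        "\<And>y. s * inner (extremal s y) y \<le> s * inner (X y) y"
      using A unfolding sol by blast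
    have "krein_le J A (id_blinfun + s *\<^sub>R ext (extremal s))"
      by (rule min) (use selfadj_extremal in \<open>auto simp: sol\<close>)
    then have "s * inner (X y) y \<le> s * inner (extremal s y) y" for y
      using krein_le_solutions_iff[OF s X(1) selfadj_extremal] unfolding X(2) by blast
    then have "s * inner (X y) y = s * inner (extremal s y) y" for y
      using X(3) by (rule order_antisym)
    moreover have "s \<noteq> 0" using s by auto
    ultimately have "X = extremal s" by (intro selfadj_eqI X(1) selfadj_extremal) simp
    then show "A = id_blinfun + s *\<^sub>R ext (extremal s)" using X by simp
  next
    assume A: "A = id_blinfun + s *\<^sub>R ext (extremal s)"
    show "J2_minimal_solution s J1 J2 T11 T21 A"
      unfolding J2_minimal_solution_def
    proof (intro conjI ballI)
      show "A \<in> completion_solutions s J1 J2 T11 T21" using A selfadj_extremal by (auto simp: sol)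
      fix A' assume "A' \<in> completion_solutions s J1 J2 T11 T21"
      then show "krein_le J A A'"
        using krein_le_solutions_iff[OF s selfadj_extremal] by (auto simp: sol A)
    qed
  qed
qed

lemma minimal_completion_eq:
  "s * s = 1 \<Longrightarrow> minimal_completion s J1 J2 T11 T21 = id_blinfun + s *\<^sub>R ext (extremal s)"
  unfolding minimal_completion_def by (rule the_equality) (simp_all add: J2_minimal_solution_iff)

lemma T_min_eq: "T_min J1 J2 T11 T21 = ext (extremal 1)"
  by (simp add: T_min_def minimal_completion_eq)

lemma T_max_eq: "T_max J1 J2 T11 T21 = ext (extremal (- 1))"
  by (simp add: T_max_def minimal_completion_eq)

text \<open>The terms with \<open>H\<close> cancel in \<open>W 1 + W (- 1)\<close>, leaving twice
  the form that \<open>adj_V_le\<close> bounds.\<close>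

lemma extremal_le: "inner (extremal 1 y) y \<le> inner (extremal (- 1) y) y"
proof -
  have "inner (W 1 y) y + inner (W (- 1) y) y = 2 * inner (sign_op (defect H) (adj V y)) (adj V y)"
    unfolding W_form by (simp add: blinfun_simps inner_add inner_diff)
  also have "\<dots> \<le> 2 * inner y y" using adj_V_le[of y] by (simp add: dot_square_norm)
  finally show ?thesis by (simp add: extremal_def blinfun_simps inner_diff)
qed

lemma ext_in_Ext_set_iff:
  assumes X: "selfadj X"
  shows "ext X \<in> Ext_set J1 J2 T11 T21 \<longleftrightarrow>
    (\<forall>y. inner (extremal 1 y) y \<le> inner (X y) y \<and> inner (X y) y \<le> inner (extremal (- 1) y) y)"
  using completion_iff_extremal[of 1, OF _ X] completion_iff_extremal[of "- 1", OF _ X]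
  by (auto simp: Ext_set_def)

text \<open>In the converse direction \<open>T\<close> is not assumed to extend the column. Both
  bounds have the same form on vectors \<open>(x, 0)\<close>, so the nonnegative difference from the
  lower bound has zero form there and annihilates them.\<close>

lemma Ext_set_iff:
  "T \<in> Ext_set J1 J2 T11 T21 \<longleftrightarrow> krein_selfadjoint J T \<and>
    krein_le J (ext (extremal 1)) T \<and> krein_le J T (ext (extremal (- 1)))"
proof
  assume T: "T \<in> Ext_set J1 J2 T11 T21"
  then obtain X where X: "selfadj X" "T = ext X"
    by (auto simp: Ext_set_def completion_via_iff)
  then show "krein_selfadjoint J T \<and> krein_le J (ext (extremal 1)) T \<and> krein_le J T (ext (extremal (- 1)))"
    using T ext_in_Ext_set_iff[OF X(1)] selfadj_matrix[OF X(1)]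
    by (simp add: krein_le_ext_iff selfadj_extremal krein_selfadjoint_iff[OF fundamental_symmetry_J] J_ext)
next
  assume T: "krein_selfadjoint J T \<and> krein_le J (ext (extremal 1)) T \<and> krein_le J T (ext (extremal (- 1)))"
  define N where "N = J o\<^sub>L T"
  have N: "selfadj N" using T by (simp add: N_def krein_selfadjoint_iff[OF fundamental_symmetry_J])
  let ?m = "matrix (extremal 1)" and ?M = "matrix (extremal (- 1))"
  have m: "J (ext X f) = matrix X f" for X f using J_ext by (metis blinfun_apply_blinfun_compose)
  have le: "inner (?m f) f \<le> inner (N f) f" "inner (N f) f \<le> inner (?M f) f" for f
    using T N krein_le_iff[of J "ext (extremal 1)" T] krein_le_iff[of J T "ext (extremal (- 1))"]
    by (simp_all add: J_ext m selfadj_matrix selfadj_extremal N_def del: split_paired_All)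
  have nn: "nonneg_op (N - ?m)"
    using le by (simp add: nonneg_op_iff selfadj_diff N selfadj_matrix selfadj_extremal
        blinfun_simps inner_diff)
  have T_col: "T (x, 0) = column_op T11 T21 x" for x
  proof -
    have "inner (N (x, 0)) (x, 0) = inner (?m (x, 0)) (x, 0)"
      using le[of "(x, 0)"] by (simp add: matrix_apply inner_prod_def)
    then have "(N - ?m) (x, 0) = 0"
      by (intro nonneg_op_kernel[OF nn]) (simp add: blinfun_simps inner_diff)
    then have "J (N (x, 0)) = J (H x, B x)"
      by (simp add: blinfun_simps matrix_apply)
    then show ?thesis
      by (simp add: N_def fundamental_symmetry_involution[OF fundamental_symmetry_J] J1_H J2_B)
  qed
  have "selfadjoint_extension J1 J2 T11 T21 T"
    using T T_col by (simp add: selfadjoint_extension_def)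
  then obtain X where X: "selfadj X" "T = ext X" unfolding selfadjoint_extension_iff by blast
  then show "T \<in> Ext_set J1 J2 T11 T21"
    using T ext_in_Ext_set_iff[OF X(1)] by (simp add: krein_le_ext_iff selfadj_extremal)
qed

lemma adj_B_eq: "adj B = abs_root (defect H) o\<^sub>L adj V"
proof -
  note R = selfadj_abs_root[OF selfadj_defect[OF selfadj_H]]
  have "B = V o\<^sub>L abs_root (defect H)" by (rule blinfun_eqI) (simp add: V_abs_root)
  then show ?thesis
    using R by (simp add: adj_compose[OF V selfadj_linear[OF R]] selfadj_iff_adj)
qed

lemma ext_extremal_block:
  assumes "s * s = 1"
  shows "ext (extremal s) = block_op T11 (J1 o\<^sub>L abs_root (defect H) o\<^sub>L adj V)
    (J2 o\<^sub>L V o\<^sub>L abs_root (defect H))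
    (s *\<^sub>R (- J2 + (J2 o\<^sub>L V o\<^sub>L (id_blinfun - s *\<^sub>R (J1 o\<^sub>L T11)) o\<^sub>L sign_op (defect H) o\<^sub>L adj V)))"
proof -
  have "J1 (T11 x) = H x" for x by (simp add: H_def)
  then show ?thesis
    by (intro blinfun_eqI) (auto simp: ext_eq adj_B_eq V_abs_root J2_B extremal_def W_def blinfun_simps)
qed

lemma extremal_in_Ext_set:
  "ext (extremal 1) \<in> Ext_set J1 J2 T11 T21" "ext (extremal (- 1)) \<in> Ext_set J1 J2 T11 T21"
  using extremal_le by (simp_all add: ext_in_Ext_set_iff selfadj_extremal)

end

text \<open>\<open>I + s T\<close> equals \<open>I + (- s) (- T)\<close>, so the negated column
  poses the problem of opposite sign with the very same solutions.\<close>

lemma completion_solutions_uminus: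
  assumes T21: "complex_linear T21"
  shows "completion_solutions s J1 J2 (- T11) (- T21) = completion_solutions (- s) J1 J2 T11 T21"
proof -
  have adj: "adj (- X) = - adj X" if "complex_linear X"
    for X :: "'c::complex_hilbert_space \<Rightarrow>\<^sub>L 'd::complex_hilbert_space"
    by (rule adj_eqI) (simp_all add: complex_linear_minus that blinfun_simps inner_adj)
  have krein_adj: "krein_adj J K (- X) = - krein_adj J K X" if "complex_linear X"
    for J :: "'c::complex_hilbert_space \<Rightarrow>\<^sub>L 'c" and K :: "'d::complex_hilbert_space \<Rightarrow>\<^sub>L 'd" and X
    unfolding krein_adj_def adj[OF that] by (rule blinfun_eqI) (simp add: blinfun_simps)
  have sa: "krein_selfadjoint J (- T) \<longleftrightarrow> krein_selfadjoint J T" for J T :: "'c::complex_hilbert_space \<Rightarrow>\<^sub>L 'c"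
  proof -
    have "krein_selfadjoint J (- T)" if "krein_selfadjoint J T" for T
      using that krein_adj[of T J J] by (auto simp: krein_selfadjoint_def complex_linear_minus)
    from this[of T] this[of "- T"] show ?thesis by auto
  qed
  have comp: "A o\<^sub>L (- X) = - (A o\<^sub>L X)" for A :: "'c::real_normed_vector \<Rightarrow>\<^sub>L 'd::real_normed_vector"
      and X :: "'e::real_normed_vector \<Rightarrow>\<^sub>L 'c"
    by (rule blinfun_eqI) (simp add: blinfun_simps)
  have "completion_via s J1 J2 (- T11) (- T21) T \<longleftrightarrow> completion_via (- s) J1 J2 T11 T21 (- T)" for T
  proof -
    have "(\<forall>x. T (x, 0) = column_op (- T11) (- T21) x) \<longleftrightarrow> (\<forall>x. (- T) (x, 0) = column_op T11 T21 x)"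
    proof -
      have "column_op (- T11) (- T21) x = - column_op T11 T21 x" for x
        by (simp add: prod_eq_iff blinfun_simps)
      then show ?thesis unfolding blinfun.minus_left by (metis minus_minus)
    qed
    then show ?thesis
      unfolding completion_via_def selfadjoint_extension_def
      by (simp add: sa krein_adj[OF T21] comp)
  qed
  then show ?thesis
    unfolding completion_solutions_def
    by (auto, metis (no_types) minus_minus scaleR_minus_left scaleR_minus_right,
        metis (no_types) minus_minus scaleR_minus_left scaleR_minus_right)
qed

text \<open>The minimal completion depends only on the set of solutions, so the two problems
  exchange their minimal solutions.\<close>

lemma
  assumes "complex_linear T21"
  shows T_min_uminus: "T_min J1 J2 (- T11) (- T21) = - T_max J1 J2 T11 T21"
    and T_max_uminus: "T_max J1 J2 (- T11) (- T21) = - T_min J1 J2 T11 T21"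
  unfolding T_min_def T_max_def minimal_completion_def J2_minimal_solution_def
    completion_solutions_uminus[OF assms]
  by simp_all

theorem theorem4p2:
  fixes J1 T11 :: "'a::complex_hilbert_space \<Rightarrow>\<^sub>L 'a"
    and J2 :: "'b::complex_hilbert_space \<Rightarrow>\<^sub>L 'b"
    and T21 :: "'a \<Rightarrow>\<^sub>L 'b"
    and \<kappa> :: nat
  assumes "fundamental_symmetry J1"
    and "fundamental_symmetry J2"
    and "krein_selfadjoint J1 T11"
    and "complex_linear T21"
    and "nu_minus (id_blinfun - (adj T11 o\<^sub>L T11)) = enat \<kappa>"
  shows "let J = sum_symmetry J1 J2;
             T1 = column_op T11 T21;
             J11 = sign_op (id_blinfun - (adj T11 o\<^sub>L T11));
             D = sqrt_op (abs_op (id_blinfun - (adj T11 o\<^sub>L T11)));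
             cond = (nu_minus (id_blinfun - (adj T11 o\<^sub>L T11))
                       = nu_minus (id_blinfun - (adj T1 o\<^sub>L T1)));
             Ap = minimal_completion 1 J1 J2 T11 T21;
             Am = minimal_completion (- 1) J1 J2 T11 T21;
             Tm = T_min J1 J2 T11 T21;
             TM = T_max J1 J2 T11 T21
         in ((\<exists>T \<in> Ext_set J1 J2 T11 T21. nu_minus (id_blinfun - (adj T o\<^sub>L T)) = enat \<kappa>)
               \<longleftrightarrow> cond) \<and>
            (cond \<longrightarrow>
              (J2_minimal_solution 1 J1 J2 T11 T21 Ap \<and>
               J2_minimal_solution (- 1) J1 J2 T11 T21 Am) \<and>
              (Tm \<in> Ext_set J1 J2 T11 T21 \<and> TM \<in> Ext_set J1 J2 T11 T21) \<and>
              (\<exists>V. complex_linear V \<and> graph_op V = V_graph J2 T21 D \<and>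
                 Tm = block_op T11 (J1 o\<^sub>L D o\<^sub>L adj V) (J2 o\<^sub>L V o\<^sub>L D)
                   (- J2 + (J2 o\<^sub>L V o\<^sub>L (id_blinfun - (J1 o\<^sub>L T11)) o\<^sub>L J11 o\<^sub>L adj V)) \<and>
                 TM = block_op T11 (J1 o\<^sub>L D o\<^sub>L adj V) (J2 o\<^sub>L V o\<^sub>L D)
                   (J2 - (J2 o\<^sub>L V o\<^sub>L (id_blinfun + (J1 o\<^sub>L T11)) o\<^sub>L J11 o\<^sub>L adj V))) \<and>
              (\<forall>T. T \<in> Ext_set J1 J2 T11 T21 \<longleftrightarrow>
                 krein_selfadjoint J T \<and> krein_le J Tm T \<and> krein_le J T TM) \<and>
              (T_min J1 J2 (- T11) (- T21) = - TM \<and>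
               T_max J1 J2 (- T11) (- T21) = - Tm))"
proof -
  interpret krein_column J1 T11 J2 T21 by unfold_locales (fact assms)+
  have \<kappa>: "nu_minus (defect H) = enat \<kappa>" using assms(5) unfolding defect_T11 .
  let ?R = "abs_root (defect H)"
  have nonempty_if: "\<exists>T \<in> Ext_set J1 J2 T11 T21. nu_minus (id_blinfun - (adj T o\<^sub>L T)) = enat \<kappa>"
    and factor_if: "\<exists>V. contractive_column J1 T11 J2 T21 V \<kappa> \<and> graph_op V = V_graph J2 T21 ?R"
    if cond: "nu_minus (defect H) = nu_minus column_defect"
  proof -
    obtain V where Vs: "complex_linear V" "\<And>x. V (?R x) = B x" "\<And>y. adj V y \<in> closure (range ?R)"
      "graph_op V = closure (moore_penrose ?R O graph_op B)"
      "\<And>y. inner (sign_op (defect H) (adj V y)) (adj V y) \<le> (norm y)\<^sup>2"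
      by (rule contraction_exists[OF \<kappa> cond]) blast
    interpret contractive_column J1 T11 J2 T21 V \<kappa> by unfold_locales (fact \<kappa> Vs)+
    \<comment> \<open>The lower extremal completion is the witness: \<open>defect_nu_minus\<close>
      bounds the index from above, and the corner \<open>column_defect\<close>, whose index is
      \<open>\<kappa>\<close> by \<open>cond\<close>, from below.\<close>
    have "nu_minus (id_blinfun - (adj (ext (extremal 1)) o\<^sub>L ext (extremal 1))) = enat \<kappa>"
      using defect_nu_minus[OF selfadj_extremal extremal_in_Ext_set(1)]
        nu_minus_column_le_ext[of "extremal 1"] \<kappa> cond
      by (simp add: defect_ext selfadj_extremal)
    then show "\<exists>T \<in> Ext_set J1 J2 T11 T21. nu_minus (id_blinfun - (adj T o\<^sub>L T)) = enat \<kappa>"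
      using extremal_in_Ext_set(1) by blast
    have "graph_op V = V_graph J2 T21 ?R" using Vs(4) by (simp add: V_graph_def B_def)
    then show "\<exists>V. contractive_column J1 T11 J2 T21 V \<kappa> \<and> graph_op V = V_graph J2 T21 ?R"
      using contractive_column_axioms by blast
  qed
  show ?thesis
    unfolding Let_def defect_T11 abs_root_def[symmetric]
  proof (rule conjI, goal_cases)
    case 1
    show ?case using nonempty_if index_condition_necessary \<kappa> by auto
  next
    case 2
    show ?case
    proof (rule impI, goal_cases)
      case 1
      then obtain V where Vs: "contractive_column J1 T11 J2 T21 V \<kappa>" "graph_op V = V_graph J2 T21 ?R"
        using factor_if by blast
      interpret contractive_column J1 T11 J2 T21 V \<kappa> by (fact Vs(1))
      show ?case
        using V Vs(2) extremal_in_Ext_set ext_extremal_block[of 1] ext_extremal_block[of "- 1"]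
        unfolding T_min_uminus[OF assms(4)] T_max_uminus[OF assms(4)] T_min_eq T_max_eq Ext_set_iff[symmetric]
        by (auto simp: J2_minimal_solution_iff minimal_completion_eq)
    qed
  qed
qed

end
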